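(* Let $\mathbb P=(P;\leq)=(P;\mu)$ be a poset of finite component size such that $|P|$ is an accessible cardinal. Let $\mathrm{Quo}^{\mathrm e}(\mathbb P)$ be the complete lattice (ordered by inclusion) of all quasiorders of $P$ that include the partial order $\leq$. Then the following three assertions hold. (A) If $\mathrm{cmp}(\mathbb P)\geq 2$, then $\mathrm{Quo}^{\mathrm e}(\mathbb P)$ has a complete generating set $E$ such that $$|E|\leq \mathrm{cp}(\mathbb P)+\mathrm{ce}(\mathbb P).$$ (B) If $\mathbb P$ is a forest and $\mathrm{cmp}(\mathbb P)\geq 2$, then $\mathrm{Quo}^{\mathrm e}(\mathbb P)$ has a complete generating set $E$ such that $$|E|\leq \mathrm{cp}(\mathbb P)+\mathrm{LASp}(\mathrm{ce}(\mathbb P)).$$ (C) If $\mathbb P$ is a finite chain, then $\mathrm{Quo}^{\mathrm e}(\mathbb P)$ is $\mathrm{LASp}(\mathrm{ce}(\mathbb P))$-generated as a complete lattice, but it is not $\bigl(\mathrm{LASp}(\mathrm{ce}(\mathbb P))-1\bigr)$-generated as a complete lattice.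
   Context: **Quasiorders.** A quasiorder (preorder) of a set $X$ is a reflexive and transitive relation on $X$. $\mathrm{Quo}(X)$ is the complete lattice of all quasiorders of $X$, ordered by inclusion. For a poset $\mathbb A=(A;\leq)=(A;\mu)$ (so $\mu$ is another name for the order relation $\leq$), $\mathrm{Quo}^{\mathrm e}(\mathbb A)=\{\rho\in\mathrm{Quo}(A):\mu\subseteq\rho\}$; it is a principal filter of $\mathrm{Quo}(A)$ and a complete lattice. For $x,y\in A$, $\mathrm{qu}_\mu(y,x)$ denotes the least member of $\mathrm{Quo}^{\mathrm e}(\mathbb A)$ containing the pair $(y,x)$. **Generation.** A subset $Y$ of a complete lattice $L$ is a complete generating set if no proper complete sublattice of $L$ includes $Y$. $L$ is $n$-generated (as a complete lattice) if it has a complete generating set with at most $n$ elements. "Generates" always means generation as a complete lattice. **Accessible cardinals.** A cardinal $\eta>\aleph_0$ is strongly inaccessible if for every cardinal $\lambda<\eta$ we have $2^\lambda<\eta$, and for every set $I$ of cardinals smaller than $\eta$, $|I|<\eta$ implies $\sup I<\eta$. A cardinal $\lambda$ is accessible if there is no strongly inaccessible cardinal $\eta$ with $\eta\leq\lambda$. **Posets.** The graph of a poset of finite length (i.e., for some $n\in\{0,1,2,\dots\}$ it has a chain with $n+1$ elements but none with $n+2$ elements) is the undirected graph whose edges are the two-element sets $\{x,y\}$ with $x\prec y$ or $y\prec x$, where $\prec$ is the covering relation. The poset is a forest if this graph contains no circle (cycle) of positive length. The components of $\mathbb P$ are the subposets on the blocks of the least equivalence collapsing all edges; $\mathrm{Comp}(\mathbb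 P)$ is the set of components, and $\mathbb P$ is connected if $|\mathrm{Comp}(\mathbb P)|=1$. $\mathbb P$ is of finite component size if there is a positive integer $k$ such that every component has at most $k$ elements (all posets considered are of finite length). $\mathrm{cmp}(\mathbb P)=|\mathrm{Comp}(\mathbb P)|$, a cardinal. $\mathrm{Edge}(\mathbb X)=\{(x,y):x\prec y\text{ in }\mathbb X\}$, and, for $\mathbb P$ of finite component size, $\mathrm{ce}(\mathbb P)=\max\{|\mathrm{Edge}(\mathbb X)|:\mathbb X\in\mathrm{Comp}(\mathbb P)\}$. $\mathrm{Max}(\mathbb X)$ and $\mathrm{Min}(\mathbb X)$ are the sets of maximal and minimal elements of $\mathbb X$. **$\mathrm{LASp}$.** For a positive integer $n$, $\mathrm{LASp}(n)$ is the smallest positive integer $k$ with $n\leq\binom{k}{\lfloor k/2\rfloor}$; $\mathrm{LASp}(0)=0$. **$f_4$.** For accessible cardinals $x\neq 0$: $f_4(1)=0$, $f_4(2)=2$, $f_4(3)=4$, $f_4(4)=5$, and $f_4(x)=4$ for every accessible $x\geq5$. **$\mathrm{spp}$.** For a finite connected poset $\mathbb X=(X;\leq)=(X;\mu)$: if $|X|=1$, then $\mathrm{spp}(\mathbb X)=0$; if $\mathbb X$ is a chain with more than one element, then $\mathrm{spp}(\mathbb X)=1$; if $\mathbb X$ is not a chain, then $\mathrm{spp}(\mathbb X)$ is the smallest positive integer $k$ such that there is a $(k-1)$-element subset $Y$ of $\mathrm{Quo}^{\mathrm e}(\mathbb X)$ for which $Y\cup\{\mathrm{qu}_\mu(y,x):x\prec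 y\text{ in }\mathbb X\}$ generates $\mathrm{Quo}^{\mathrm e}(\mathbb X)$ (here $\mathrm{qu}_\mu(y,x)$ is taken in $\mathrm{Quo}^{\mathrm e}(\mathbb X)$). **Thread number.** Let $\mathrm{cmp}(\mathbb P)\geq 2$ and let $\mathbb M_1\neq\mathbb M_2$ be components of $\mathbb P$. Let $\mathbb P^{(0)}$ be the subposet of $\mathbb P$ obtained by omitting all elements of $\mathbb M_1$ and $\mathbb M_2$. Define $\mathrm{thn}(\mathbb P,\mathbb M_1,\mathbb M_2)$ as follows. - If $\mathbb P$ is an antichain, it is $1$. - If $\mathbb P$ is not an antichain and $\mathrm{cmp}(\mathbb P)=2$, it is $|\mathrm{Max}(\mathbb M_1)|\cdot|\mathrm{Max}(\mathbb M_2)|+|\mathrm{Min}(\mathbb M_1)|\cdot|\mathrm{Min}(\mathbb M_2)|$. - If $\mathbb P$ is not an antichain and $\mathrm{cmp}(\mathbb P)\geq3$, it is $$\max\{|\mathrm{Max}(\mathbb X)|:\mathbb X\in\mathrm{Comp}(\mathbb P^{(0)})\}\cdot\prod_{i=1}^2|\mathrm{Max}(\mathbb M_i)|+\max\{|\mathrm{Min}(\mathbb X)|:\mathbb X\in\mathrm{Comp}(\mathbb P^{(0)})\}\cdot\prod_{i=1}^2|\mathrm{Min}(\mathbb M_i)|.$$ **Combined parameter.** For $\mathrm{cmp}(\mathbb P)\geq2$, $$\mathrm{cp}(\mathbb P)=\min\bigl\{f_4(\mathrm{cmp}(\mathbb P))\cdot\mathrm{thn}(\mathbb P,\mathbb M_1,\mathbb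 M_2)+\mathrm{spp}(\mathbb M_1)+\mathrm{spp}(\mathbb M_2):\mathbb M_1,\mathbb M_2\in\mathrm{Comp}(\mathbb P),\ \mathbb M_1\neq\mathbb M_2\bigr\}.$$
   Formalization: Complete sublattices are taken closed under all joins, including the empty one, but only nonempty meets; this matters only for the two-element chain, where (C) fails if both empty operations are allowed (0-generated) or neither is (not 1-generated). *)

theory Defs
  imports Complex_Main "HOL-Library.Lub_Glb"
begin

unbundle cardinal_syntax

text \<open>
  A poset is given by its (reflexive) order relation \<open>\<mu>\<close> with \<open>Partial_order \<mu>\<close>; its carrier is
  \<open>Field \<mu>\<close>, and the subposet on a set \<open>B\<close> is \<open>Restr \<mu> B\<close>.
\<close>


section \<open>Generation of complete lattices of sets\<close>

text \<open>
  A complete lattice is a family \<open>L\<close> of sets ordered by inclusion; \<open>isLub L X s\<close> and \<open>isGlb L X s\<close>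
  say that \<open>s\<close> is the join and the meet, respectively, of \<open>X\<close> taken in \<open>L\<close>.

  Convention on empty families: a complete sublattice is closed under all joins, including the
  empty one (so it contains the least element of \<open>L\<close>), and under the meets of nonempty families.
  The choice is immaterial unless \<open>L\<close> has one or two elements, i.e. for the lattices studied below
  unless the poset is a chain of one or two elements: in all other cases treated here a generating
  set in any of the usual senses produces the least and the greatest element by nonempty meets and
  joins. A two-element lattice is generated by its greatest element but not by the empty set
  in the present sense. It would be generated by the empty set if the empty meet were included as
  well, and it would not be generated by any single element if neither empty operation were.
\<close>

definition complete_sublattice :: "'b set set \<Rightarrow> 'b set set \<Rightarrow> bool" where
  "complete_sublattice L S \<longleftrightarrow> S \<subseteq> L
     \<and> (\<forall>X s. X \<subseteq> S \<and> isLub L X s \<longrightarrow> s \<in> S)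
     \<and> (\<forall>X s. X \<subseteq> S \<and> X \<noteq> {} \<and> isGlb L X s \<longrightarrow> s \<in> S)"

definition complete_generating_set :: "'b set set \<Rightarrow> 'b set set \<Rightarrow> bool" where
  "complete_generating_set L Y \<longleftrightarrow> Y \<subseteq> L \<and> \<not> (\<exists>S. complete_sublattice L S \<and> S \<subset> L \<and> Y \<subseteq> S)"

text \<open>The number is an integer, since \<open>-1\<close> arises as one less than a generation number \<open>0\<close>.\<close>

definition n_generated :: "int \<Rightarrow> 'b set set \<Rightarrow> bool" where
  "n_generated n L \<longleftrightarrow> (\<exists>Y. complete_generating_set L Y \<and> finite Y \<and> int (card Y) \<le> n)"


section \<open>Quasiorders\<close>

definition Quo :: "'a set \<Rightarrow> 'a rel set" where
  "Quo A = {\<rho>. preorder_on A \<rho>}"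

definition Quo_e :: "'a rel \<Rightarrow> 'a rel set" where
  "Quo_e \<mu> = {\<rho> \<in> Quo (Field \<mu>). \<mu> \<subseteq> \<rho>}"

definition qu :: "'a rel \<Rightarrow> 'a \<Rightarrow> 'a \<Rightarrow> 'a rel" where
  "qu \<mu> y x = \<Inter> {\<rho> \<in> Quo_e \<mu>. (y, x) \<in> \<rho>}"


section \<open>Accessible cardinals\<close>

definition is_card_sup :: "'a rel set \<Rightarrow> 'a rel \<Rightarrow> bool" where
  "is_card_sup I \<kappa> \<longleftrightarrow> Card_order \<kappa> \<and> (\<forall>\<nu>\<in>I. \<nu> \<le>o \<kappa>)
     \<and> (\<forall>\<kappa>'::'a rel. Card_order \<kappa>' \<and> (\<forall>\<nu>\<in>I. \<nu> \<le>o \<kappa>') \<longrightarrow> \<kappa> \<le>o \<kappa>')"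

text \<open>
  All cardinals below a cardinal \<open>\<eta> :: 'a rel\<close>, as well as their suprema, which are at most \<open>\<eta>\<close>, are
  represented by cardinal orders of type \<open>'a rel\<close>, so quantifying over this type loses nothing.
\<close>

definition strongly_inaccessible :: "'a rel \<Rightarrow> bool" where
  "strongly_inaccessible \<eta> \<longleftrightarrow> Card_order \<eta> \<and> natLeq <o \<eta>
     \<and> (\<forall>\<nu>::'a rel. Card_order \<nu> \<and> \<nu> <o \<eta> \<longrightarrow> ctwo ^c \<nu> <o \<eta>)
     \<and> (\<forall>(I::'a rel set) \<kappa>. (\<forall>\<nu>\<in>I. Card_order \<nu> \<and> \<nu> <o \<eta>) \<and> |I| <o \<eta> \<and> is_card_sup I \<kappa>
          \<longrightarrow> \<kappa> <o \<eta>)"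

definition accessible :: "'a rel \<Rightarrow> bool" where
  "accessible \<kappa> \<longleftrightarrow> Card_order \<kappa> \<and> \<not> (\<exists>\<eta>::'a rel. strongly_inaccessible \<eta> \<and> \<eta> \<le>o \<kappa>)"


section \<open>Posets, their graphs and components\<close>

definition finite_length :: "'a rel \<Rightarrow> bool" where
  "finite_length \<mu> \<longleftrightarrow> (\<exists>n::nat. (\<exists>C\<in>Chains \<mu>. finite C \<and> card C = n + 1)
     \<and> \<not> (\<exists>C\<in>Chains \<mu>. finite C \<and> card C = n + 2))"

definition Edge :: "'a rel \<Rightarrow> 'a rel" where
  "Edge \<mu> = {(x, y). (x, y) \<in> \<mu> \<and> x \<noteq> y
     \<and> \<not> (\<exists>z. z \<noteq> x \<and> z \<noteq> y \<and> (x, z) \<in> \<mu> \<and> (z, y) \<in> \<mu>)}"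

definition graph_edges :: "'a rel \<Rightarrow> 'a set set" where
  "graph_edges \<mu> = {{x, y} | x y. (x, y) \<in> Edge \<mu>}"

definition is_circle :: "'a rel \<Rightarrow> 'a list \<Rightarrow> bool" where
  "is_circle \<mu> vs \<longleftrightarrow> length vs \<ge> 3 \<and> distinct vs
     \<and> (\<forall>i<length vs. {vs ! i, vs ! (Suc i mod length vs)} \<in> graph_edges \<mu>)"

definition forest :: "'a rel \<Rightarrow> bool" where
  "forest \<mu> \<longleftrightarrow> \<not> (\<exists>vs. is_circle \<mu> vs)"

definition component_equiv :: "'a rel \<Rightarrow> 'a rel" where
  "component_equiv \<mu> = \<Inter> {\<theta>. equiv (Field \<mu>) \<theta> \<and> Edge \<mu> \<subseteq> \<theta>}"

definition Comp :: "'a rel \<Rightarrow> 'a rel set" where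
  "Comp \<mu> = (\<lambda>B. Restr \<mu> B) ` (Field \<mu> // component_equiv \<mu>)"

definition finite_component_size :: "'a rel \<Rightarrow> bool" where
  "finite_component_size \<mu> \<longleftrightarrow> finite_length \<mu>
     \<and> (\<exists>k::nat. k > 0 \<and> (\<forall>X\<in>Comp \<mu>. finite (Field X) \<and> card (Field X) \<le> k))"

definition cmp :: "'a rel \<Rightarrow> 'a rel rel" where
  "cmp \<mu> = |Comp \<mu>|"

text \<open>
  For posets of finite component size, the maxima below are those of finite nonempty sets
  of natural numbers, even if there are infinitely many components.
\<close>

definition ce :: "'a rel \<Rightarrow> nat" where
  "ce \<mu> = Max ((\<lambda>X. card (Edge X)) ` Comp \<mu>)"

definition max_elems :: "'a rel \<Rightarrow> 'a set" where
  "max_elems \<mu> = {x \<in> Field \<mu>. \<forall>y. (x, y) \<in> \<mu> \<longrightarrow> y = x}"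

definition min_elems :: "'a rel \<Rightarrow> 'a set" where
  "min_elems \<mu> = {x \<in> Field \<mu>. \<forall>y. (y, x) \<in> \<mu> \<longrightarrow> y = x}"

definition antichain :: "'a rel \<Rightarrow> bool" where
  "antichain \<mu> \<longleftrightarrow> (\<forall>x y. (x, y) \<in> \<mu> \<longrightarrow> x = y)"


section \<open>The numerical parameters\<close>

definition LASp :: "nat \<Rightarrow> nat" where
  "LASp n = (if n = 0 then 0 else LEAST k. k > 0 \<and> n \<le> k choose (k div 2))"

text \<open>\<open>natLeq_on n\<close> is the cardinal \<open>n\<close>. Only nonzero accessible arguments are meaningful.\<close>

definition f4 :: "'b rel \<Rightarrow> nat" where
  "f4 \<kappa> = (if \<kappa> =o natLeq_on 1 then 0
     else if \<kappa> =o natLeq_on 2 then 2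
     else if \<kappa> =o natLeq_on 3 then 4
     else if \<kappa> =o natLeq_on 4 then 5
     else 4)"

text \<open>To be used for finite connected posets only.\<close>

definition spp :: "'a rel \<Rightarrow> nat" where
  "spp \<mu> = (if card (Field \<mu>) = 1 then 0
     else if Linear_order \<mu> then 1
     else LEAST k. k > 0 \<and> (\<exists>Y. Y \<subseteq> Quo_e \<mu> \<and> finite Y \<and> card Y = k - 1
            \<and> complete_generating_set (Quo_e \<mu>) (Y \<union> {qu \<mu> y x | x y. (x, y) \<in> Edge \<mu>})))"

definition thn :: "'a rel \<Rightarrow> 'a rel \<Rightarrow> 'a rel \<Rightarrow> nat" where
  "thn \<mu> M1 M2 =
     (let \<mu>0 = Restr \<mu> (Field \<mu> - (Field M1 \<union> Field M2)) in
      if antichain \<mu> then 1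
      else if cmp \<mu> =o natLeq_on 2 then
        card (max_elems M1) * card (max_elems M2) + card (min_elems M1) * card (min_elems M2)
      else
        Max ((\<lambda>X. card (max_elems X)) ` Comp \<mu>0) * (card (max_elems M1) * card (max_elems M2))
        + Max ((\<lambda>X. card (min_elems X)) ` Comp \<mu>0) * (card (min_elems M1) * card (min_elems M2)))"

definition cp :: "'a rel \<Rightarrow> nat" where
  "cp \<mu> = (LEAST n. \<exists>M1\<in>Comp \<mu>. \<exists>M2\<in>Comp \<mu>. M1 \<noteq> M2
     \<and> n = f4 (cmp \<mu>) * thn \<mu> M1 M2 + spp M1 + spp M2)"

end

theory Submission
  imports Defs
begin

text \<open>
  Everything is reduced to generating, for each pair of points, the least quasiorder containing \<open>\<mu>\<close> and this pair, since every
  quasiorder is a join of such ones.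

  The first ingredient concerns antichains: the lattice of all quasiorders of a set of accessible cardinality has a generating set of at
  most \<open>f4\<close> elements (\<open>f4_generated\<close>). For two, three and four points this is a finite calculation. For all other sizes, four quasiorders are built from
  a coding of the points: a small skeleton of five points, together with a positive point for each coded element, which is related to the
  labels of that element, and negative points, which represent the labels. Labels are earlier elements, and the sets of labels form an antichain, so the meet over
  the labels of \<open>x\<close> singles out \<open>x\<close>, and well-founded induction reaches all points. Accessibility is what makes such a coding
  possible (\<open>coding_exists\<close>): a singular stage is coded by a short cofinal set, any other stage by subsets of something smaller.
  The calculations in the skeleton are straight-line programs of joins and meets; they are verified by enclosing the
  unknown values between a bound on a finite part and a bound pulled back from a finite model.

  The second ingredient moves from the antichain to the poset. A transversal, with one point in each component, carries no order, and its quasiorders lift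
  to the poset by a complete lattice homomorphism (\<open>transversal_generated\<close>). The thread number is the number of transversals
  needed to connect the maximal elements of two distinguished components with those of all the others, and likewise for the minimal elements (\<open>threads\<close>).
  The two distinguished components serve as two alternative routes, and the meet of both routes leaves only the
  intended connection (\<open>everything_generated\<close>). The parameter \<open>spp\<close> accounts for the interior of the distinguished components.

  The third ingredient produces the reversed coverings. A single generator may reverse coverings in all components simultaneously,
  since collapsing one component isolates its trace there. In general one generator per covering is used. In a forest, every
  covering is separated by a cut (\<open>forest_cut\<close>), so it suffices that the coverings of a component are labelled
  by an antichain of sets of generators (\<open>separation_of_cuts\<close>). For chains the same labelling gives the upper bound, and the lower bound
  is Sperner's theorem: the generators that reverse a given covering form such an antichain for any generating set (\<open>chain_lower_bound\<close>).
\<close>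


section \<open>Generating lattices of quasiorders\<close>

text \<open>The join, in \<open>Quo_e \<mu>\<close>, of the quasiorder generated by the pairs in \<open>R\<close>.\<close>

definition qcl :: "'a rel \<Rightarrow> 'a rel \<Rightarrow> 'a rel" where
  "qcl \<mu> R = (\<mu> \<union> R)\<^sup>+"

text \<open>
  The complete sublattice spanned by \<open>Y\<close>, described by the operations instead of as an intersection, so that
  membership can be proved by exhibiting a term. The empty join is allowed, the empty meet is not.
\<close>

inductive_set generated :: "'a rel \<Rightarrow> 'a rel set \<Rightarrow> 'a rel set" for \<mu> Y where
  base: "\<rho> \<in> Y \<Longrightarrow> \<rho> \<in> generated \<mu> Y"
| join: "(\<And>\<rho>. \<rho> \<in> X \<Longrightarrow> \<rho> \<in> generated \<mu> Y) \<Longrightarrow> qcl \<mu> (\<Union>X) \<in> generated \<mu> Y"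
| meet: "X \<noteq> {} \<Longrightarrow> (\<And>\<rho>. \<rho> \<in> X \<Longrightarrow> \<rho> \<in> generated \<mu> Y) \<Longrightarrow> \<Inter>X \<in> generated \<mu> Y"

lemma Quo_e_iff:
  "\<rho> \<in> Quo_e \<mu> \<longleftrightarrow> \<rho> \<subseteq> Field \<mu> \<times> Field \<mu> \<and> Id_on (Field \<mu>) \<subseteq> \<rho> \<and> trans \<rho> \<and> \<mu> \<subseteq> \<rho>"
  unfolding Quo_e_def Quo_def preorder_on_def refl_on_def by auto

lemma Quo_eD:
  assumes "\<rho> \<in> Quo_e \<mu>"
  shows "\<rho> \<subseteq> Field \<mu> \<times> Field \<mu>" "Id_on (Field \<mu>) \<subseteq> \<rho>" "trans \<rho>" "\<mu> \<subseteq> \<rho>"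
  using assms by (simp_all add: Quo_e_iff)

lemma Partial_order_Id_on: "Partial_order \<mu> \<Longrightarrow> Id_on (Field \<mu>) \<subseteq> \<mu>"
  unfolding order_on_defs refl_on_def by auto

lemma trans_qcl: "trans (qcl \<mu> R)"
  by (simp add: qcl_def)

lemma qcl_least: "\<mu> \<subseteq> \<rho> \<Longrightarrow> R \<subseteq> \<rho> \<Longrightarrow> trans \<rho> \<Longrightarrow> qcl \<mu> R \<subseteq> \<rho>"
  unfolding qcl_def by (metis Un_least trancl_id trancl_mono_subset)

lemma qcl_upper: "\<mu> \<subseteq> qcl \<mu> R" "R \<subseteq> qcl \<mu> R"
  unfolding qcl_def by auto

lemma qcl_mono: "R \<subseteq> S \<Longrightarrow> qcl \<mu> R \<subseteq> qcl \<mu> S"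
  unfolding qcl_def by (meson Un_mono order_refl trancl_mono_subset)

lemma qcl_trans: "(a, b) \<in> qcl \<mu> R \<Longrightarrow> (b, c) \<in> qcl \<mu> R \<Longrightarrow> (a, c) \<in> qcl \<mu> R"
  by (meson trans_qcl transD)

lemma qcl_in_Quo_e:
  assumes "Partial_order \<mu>" "R \<subseteq> Field \<mu> \<times> Field \<mu>"
  shows "qcl \<mu> R \<in> Quo_e \<mu>"
proof -
  have "\<mu> \<subseteq> Field \<mu> \<times> Field \<mu>" unfolding Field_def by auto
  then have "qcl \<mu> R \<subseteq> Field \<mu> \<times> Field \<mu>"
    by (intro qcl_least assms) (auto simp: trans_def)
  moreover have "Id_on (Field \<mu>) \<subseteq> qcl \<mu> R"
    using Partial_order_Id_on[OF assms(1)] qcl_upper(1) by blast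
  ultimately show ?thesis
    unfolding Quo_e_iff using trans_qcl qcl_upper(1) by blast
qed

lemma Inter_in_Quo_e:
  assumes "X \<noteq> {}" "X \<subseteq> Quo_e \<mu>"
  shows "\<Inter>X \<in> Quo_e \<mu>"
proof -
  obtain \<sigma> where \<sigma>: "\<sigma> \<in> X" using assms(1) by blast
  have X: "\<rho> \<subseteq> Field \<mu> \<times> Field \<mu>" "Id_on (Field \<mu>) \<subseteq> \<rho>" "trans \<rho>" "\<mu> \<subseteq> \<rho>" if "\<rho> \<in> X" for \<rho>
    using Quo_eD[of \<rho> \<mu>] that assms(2) by auto
  have "trans (\<Inter>X)"
    using trans_INTER[of X "\<lambda>\<rho>. \<rho>"] X(3) by simp
  then show ?thesis
    unfolding Quo_e_iff using Inter_lower[OF \<sigma>] X(1)[OF \<sigma>] X(2,4)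
    by (meson Inter_greatest subset_trans)
qed

lemma isLub_Quo_e:
  assumes "Partial_order \<mu>" "X \<subseteq> Quo_e \<mu>"
  shows "isLub (Quo_e \<mu>) X s \<longleftrightarrow> s = qcl \<mu> (\<Union>X)"
proof -
  have mem: "qcl \<mu> (\<Union>X) \<in> Quo_e \<mu>"
    using Quo_eD(1) assms(2) by (intro qcl_in_Quo_e assms(1) Union_least) auto
  have "isLub (Quo_e \<mu>) X (qcl \<mu> (\<Union>X))"
    unfolding isLub_def leastP_def isUb_def setle_def setge_def
  proof (intro conjI ballI)
    show "\<rho> \<subseteq> qcl \<mu> (\<Union>X)" if "\<rho> \<in> X" for \<rho>
      using that qcl_upper(2)[of "\<Union>X" \<mu>] by blast
    show "qcl \<mu> (\<Union>X) \<subseteq> \<rho>" if "\<rho> \<in> Collect (\<lambda>\<rho>. (\<forall>y\<in>X. y \<subseteq> \<rho>) \<and> \<rho> \<in> Quo_e \<mu>)" for \<rho>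
      using that Quo_eD[of \<rho> \<mu>] by (intro qcl_least) auto
  qed (rule mem)
  moreover have "t \<le> t'" if "isLub (Quo_e \<mu>) X t" "isLub (Quo_e \<mu>) X t'" for t t'
    using that by (meson isLub_isUb isLub_le_isUb)
  ultimately show ?thesis by (auto intro: antisym)
qed

lemma isGlb_Quo_e:
  assumes "X \<noteq> {}" "X \<subseteq> Quo_e \<mu>"
  shows "isGlb (Quo_e \<mu>) X s \<longleftrightarrow> s = \<Inter>X"
proof -
  have "isGlb (Quo_e \<mu>) X (\<Inter>X)"
    unfolding isGlb_def greatestP_def isLb_def setle_def setge_def
    using Inter_in_Quo_e[OF assms] by auto
  moreover have "t \<le> t'" if "isGlb (Quo_e \<mu>) X t" "isGlb (Quo_e \<mu>) X t'" for t t'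
    using that unfolding isGlb_def greatestP_def setle_def by auto
  ultimately show ?thesis by (auto intro: antisym)
qed

lemma generated_in_Quo_e:
  assumes "Partial_order \<mu>" "Y \<subseteq> Quo_e \<mu>" "\<rho> \<in> generated \<mu> Y"
  shows "\<rho> \<in> Quo_e \<mu>"
  using assms(3)
proof induction
  case (base \<rho>)
  then show ?case using assms(2) by blast
next
  case (join X)
  have "\<rho> \<subseteq> Field \<mu> \<times> Field \<mu>" if "\<rho> \<in> X" for \<rho>
    using Quo_eD(1)[OF join(2)[OF that]] .
  then show ?case by (intro qcl_in_Quo_e assms Union_least)
next
  case (meet X)
  then show ?case by (intro Inter_in_Quo_e) auto
qed

text \<open>
  The two descriptions of a span agree because joins and meets in \<open>Quo_e \<mu>\<close> are the hull of the union
  and the intersection.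
\<close>

lemma complete_generating_set_iff_generated:
  assumes "Partial_order \<mu>"
  shows "complete_generating_set (Quo_e \<mu>) Y \<longleftrightarrow> Y \<subseteq> Quo_e \<mu> \<and> Quo_e \<mu> \<subseteq> generated \<mu> Y"
proof (cases "Y \<subseteq> Quo_e \<mu>")
  case True
  note in_Quo = generated_in_Quo_e[OF assms True]
  have generated_sub: "complete_sublattice (Quo_e \<mu>) (generated \<mu> Y)"
    unfolding complete_sublattice_def
  proof (intro conjI allI impI)
    show "generated \<mu> Y \<subseteq> Quo_e \<mu>" using in_Quo by blast
    show "s \<in> generated \<mu> Y" if "X \<subseteq> generated \<mu> Y \<and> isLub (Quo_e \<mu>) X s" for X s
    proof -
      have "X \<subseteq> Quo_e \<mu>" using that in_Quo by blast
      then have "s = qcl \<mu> (\<Union>X)" using that isLub_Quo_e[OF assms, of X s] by simp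
      then show ?thesis using that by (auto intro: generated.join)
    qed
    show "s \<in> generated \<mu> Y" if "X \<subseteq> generated \<mu> Y \<and> X \<noteq> {} \<and> isGlb (Quo_e \<mu>) X s" for X s
    proof -
      have "X \<subseteq> Quo_e \<mu>" using that in_Quo by blast
      then have "s = \<Inter>X" using that isGlb_Quo_e[of X \<mu> s] by simp
      then show ?thesis using that by (auto intro: generated.meet)
    qed
  qed
  have least: "generated \<mu> Y \<subseteq> S" if S: "complete_sublattice (Quo_e \<mu>) S" "Y \<subseteq> S" for S
  proof
    fix \<rho> assume "\<rho> \<in> generated \<mu> Y"
    then show "\<rho> \<in> S"
    proof induction
      case (base \<rho>)
      then show ?case using S by blast
    next
      case (join X)
      then have "X \<subseteq> S" by blast
      moreover from this have "isLub (Quo_e \<mu>) X (qcl \<mu> (\<Union>X))"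
        using S(1) isLub_Quo_e[OF assms, of X] unfolding complete_sublattice_def by auto
      ultimately show ?case using S(1) unfolding complete_sublattice_def by simp
    next
      case (meet X)
      then have "X \<subseteq> S" by blast
      moreover from this have "isGlb (Quo_e \<mu>) X (\<Inter>X)"
        using S(1) meet isGlb_Quo_e[of X \<mu>] unfolding complete_sublattice_def by auto
      ultimately show ?case using S(1) meet(1) unfolding complete_sublattice_def by simp
    qed
  qed
  show ?thesis
  proof
    assume "complete_generating_set (Quo_e \<mu>) Y"
    moreover have "Y \<subseteq> generated \<mu> Y" by (auto intro: generated.base)
    ultimately have "\<not> generated \<mu> Y \<subset> Quo_e \<mu>"
      unfolding complete_generating_set_def using generated_sub by blast
    then show "Y \<subseteq> Quo_e \<mu> \<and> Quo_e \<mu> \<subseteq> generated \<mu> Y"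
      using True in_Quo by blast
  next
    assume "Y \<subseteq> Quo_e \<mu> \<and> Quo_e \<mu> \<subseteq> generated \<mu> Y"
    then show "complete_generating_set (Quo_e \<mu>) Y"
      unfolding complete_generating_set_def using least by (meson psubsetE subset_trans)
  qed
next
  case False
  then show ?thesis by (simp add: complete_generating_set_def)
qed

lemma generated_idem:
  assumes "Y \<subseteq> generated \<mu> Z" shows "generated \<mu> Y \<subseteq> generated \<mu> Z"
proof
  fix \<rho> assume "\<rho> \<in> generated \<mu> Y"
  then show "\<rho> \<in> generated \<mu> Z"
    by induction (use assms in \<open>auto intro: generated.intros\<close>)
qed

lemma generated_mono: "Y \<subseteq> Z \<Longrightarrow> generated \<mu> Y \<subseteq> generated \<mu> Z"
  by (intro generated_idem) (auto intro: generated.base)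

lemma generated_join_family:
  assumes "\<And>i. i \<in> I \<Longrightarrow> f i \<in> generated \<mu> Y"
  shows "qcl \<mu> (\<Union>i\<in>I. f i) \<in> generated \<mu> Y"
  using generated.join[of "f ` I" \<mu> Y] assms by blast

lemma generated_meet_family:
  assumes "I \<noteq> {}" "\<And>i. i \<in> I \<Longrightarrow> f i \<in> generated \<mu> Y"
  shows "(\<Inter>i\<in>I. f i) \<in> generated \<mu> Y"
  using generated.meet[of "f ` I" \<mu> Y] assms by blast

lemma generated_Int: "\<rho> \<in> generated \<mu> Y \<Longrightarrow> \<sigma> \<in> generated \<mu> Y \<Longrightarrow> \<rho> \<inter> \<sigma> \<in> generated \<mu> Y"
  using generated.meet[of "{\<rho>, \<sigma>}" \<mu> Y] by auto

lemma generated_Un: "\<rho> \<in> generated \<mu> Y \<Longrightarrow> \<sigma> \<in> generated \<mu> Y \<Longrightarrow> qcl \<mu> (\<rho> \<union> \<sigma>) \<in> generated \<mu> Y"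
  using generated.join[of "{\<rho>, \<sigma>}" \<mu> Y] by auto

lemma qcl_absorb: "qcl \<mu> (qcl \<mu> R \<union> S) = qcl \<mu> (R \<union> S)"
proof
  show "qcl \<mu> (qcl \<mu> R \<union> S) \<subseteq> qcl \<mu> (R \<union> S)"
    by (intro qcl_least trans_qcl Un_least qcl_upper qcl_mono)
      (use qcl_upper(2)[of "R \<union> S" \<mu>] in auto)
  show "qcl \<mu> (R \<union> S) \<subseteq> qcl \<mu> (qcl \<mu> R \<union> S)"
    by (intro qcl_mono Un_mono order_refl qcl_upper)
qed

lemma qcl_UN_absorb: "qcl \<mu> (\<Union>i\<in>I. qcl \<mu> (f i)) = qcl \<mu> (\<Union>i\<in>I. f i)"
proof
  show "qcl \<mu> (\<Union>i\<in>I. qcl \<mu> (f i)) \<subseteq> qcl \<mu> (\<Union>i\<in>I. f i)"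
    by (intro qcl_least trans_qcl qcl_upper UN_least qcl_mono) blast
  show "qcl \<mu> (\<Union>i\<in>I. f i) \<subseteq> qcl \<mu> (\<Union>i\<in>I. qcl \<mu> (f i))"
    using qcl_upper(2) by (intro qcl_mono) fast
qed

lemma qcl_of_Quo_e: "\<rho> \<in> Quo_e \<mu> \<Longrightarrow> qcl \<mu> \<rho> = \<rho>"
  unfolding qcl_def Quo_e_iff by (simp add: Un_absorb1)

text \<open>Every quasiorder is the join of the principal ones below it.\<close>

lemma qcl_in_generated:
  assumes "\<And>a b. (a, b) \<in> R \<Longrightarrow> qcl \<mu> {(a, b)} \<in> generated \<mu> Y"
  shows "qcl \<mu> R \<in> generated \<mu> Y"
proof -
  have "qcl \<mu> R = qcl \<mu> (\<Union>p\<in>R. qcl \<mu> {p})"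
    by (simp add: qcl_UN_absorb)
  also have "\<dots> \<in> generated \<mu> Y"
    using assms by (intro generated_join_family) auto
  finally show ?thesis .
qed

lemma Quo_e_subset_generated:
  assumes "\<And>a b. a \<in> Field \<mu> \<Longrightarrow> b \<in> Field \<mu> \<Longrightarrow> qcl \<mu> {(a, b)} \<in> generated \<mu> Y"
  shows "Quo_e \<mu> \<subseteq> generated \<mu> Y"
proof
  fix \<rho> assume \<rho>: "\<rho> \<in> Quo_e \<mu>"
  have "qcl \<mu> \<rho> \<in> generated \<mu> Y"
  proof (rule qcl_in_generated)
    show "qcl \<mu> {(a, b)} \<in> generated \<mu> Y" if "(a, b) \<in> \<rho>" for a b
      using that Quo_eD(1)[OF \<rho>] by (intro assms) auto
  qed
  then show "\<rho> \<in> generated \<mu> Y" using qcl_of_Quo_e[OF \<rho>] by simp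
qed

lemma qu_eq_qcl:
  assumes "Partial_order \<mu>" "y \<in> Field \<mu>" "x \<in> Field \<mu>"
  shows "qu \<mu> y x = qcl \<mu> {(y, x)}"
proof
  show "qu \<mu> y x \<subseteq> qcl \<mu> {(y, x)}"
    unfolding qu_def using qcl_in_Quo_e[of \<mu> "{(y,x)}"] assms qcl_upper(2)[of "{(y,x)}" \<mu>]
    by (intro Inter_lower) simp
  show "qcl \<mu> {(y, x)} \<subseteq> qu \<mu> y x"
    unfolding qu_def
  proof (rule Inter_greatest)
    show "qcl \<mu> {(y, x)} \<subseteq> \<rho>" if "\<rho> \<in> {\<rho> \<in> Quo_e \<mu>. (y, x) \<in> \<rho>}" for \<rho>
      using that Quo_eD[of \<rho> \<mu>] by (intro qcl_least) auto
  qed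
qed

text \<open>Adding a single pair \<open>(a, b)\<close> to a transitive and reflexive relation.\<close>

lemma qcl_single:
  assumes "Partial_order \<mu>" "a \<in> Field \<mu>" "b \<in> Field \<mu>"
  shows "qcl \<mu> {(a, b)} = \<mu> \<union> {(x, y). (x, a) \<in> \<mu> \<and> (b, y) \<in> \<mu>}" (is "_ = ?r")
proof
  have tr: "trans \<mu>" and re: "\<And>x. x \<in> Field \<mu> \<Longrightarrow> (x, x) \<in> \<mu>"
    using assms(1) unfolding order_on_defs refl_on_def by auto
  have "trans ?r"
    using tr unfolding trans_def by blast
  then show "qcl \<mu> {(a, b)} \<subseteq> ?r"
    using re assms by (intro qcl_least) auto
  show "?r \<subseteq> qcl \<mu> {(a, b)}"
  proof (clarify, safe)
    fix x y assume "(x, a) \<in> \<mu>" "(b, y) \<in> \<mu>"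
    then have "(x, a) \<in> qcl \<mu> {(a, b)}" "(b, y) \<in> qcl \<mu> {(a, b)}" "(a, b) \<in> qcl \<mu> {(a, b)}"
      using qcl_upper[of \<mu> "{(a, b)}"] qcl_upper(2)[of "{(a, b)}" \<mu>] by auto
    then show "(x, y) \<in> qcl \<mu> {(a, b)}" by (meson qcl_trans)
  qed (use qcl_upper in blast)
qed

text \<open>A complete homomorphism carries hulls into hulls.\<close>

lemma generated_transport:
  assumes "Partial_order \<nu>" "Z \<subseteq> Quo_e \<nu>" "\<rho> \<in> generated \<nu> Z"
    and gens: "\<And>\<rho>. \<rho> \<in> Z \<Longrightarrow> F \<rho> \<in> generated \<mu> Y"
    and join: "\<And>X. X \<subseteq> Quo_e \<nu> \<Longrightarrow> F (qcl \<nu> (\<Union>X)) = qcl \<mu> (\<Union>(F ` X))"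
    and meet: "\<And>X. X \<subseteq> Quo_e \<nu> \<Longrightarrow> X \<noteq> {} \<Longrightarrow> F (\<Inter>X) = \<Inter>(F ` X)"
  shows "F \<rho> \<in> generated \<mu> Y"
  using assms(3)
proof induction
  case (base \<rho>)
  then show ?case by (rule gens)
next
  case (join X)
  then have "X \<subseteq> Quo_e \<nu>" using generated_in_Quo_e[OF assms(1,2)] by blast
  then show ?case using join assms(5) by (auto intro!: generated.join)
next
  case (meet X)
  then have "X \<subseteq> Quo_e \<nu>" using generated_in_Quo_e[OF assms(1,2)] by blast
  then show ?case using meet assms(6) by (auto intro!: generated.meet)
qed

lemma Partial_order_Id_on': "Partial_order (Id_on A)"
  unfolding order_on_defs refl_on_def by (auto simp: Field_def trans_def antisym_def)

lemma Field_Id_on [simp]: "Field (Id_on A) = A"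
  by (auto simp: Field_def)


section \<open>Enclosing quasiorders by finite models\<close>

type_synonym bmat = "bool list list"

definition bmat_rel :: "bmat \<Rightarrow> nat rel" where
  "bmat_rel M = {(i, j). i < length M \<and> j < length (M ! i) \<and> M ! i ! j}"

definition square :: "nat \<Rightarrow> bmat \<Rightarrow> bool" where
  "square n M \<longleftrightarrow> length M = n \<and> (\<forall>row\<in>set M. length row = n)"

definition mat_of :: "nat \<Rightarrow> (nat \<Rightarrow> nat \<Rightarrow> bool) \<Rightarrow> bmat" where
  "mat_of n f = map (\<lambda>i. map (f i) [0..<n]) [0..<n]"

definition mat_or :: "bmat \<Rightarrow> bmat \<Rightarrow> bmat" where
  "mat_or = map2 (map2 (\<or>))"

definition mat_and :: "bmat \<Rightarrow> bmat \<Rightarrow> bmat" where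
  "mat_and = map2 (map2 (\<and>))"

definition warshall_step :: "nat \<Rightarrow> bmat \<Rightarrow> bmat" where
  "warshall_step k M = map (\<lambda>row. if row ! k then map2 (\<or>) row (M ! k) else row) M"

text \<open>
  Correctness of the Warshall algorithm, which computes the joins in a finite model.
\<close>

definition mat_closure :: "nat \<Rightarrow> bmat \<Rightarrow> bmat" where
  "mat_closure n M = fold warshall_step [0..<n] M"

lemma square_nth: "square n M \<Longrightarrow> i < n \<Longrightarrow> length (M ! i) = n"
  by (simp add: square_def)

lemma bmat_rel_iff: "square n M \<Longrightarrow> (i, j) \<in> bmat_rel M \<longleftrightarrow> i < n \<and> j < n \<and> M ! i ! j"
  by (auto simp: bmat_rel_def square_def)

lemma square_mat_of [simp]: "square n (mat_of n f)"
  by (auto simp: square_def mat_of_def)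

lemma bmat_rel_mat_of: "bmat_rel (mat_of n f) = {(i, j). i < n \<and> j < n \<and> f i j}"
  by (auto simp: bmat_rel_def mat_of_def)

lemma square_map2: "square n M \<Longrightarrow> square n N \<Longrightarrow> square n (map2 (map2 f) M N)"
  by (auto simp: square_def set_zip)

lemma square_mat_or: "square n M \<Longrightarrow> square n N \<Longrightarrow> square n (mat_or M N)"
  and square_mat_and: "square n M \<Longrightarrow> square n N \<Longrightarrow> square n (mat_and M N)"
  unfolding mat_or_def mat_and_def by (rule square_map2; assumption)+

lemma bmat_rel_or: "square n M \<Longrightarrow> square n N \<Longrightarrow> bmat_rel (mat_or M N) = bmat_rel M \<union> bmat_rel N"
  by (auto simp: bmat_rel_def mat_or_def square_def)

lemma bmat_rel_and: "square n M \<Longrightarrow> square n N \<Longrightarrow> bmat_rel (mat_and M N) = bmat_rel M \<inter> bmat_rel N"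
  by (auto simp: bmat_rel_def mat_and_def square_def)

lemma square_warshall_step: "square n M \<Longrightarrow> k < n \<Longrightarrow> square n (warshall_step k M)"
  by (auto simp: square_def warshall_step_def)

lemma bmat_rel_warshall_step:
  assumes "square n M" "k < n"
  shows "bmat_rel (warshall_step k M) =
    bmat_rel M \<union> {(i, j). (i, k) \<in> bmat_rel M \<and> (k, j) \<in> bmat_rel M}"
proof -
  have entry: "warshall_step k M ! i ! j \<longleftrightarrow> M ! i ! j \<or> M ! i ! k \<and> M ! k ! j"
    if "i < n" "j < n" for i j
    using that assms square_nth[OF assms(1)] by (simp add: warshall_step_def square_def)
  show ?thesis
    using entry assms(2)
    unfolding set_eq_iff split_paired_All Un_iff mem_Collect_eq case_prod_conv
      bmat_rel_iff[OF assms(1)] bmat_rel_iff[OF square_warshall_step[OF assms]]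
    by blast
qed

text \<open>
  After the steps for the points below \<open>k\<close> the relation is closed under composition through those
  points, and only compositions of pairs have been added.
\<close>

lemma mat_closure_invariant:
  assumes "square n M" "k \<le> n"
  shows "square n (fold warshall_step [0..<k] M)
    \<and> bmat_rel M \<subseteq> bmat_rel (fold warshall_step [0..<k] M)
    \<and> bmat_rel (fold warshall_step [0..<k] M) \<subseteq> (bmat_rel M)\<^sup>+
    \<and> (\<forall>m<k. \<forall>i j. (i, m) \<in> bmat_rel (fold warshall_step [0..<k] M)
         \<and> (m, j) \<in> bmat_rel (fold warshall_step [0..<k] M)
         \<longrightarrow> (i, j) \<in> bmat_rel (fold warshall_step [0..<k] M))"
  using assms(2)
proof (induction k)
  case 0
  then show ?case using assms(1) by auto
next
  case (Suc k)
  define N where "N = fold warshall_step [0..<k] M"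
  have IH: "square n N" "bmat_rel M \<subseteq> bmat_rel N" "bmat_rel N \<subseteq> (bmat_rel M)\<^sup>+"
    "\<And>m i j. m < k \<Longrightarrow> (i, m) \<in> bmat_rel N \<Longrightarrow> (m, j) \<in> bmat_rel N \<Longrightarrow> (i, j) \<in> bmat_rel N"
    using Suc.IH[OF Suc_leD[OF Suc.prems]] unfolding N_def by blast+
  have k: "k < n" using Suc.prems by simp
  have eq: "fold warshall_step [0..<Suc k] M = warshall_step k N"
    by (simp add: N_def)
  note step = bmat_rel_warshall_step[OF IH(1) k]
  have "bmat_rel (warshall_step k N) \<subseteq> (bmat_rel M)\<^sup>+"
    unfolding step
  proof (rule Un_least[OF IH(3)], rule subrelI)
    show "(i, j) \<in> (bmat_rel M)\<^sup>+"
      if "(i, j) \<in> {(i, j). (i, k) \<in> bmat_rel N \<and> (k, j) \<in> bmat_rel N}" for i j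
      using that IH(3) trancl_trans[of i k "bmat_rel M" j] by auto
  qed
  moreover have "(i, j) \<in> bmat_rel (warshall_step k N)"
    if "m < Suc k" "(i, m) \<in> bmat_rel (warshall_step k N)" "(m, j) \<in> bmat_rel (warshall_step k N)"
    for m i j
  proof (cases "m = k")
    case True
    then show ?thesis using that unfolding step by blast
  next
    case False
    then have "m < k" using that by simp
    then show ?thesis using that IH(4)[of m] unfolding step by blast
  qed
  moreover have "bmat_rel M \<subseteq> bmat_rel (warshall_step k N)"
    using IH(2) step by auto
  ultimately show ?case
    unfolding eq using square_warshall_step[OF IH(1) k] by blast
qed

lemma mat_closure:
  assumes "square n M"
  shows "square n (mat_closure n M)" "bmat_rel M \<subseteq> bmat_rel (mat_closure n M)"
    "bmat_rel (mat_closure n M) \<subseteq> (bmat_rel M)\<^sup>+" "trans (bmat_rel (mat_closure n M))"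
proof -
  note inv = mat_closure_invariant[OF assms order_refl, folded mat_closure_def]
  show "square n (mat_closure n M)" "bmat_rel M \<subseteq> bmat_rel (mat_closure n M)"
    "bmat_rel (mat_closure n M) \<subseteq> (bmat_rel M)\<^sup>+"
    using inv by blast+
  show "trans (bmat_rel (mat_closure n M))"
    unfolding trans_def
  proof (intro allI impI)
    fix x y z assume "(x, y) \<in> bmat_rel (mat_closure n M)" "(y, z) \<in> bmat_rel (mat_closure n M)"
    moreover from this have "y < n" using bmat_rel_iff[of n "mat_closure n M" x y] conjunct1[OF inv] by blast
    ultimately show "(x, z) \<in> bmat_rel (mat_closure n M)" using inv by blast
  qed
qed

datatype instr = Join nat "nat list" | Meet nat "nat list"

type_synonym enclosure = "bmat \<times> bmat"

definition fetch :: "enclosure list \<Rightarrow> nat \<Rightarrow> enclosure" where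
  "fetch env i = (if i < length env then env ! i else hd env)"

fun run_instr :: "nat \<Rightarrow> enclosure list \<Rightarrow> instr \<Rightarrow> enclosure" where
  "run_instr n env (Join i is) =
     (let es = map (fetch env) is; e = fetch env i
      in (mat_closure n (fold mat_or (map fst es) (fst e)), mat_closure n (fold mat_or (map snd es) (snd e))))"
| "run_instr n env (Meet i is) =
     (let es = map (fetch env) is; e = fetch env i
      in (fold mat_and (map fst es) (fst e), fold mat_and (map snd es) (snd e)))"

fun exec :: "nat \<Rightarrow> enclosure list \<Rightarrow> instr list \<Rightarrow> enclosure list" where
  "exec n env [] = env"
| "exec n env (ins # prog) = exec n (env @ [run_instr n env ins]) prog"

text \<open>
  If the lower and the upper bound leave no room beyond a pair, then the computed quasiorder is determined.
\<close>

definition pinned :: "nat \<Rightarrow> enclosure list \<Rightarrow> nat \<times> nat \<Rightarrow> bool" where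
  "pinned n es = (\<lambda>(u, v).
     list_ex (\<lambda>(lo, up). lo ! u ! v \<and> up = mat_of n (\<lambda>i j. i = j \<or> i = u \<and> j = v)) es)"

text \<open>
  A large set is compared with a model on \<open>{..<n}\<close>: a map \<open>\<phi>\<close> from the set to the model bounds quasiorders from
  above by pulling back, and finitely many chosen points bound them from below. Both bounds are stable under
  joins and meets.
\<close>

locale finite_model =
  fixes n :: nat and A :: "'p set" and \<phi> :: "'p \<Rightarrow> nat" and \<iota> :: "nat \<Rightarrow> 'p"
  assumes \<phi>_less: "x \<in> A \<Longrightarrow> \<phi> x < n"
begin

definition encloses :: "enclosure \<Rightarrow> 'p rel \<Rightarrow> bool" where
  "encloses e \<rho> \<longleftrightarrow> square n (fst e) \<and> square n (snd e) \<and> (\<forall>i<n. (i, i) \<in> bmat_rel (snd e))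
     \<and> (\<forall>(i, j)\<in>bmat_rel (fst e). (\<iota> i, \<iota> j) \<in> \<rho>) \<and> (\<forall>(x, y)\<in>\<rho>. (\<phi> x, \<phi> y) \<in> bmat_rel (snd e))"

lemma fold_or:
  assumes "square n M" "\<forall>N\<in>set Ns. square n N"
  shows "square n (fold mat_or Ns M) \<and> bmat_rel (fold mat_or Ns M) = bmat_rel M \<union> (\<Union>N\<in>set Ns. bmat_rel N)"
  using assms by (induction Ns arbitrary: M) (auto simp: square_mat_or bmat_rel_or)

lemma fold_and:
  assumes "square n M" "\<forall>N\<in>set Ns. square n N"
  shows "square n (fold mat_and Ns M) \<and> bmat_rel (fold mat_and Ns M) = bmat_rel M \<inter> (\<Inter>N\<in>set Ns. bmat_rel N)"
  using assms by (induction Ns arbitrary: M) (auto simp: square_mat_and bmat_rel_and)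

lemma encloses_join:
  assumes e: "encloses e \<rho>" and es: "list_all2 encloses es \<rho>s" and "\<Union>(set (\<rho> # \<rho>s)) \<subseteq> A \<times> A"
  shows "encloses (mat_closure n (fold mat_or (map fst es) (fst e)),
      mat_closure n (fold mat_or (map snd es) (snd e))) (qcl (Id_on A) (\<Union>(set (\<rho> # \<rho>s))))"
proof -
  have sq: "square n (fst e')" "square n (snd e')" if "e' \<in> set es" for e'
    using that es by (auto simp: encloses_def list_all2_conv_all_nth in_set_conv_nth)
  have sqe: "square n (fst e)" "square n (snd e)" using e by (auto simp: encloses_def)
  define lo up where "lo = fold mat_or (map fst es) (fst e)" and "up = fold mat_or (map snd es) (snd e)"
  have lo: "square n lo" "bmat_rel lo = bmat_rel (fst e) \<union> (\<Union>e'\<in>set es. bmat_rel (fst e'))"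
    unfolding lo_def using fold_or[OF sqe(1), of "map fst es"] sq by auto
  have up: "square n up" "bmat_rel up = bmat_rel (snd e) \<union> (\<Union>e'\<in>set es. bmat_rel (snd e'))"
    unfolding up_def using fold_or[OF sqe(2), of "map snd es"] sq by auto
  let ?R = "qcl (Id_on A) (\<Union>(set (\<rho> # \<rho>s)))"
  have "(\<iota> i, \<iota> j) \<in> \<Union>(set (\<rho> # \<rho>s))" if "(i, j) \<in> bmat_rel lo" for i j
    using that e es unfolding lo(2) encloses_def list_all2_conv_all_nth in_set_conv_nth
    by (fastforce simp: in_set_conv_nth)
  then have edge: "(\<iota> i, \<iota> j) \<in> ?R" if "(i, j) \<in> bmat_rel lo" for i j
    using that qcl_upper(2) by blast
  have "(\<iota> i, \<iota> j) \<in> ?R" if "(i, j) \<in> (bmat_rel lo)\<^sup>+" for i j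
    using that
  proof (induction rule: trancl_induct)
    case (base j)
    then show ?case by (rule edge)
  next
    case (step j k)
    then show ?case by (intro qcl_trans[OF step.IH edge])
  qed
  then have 1: "(\<iota> i, \<iota> j) \<in> ?R" if "(i, j) \<in> bmat_rel (mat_closure n lo)" for i j
    using that mat_closure(3)[OF lo(1)] by blast
  let ?S = "{(x, y) \<in> A \<times> A. (\<phi> x, \<phi> y) \<in> bmat_rel (mat_closure n up)}"
  have "(\<phi> x, \<phi> y) \<in> bmat_rel up" if "(x, y) \<in> \<Union>(set (\<rho> # \<rho>s))" for x y
    using that e es unfolding up(2) encloses_def list_all2_conv_all_nth in_set_conv_nth
    by (fastforce simp: in_set_conv_nth)
  then have "\<Union>(set (\<rho> # \<rho>s)) \<subseteq> ?S"
    using assms(3) mat_closure(2)[OF up(1)] by auto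
  moreover have diag: "(i, i) \<in> bmat_rel (mat_closure n up)" if "i < n" for i
    using that e mat_closure(2)[OF up(1)] unfolding up(2) encloses_def by blast
  moreover have "trans ?S"
    using mat_closure(4)[OF up(1)] unfolding trans_def by blast
  ultimately have 2: "?R \<subseteq> ?S"
    using \<phi>_less by (intro qcl_least) auto
  show ?thesis
    unfolding encloses_def lo_def[symmetric] up_def[symmetric] fst_conv snd_conv
    using mat_closure(1)[OF lo(1)] mat_closure(1)[OF up(1)] 1 2 diag by blast
qed

lemma encloses_meet:
  assumes e: "encloses e \<rho>" and es: "list_all2 encloses es \<rho>s"
  shows "encloses (fold mat_and (map fst es) (fst e), fold mat_and (map snd es) (snd e)) (\<Inter>(set (\<rho> # \<rho>s)))"
proof -
  have sq: "square n (fst e')" "square n (snd e')" if "e' \<in> set es" for e'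
    using that es by (auto simp: encloses_def list_all2_conv_all_nth in_set_conv_nth)
  have sqe: "square n (fst e)" "square n (snd e)" using e by (auto simp: encloses_def)
  define lo up where "lo = fold mat_and (map fst es) (fst e)" and "up = fold mat_and (map snd es) (snd e)"
  have lo: "square n lo" "bmat_rel lo = bmat_rel (fst e) \<inter> (\<Inter>e'\<in>set es. bmat_rel (fst e'))"
    unfolding lo_def using fold_and[OF sqe(1), of "map fst es"] sq by auto
  have up: "square n up" "bmat_rel up = bmat_rel (snd e) \<inter> (\<Inter>e'\<in>set es. bmat_rel (snd e'))"
    unfolding up_def using fold_and[OF sqe(2), of "map snd es"] sq by auto
  have "\<forall>(i, j)\<in>bmat_rel lo. (\<iota> i, \<iota> j) \<in> \<Inter>(set (\<rho> # \<rho>s))"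
    using e es unfolding lo(2) encloses_def list_all2_conv_all_nth
    by (fastforce simp: in_set_conv_nth)
  moreover have "\<forall>(x, y)\<in>\<Inter>(set (\<rho> # \<rho>s)). (\<phi> x, \<phi> y) \<in> bmat_rel up"
    using e es unfolding up(2) encloses_def list_all2_conv_all_nth
    by (fastforce simp: in_set_conv_nth)
  moreover have "\<forall>i<n. (i, i) \<in> bmat_rel up"
    using e es unfolding up(2) encloses_def list_all2_conv_all_nth
    by (fastforce simp: in_set_conv_nth)
  ultimately show ?thesis
    unfolding encloses_def lo_def[symmetric] up_def[symmetric] fst_conv snd_conv
    using lo(1) up(1) by blast
qed

definition realised :: "'p rel set \<Rightarrow> enclosure \<Rightarrow> bool" where
  "realised Y e \<longleftrightarrow> (\<exists>\<rho>\<in>generated (Id_on A) Y. encloses e \<rho>)"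

context
  fixes Y :: "'p rel set"
  assumes Y: "Y \<subseteq> Quo_e (Id_on A)"
begin

lemma realised_list:
  assumes "\<forall>e\<in>set es. realised Y e"
  obtains \<rho>s where "list_all2 encloses es \<rho>s" "set \<rho>s \<subseteq> generated (Id_on A) Y"
  using assms
proof (induction es arbitrary: thesis)
  case Nil
  show ?case by (rule Nil(1)[of "[]"]) auto
next
  case (Cons e es)
  from Cons.prems(2) obtain \<rho> where "\<rho> \<in> generated (Id_on A) Y" "encloses e \<rho>"
    by (auto simp: realised_def)
  moreover obtain \<rho>s where "list_all2 encloses es \<rho>s" "set \<rho>s \<subseteq> generated (Id_on A) Y"
    using Cons.IH Cons.prems(2) by auto
  ultimately show ?case by (intro Cons.prems(1)[of "\<rho> # \<rho>s"]) auto
qed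

lemma realised_run_instr:
  assumes "env \<noteq> []" "\<forall>e\<in>set env. realised Y e"
  shows "realised Y (run_instr n env ins)"
proof -
  have fetch: "realised Y (fetch env i)" for i
    using assms by (auto simp: fetch_def)
  have carrier: "\<rho> \<subseteq> A \<times> A" if "\<rho> \<in> generated (Id_on A) Y" for \<rho>
    using Quo_eD(1)[OF generated_in_Quo_e[OF Partial_order_Id_on' Y that]] by simp
  obtain k ks where ks: "ins = Join k ks \<or> ins = Meet k ks"
    by (cases ins) auto
  obtain \<rho> where \<rho>: "\<rho> \<in> generated (Id_on A) Y" "encloses (fetch env k) \<rho>"
    using fetch[of k] by (auto simp: realised_def)
  obtain \<rho>s where \<rho>s: "list_all2 encloses (map (fetch env) ks) \<rho>s" "set \<rho>s \<subseteq> generated (Id_on A) Y"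
    using realised_list[of "map (fetch env) ks"] fetch by auto
  have sub: "\<sigma> \<in> generated (Id_on A) Y" if "\<sigma> \<in> set (\<rho> # \<rho>s)" for \<sigma>
    using that \<rho>(1) \<rho>s(2) by auto
  then have "\<Union>(set (\<rho> # \<rho>s)) \<subseteq> A \<times> A" using carrier by (intro Union_least) simp
  note J = encloses_join[OF \<rho>(2) \<rho>s(1) this] and M = encloses_meet[OF \<rho>(2) \<rho>s(1)]
  have "qcl (Id_on A) (\<Union>(set (\<rho> # \<rho>s))) \<in> generated (Id_on A) Y"
    by (rule generated.join[OF sub])
  moreover have "\<Inter>(set (\<rho> # \<rho>s)) \<in> generated (Id_on A) Y"
    by (rule generated.meet[OF _ sub]) simp
  ultimately have "realised Y (run_instr n env (Join k ks)) \<and> realised Y (run_instr n env (Meet k ks))"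
    unfolding realised_def run_instr.simps Let_def
    using J M by (intro conjI bexI[where x = "qcl (Id_on A) (\<Union>(set (\<rho> # \<rho>s)))"]
        bexI[where x = "\<Inter>(set (\<rho> # \<rho>s))"])
  then show ?thesis using ks by auto
qed

lemma realised_exec:
  assumes "env \<noteq> []" "\<forall>e\<in>set env. realised Y e"
  shows "\<forall>e\<in>set (exec n env prog). realised Y e"
  using assms
proof (induction prog arbitrary: env)
  case Nil
  show ?case unfolding exec.simps by (rule Nil(2))
next
  case (Cons ins prog)
  have "\<forall>e\<in>set (env @ [run_instr n env ins]). realised Y e"
    unfolding set_append list.set ball_Un using Cons.prems(2) realised_run_instr[OF Cons.prems, of ins]
    by blast
  from Cons.IH[OF _ this] show ?case
    unfolding exec.simps by blast
qed

lemma pinned: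
  assumes "env \<noteq> []" "\<forall>e\<in>set env. realised Y e" "list_all (pinned n (exec n env prog)) ps"
    and uv: "(u, v) \<in> set ps" "u < n" "v < n"
  shows "\<exists>\<rho>\<in>generated (Id_on A) Y. (\<iota> u, \<iota> v) \<in> \<rho> \<and>
    (\<forall>(x, y)\<in>\<rho>. \<phi> x = \<phi> y \<or> \<phi> x = u \<and> \<phi> y = v)"
proof -
  have "pinned n (exec n env prog) (u, v)"
    using assms(3) uv(1) by (simp add: list_all_iff)
  then obtain lo up where lo: "(lo, up) \<in> set (exec n env prog)" "lo ! u ! v"
    and up: "up = mat_of n (\<lambda>i j. i = j \<or> i = u \<and> j = v)"
    by (auto simp: pinned_def list_ex_iff)
  obtain \<rho> where \<rho>: "\<rho> \<in> generated (Id_on A) Y" "encloses (lo, up) \<rho>"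
    using realised_exec[OF assms(1,2)] lo(1) unfolding realised_def by blast
  have "(u, v) \<in> bmat_rel lo"
    using \<rho>(2) lo(2) uv(2,3) by (auto simp: encloses_def bmat_rel_iff)
  then have "(\<iota> u, \<iota> v) \<in> \<rho>" using \<rho>(2) by (auto simp: encloses_def)
  moreover have "\<forall>(x, y)\<in>\<rho>. \<phi> x = \<phi> y \<or> \<phi> x = u \<and> \<phi> y = v"
    using \<rho>(2) unfolding encloses_def up snd_conv bmat_rel_mat_of by auto
  ultimately show ?thesis using \<rho>(1) by blast
qed

end

end


section \<open>Four generators\<close>

datatype 'w point = Base nat | Plus 'w | Minus 'w

fun kind :: "'w point \<Rightarrow> nat" where
  "kind (Base i) = i"
| "kind (Plus x) = 5"
| "kind (Minus x) = 6"

fun flip :: "'w point \<Rightarrow> 'w point" where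
  "flip (Base i) = Base (4 - i)"
| "flip (Plus x) = Plus x"
| "flip (Minus x) = Minus x"

text \<open>
  The points \<open>Base 0, \<dots>, Base 4\<close> form a rigid skeleton, which is the part that the programs analyse; every
  coded element contributes a positive point and, if it may serve as a label, a negative one. The tables list the comparabilities between kinds of points:
  \<open>ta\<close> is an order with the chain 0, 1, 2, 3, 4, in which the negative points lie between 1 and 3; \<open>tb\<close> has three
  layers; \<open>tg\<close> and \<open>td\<close> are dual to each other.
\<close>

definition ta :: "(nat \<times> nat) list" where
  "ta = [(0,1),(0,2),(0,3),(0,4),(1,2),(1,3),(1,4),(2,3),(2,4),(3,4),(0,5),(5,4),(0,6),(6,4),(1,6),(6,3)]"

definition tb :: "(nat \<times> nat) list" where
  "tb = [(4,3),(3,4),(0,1),(1,0),(4,2),(4,5),(4,6),(3,2),(3,5),(3,6),(2,0),(2,1),(5,0),(5,1),(6,0),(6,1),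
     (4,0),(4,1),(3,0),(3,1)]"

definition tg :: "(nat \<times> nat) list" where
  "tg = [(4,2),(3,0),(3,2),(1,4),(1,2),(5,4),(5,0),(5,2),(6,4),(6,2)]"

definition td :: "(nat \<times> nat) list" where
  "td = [(2,0),(4,1),(2,1),(0,3),(2,3),(4,5),(2,5),(0,5),(2,6),(0,6)]"

definition table_mat :: "nat list \<Rightarrow> nat list \<Rightarrow> (nat \<times> nat) list list \<Rightarrow> (nat \<times> nat) list \<Rightarrow> bmat" where
  "table_mat \<tau> L Ts ps = mat_of (length \<tau>) (\<lambda>i j. List.member L i \<and> List.member L j \<and>
     (i = j \<or> List.member ps (i, j) \<or> list_all (\<lambda>T. List.member T (\<tau> ! i, \<tau> ! j)) Ts))"

definition table_encl ::
  "nat list \<Rightarrow> nat list \<Rightarrow> (nat \<times> nat) list list \<Rightarrow> (nat \<times> nat) list \<Rightarrow> (nat \<times> nat) list \<Rightarrow> enclosure" where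
  "table_encl \<tau> L Ts ps qs = (table_mat \<tau> L Ts ps, table_mat \<tau> [0..<length \<tau>] Ts (ps @ qs))"

definition arrow_encl :: "nat list \<Rightarrow> nat list \<Rightarrow> nat \<times> nat \<Rightarrow> enclosure" where
  "arrow_encl \<tau> L p = table_encl \<tau> L [[]] [p] []"

definition base_model :: "nat list" where "base_model = [0,1,2,3,4,5,6]"

definition base_env :: "enclosure list" where
  "base_env = (let e = table_encl base_model [0,1,2,3,4] in
    [e [ta] [] [], e [tb] [] [(5,6),(6,5)], e [tg] [] [(5,6),(5,3),(5,1)],
     e [td] [] [(6,5),(1,5),(3,5)],
     e [ta,tb] [] [], e [ta,tg] [] [], e [ta,td] [] [],
     e [tb,tg] [] [(5,1)], e [tb,td] [] [(3,5)]])"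

text \<open>
  The straight-line programs of joins and meets were found by a computer search; only the enclosures that
  they produce have to be verified.
\<close>

definition base_prog :: "instr list" where
  "base_prog = [Join 3 [7], Meet 4 [9], Join 4 [7], Join 3 [4], Join 7 [8], Meet 11 [12,13],
    Join 2 [8], Meet 4 [15], Join 5 [10], Join 6 [16], Meet 17 [18], Join 0 [14],
    Meet 8 [20], Meet 7 [20], Join 6 [22], Meet 17 [23], Join 5 [21], Meet 25 [18],
    Join 1 [24], Meet 5 [27], Join 1 [26], Meet 6 [29], Join 2 [30], Meet 8 [31],
    Join 3 [28], Meet 7 [33], Join 24 [30], Meet 35 [3], Join 28 [32], Meet 37 [1],
    Join 26 [28], Meet 39 [2], Join 22 [32], Meet 41 [2], Join 21 [34], Meet 43 [3],
    Join 30 [34], Meet 45 [1], Join 19 [46], Meet 36 [47], Join 2 [46], Meet 38 [49],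
    Join 36 [38], Join 40 [46], Meet 51 [52], Join 14 [38], Meet 42 [54], Join 38 [44],
    Join 42 [46], Meet 56 [57]]"

lemma base_pinned:
  "list_all (pinned 7 (exec 7 base_env base_prog))
     [(0,1),(0,2),(0,3),(0,4),(1,0),(1,2),(1,3),(2,0),(2,1),(3,0),(3,1),(4,0)]"
  by code_simp

definition minus_model :: "nat list" where "minus_model = [0,1,2,3,4,6,5,5,6]"

definition minus_env :: "enclosure list" where
  "minus_env = (let e = table_encl minus_model [0,1,2,3,4,5,6]; k = arrow_encl minus_model [0,1,2,3,4,5,6] in
    [e [ta] [] [], e [tb] [] [(6,8),(8,6),(7,5),(5,7),(7,8),(8,7)],
     e [tg] [(6,5)] [(6,8),(7,8),(6,3),(6,1),(7,3),(7,1)],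
     k (0,3), k (0,5), k (3,0), k (3,1), k (4,2), k (4,5), k (5,0), k (5,1), k (5,3)])"

definition minus_prog :: "instr list" where
  "minus_prog = [Join 0 [8], Join 1 [4], Meet 2 [12,13], Join 11 [14], Join 0 [7], Join 2 [3],
    Meet 15 [16,17], Join 5 [18], Join 9 [14], Meet 19 [20], Join 6 [18], Join 10 [14], Meet 22 [23]]"

lemma minus_pinned: "list_all (pinned 9 (exec 9 minus_env minus_prog)) [(6,0),(6,1)]"
  by code_simp

definition sink_model :: "nat list" where "sink_model = [0,1,2,3,4,5,5,6]"

definition sink1_env :: "enclosure list" where
  "sink1_env = (let e = table_encl sink_model [0,1,2,3,4,5]; k = arrow_encl sink_model [0,1,2,3,4,5] in
    [e [ta] [] [], e [tb] [] [(5,7),(7,5),(6,7),(7,6)], e [tg] [(5,1)] [(5,7),(6,7),(5,3),(6,3)],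
     k (0,3), k (1,0), k (1,3), k (3,0), k (3,1), k (4,1), k (4,3)])"

definition sink1_prog :: "instr list" where
  "sink1_prog = [Join 0 [8], Meet 2 [1,10], Join 2 [3], Join 0 [9], Join 2 [5], Meet 12 [13,14],
    Join 4 [11], Join 6 [15], Meet 16 [17], Join 7 [15], Join 8 [15], Meet 11 [19,20]]"

lemma sink1_pinned: "list_all (pinned 8 (exec 8 sink1_env sink1_prog)) [(5,0),(5,1)]"
  by code_simp

definition sink3_env :: "enclosure list" where
  "sink3_env = (let e = table_encl sink_model [0,1,2,3,4,5]; k = arrow_encl sink_model [0,1,2,3,4,5] in
    [e [ta] [] [], e [tb] [] [(5,7),(7,5),(6,7),(7,6)], e [tg] [(5,3)] [(5,7),(6,7),(5,1),(6,1)],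
     k (1,0), k (3,0), k (3,1), k (4,1), k (4,3)])"

definition sink3_prog :: "instr list" where
  "sink3_prog = [Join 2 [5], Join 0 [6], Join 2 [6], Meet 8 [1,9,10], Join 0 [7], Meet 2 [12],
    Join 3 [11], Join 4 [13], Meet 14 [15], Join 5 [13], Join 6 [13], Meet 11 [17,18]]"

lemma sink3_pinned: "list_all (pinned 8 (exec 8 sink3_env sink3_prog)) [(5,0),(5,1)]"
  by code_simp

definition partner_model :: "nat list" where "partner_model = [0,1,2,3,4,5,6,5,6]"

definition partner_env :: "enclosure list" where
  "partner_env = (let e = table_encl partner_model [0,1,2,3,4,5,6]; k = arrow_encl partner_model [0,1,2,3,4,5,6] in
    [e [ta] [] [], e [tb] [(5,6),(6,5)] [(7,8),(8,7)],
     e [tg] [] [(5,8),(7,8),(7,6),(5,3),(5,1),(7,3),(7,1)],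
     k (2,0), k (3,0), k (3,1), k (3,5), k (4,5), k (5,0), k (5,1)])"

definition partner_prog :: "instr list" where
  "partner_prog = [Join 0 [6], Join 2 [7], Meet 10 [1,11], Join 0 [5], Join 8 [12], Join 0 [4],
    Join 2 [3], Meet 14 [15,16], Join 9 [12], Meet 18 [13]]"

lemma partner_pinned: "list_all (pinned 9 (exec 9 partner_env partner_prog)) [(6,0),(6,1)]"
  by code_simp


definition flip_kind :: "nat \<Rightarrow> nat" where "flip_kind i = (if i < 5 then 4 - i else i)"

definition table_trans :: "(nat \<times> nat) list \<Rightarrow> bool" where
  "table_trans T \<longleftrightarrow> list_all (\<lambda>(i, j). list_all (\<lambda>(j', k).
     j = j' \<longrightarrow> i = k \<and> i < 5 \<or> List.member T (i, k)) T) T"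

definition table_dual :: "(nat \<times> nat) list \<Rightarrow> (nat \<times> nat) list \<Rightarrow> bool" where
  "table_dual T T' \<longleftrightarrow> list_all (\<lambda>(i, j). List.member T' (flip_kind j, flip_kind i)) T"

lemma tables_trans: "table_trans ta" "table_trans tb" "table_trans tg" "table_trans td"
  by code_simp+

lemma tables_dual: "table_dual ta ta" "table_dual tb tb" "table_dual tg td" "table_dual td tg"
  by code_simp+

lemma extension_facts:
  "(6, v) \<in> set tb \<longleftrightarrow> (5, v) \<in> set tb" "(v, 6) \<in> set tb \<longleftrightarrow> (v, 5) \<in> set tb"
  "(6, v) \<in> set tg \<Longrightarrow> (5, v) \<in> set tg" "(1, v) \<in> set tg \<Longrightarrow> (5, v) \<in> set tg"
  "(3, v) \<in> set tg \<Longrightarrow> (5, v) \<in> set tg" "(v, 5) \<notin> set tg"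
  "(v, 6) \<in> set td \<Longrightarrow> (v, 5) \<in> set td" "(v, 1) \<in> set td \<Longrightarrow> (v, 5) \<in> set td"
  "(v, 3) \<in> set td \<Longrightarrow> (v, 5) \<in> set td" "(5, v) \<notin> set td"
  unfolding tb_def tg_def td_def by auto

lemma table_transD:
  assumes "table_trans T" "(i, j) \<in> set T" "(j, k) \<in> set T"
  shows "i = k \<and> i < 5 \<or> (i, k) \<in> set T"
proof -
  have "list_all (\<lambda>(j', k). j = j' \<longrightarrow> i = k \<and> i < 5 \<or> List.member T (i, k)) T"
    using assms(1,2) unfolding table_trans_def list_all_iff by fastforce
  then show ?thesis using assms(3) unfolding list_all_iff by fastforce
qed

lemma table_dualD: "table_dual T T' \<Longrightarrow> (i, j) \<in> set T \<Longrightarrow> (flip_kind j, flip_kind i) \<in> set T'"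
  unfolding table_dual_def list_all_iff by fastforce

text \<open>
  A code attaches to every \<open>x\<close> a set \<open>R x\<close> of labels, which are earlier elements or one of the two sinks. The
  third generator sends the positive point of \<open>x\<close> to its labels. If no set of labels contains another one, the
  intersection over \<open>R x\<close> of what can be joined to each label isolates the positive point of \<open>x\<close>; this is the reason why four
  generators reach all points by well-founded induction.
\<close>

locale antichain_code =
  fixes P M :: "'w set" and R :: "'w \<Rightarrow> ('w + nat) set" and lt :: "'w rel"
  assumes wf_lt: "wf lt"
    and M_sub: "M \<subseteq> P"
    and R_nonempty: "x \<in> P \<Longrightarrow> R x \<noteq> {}"
    and R_sub: "x \<in> P \<Longrightarrow> R x \<subseteq> Inl ` {y \<in> M. (y, x) \<in> lt} \<union> Inr ` {1, 3}"
    and R_antichain: "x \<in> P \<Longrightarrow> y \<in> P \<Longrightarrow> R x \<subseteq> R y \<Longrightarrow> x = y"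
begin

definition A :: "'w point set" where
  "A = Base ` {..<5} \<union> Plus ` P \<union> Minus ` M"

lemma in_A [simp]: "Base i \<in> A \<longleftrightarrow> i < 5" "Plus x \<in> A \<longleftrightarrow> x \<in> P" "Minus x \<in> A \<longleftrightarrow> x \<in> M"
  by (auto simp: A_def)

fun label :: "'w + nat \<Rightarrow> 'w point" where
  "label (Inl y) = Minus y"
| "label (Inr s) = Base s"

lemma R_cases:
  assumes "x \<in> P" "l \<in> R x"
  obtains y where "l = Inl y" "y \<in> M" "(y, x) \<in> lt" | "l = Inr 1" | "l = Inr 3"
  using R_sub[OF assms(1)] assms(2) by auto

lemma not_self: "x \<in> P \<Longrightarrow> Inl x \<notin> R x"
  using R_sub[of x] wf_irrefl[OF wf_lt, of x] by auto

definition tabrel :: "(nat \<times> nat) list \<Rightarrow> 'w point rel" where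
  "tabrel T = {(p, q). p \<in> A \<and> q \<in> A \<and> (p = q \<or> (kind p, kind q) \<in> set T)}"

definition E\<beta> :: "'w point rel" where
  "E\<beta> = {(p, q). \<exists>x\<in>M. p = Plus x \<and> q = Minus x \<or> p = Minus x \<and> q = Plus x}"

definition E\<gamma> :: "'w point rel" where
  "E\<gamma> = {(p, q). \<exists>x\<in>P. \<exists>l\<in>R x. p = Plus x \<and> q = label l}"

definition E\<delta> :: "'w point rel" where
  "E\<delta> = {(p, q). \<exists>x\<in>P. \<exists>l\<in>R x. p = flip (label l) \<and> q = Plus x}"

definition \<alpha> where "\<alpha> = tabrel ta"
definition \<beta> where "\<beta> = tabrel tb \<union> E\<beta>"
definition \<gamma> where "\<gamma> = tabrel tg \<union> E\<gamma>"
definition \<delta> where "\<delta> = tabrel td \<union> E\<delta>"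

lemma trans_extension:
  assumes "table_trans T" "E \<subseteq> A \<times> A"
    and "\<And>p q v. (p, q) \<in> E \<Longrightarrow> (kind q, v) \<in> set T \<Longrightarrow> (kind p, v) \<in> set T"
    and "\<And>p q v. (p, q) \<in> E \<Longrightarrow> (v, kind p) \<in> set T \<Longrightarrow> (v, kind q) \<in> set T"
    and "\<And>p q r. (p, q) \<in> E \<Longrightarrow> (q, r) \<in> E \<Longrightarrow> p = r"
  shows "trans (tabrel T \<union> E)"
proof (rule transI)
  fix p q r assume pq: "(p, q) \<in> tabrel T \<union> E" and qr: "(q, r) \<in> tabrel T \<union> E"
  have mem: "p \<in> A" "q \<in> A" "r \<in> A" using pq qr assms(2) by (auto simp: tabrel_def)
  have "p = q \<or> (kind p, kind q) \<in> set T \<or> (p, q) \<in> E" "q = r \<or> (kind q, kind r) \<in> set T \<or> (q, r) \<in> E"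
    using pq qr by (auto simp: tabrel_def)
  then consider "p = q" | "q = r" | "(kind p, kind q) \<in> set T" "(kind q, kind r) \<in> set T"
    | "(kind p, kind q) \<in> set T" "(q, r) \<in> E" | "(p, q) \<in> E" "(kind q, kind r) \<in> set T"
    | "(p, q) \<in> E" "(q, r) \<in> E"
    by blast
  then have "(p, r) \<in> E \<or> p = r \<or> (kind p, kind r) \<in> set T"
  proof cases
    case 1 then show ?thesis using qr by (auto simp: tabrel_def)
  next
    case 2 then show ?thesis using pq by (auto simp: tabrel_def)
  next
    case 3
    then have "kind p = kind r \<and> kind p < 5 \<or> (kind p, kind r) \<in> set T"
      by (rule table_transD[OF assms(1)])
    then show ?thesis by (cases p; cases r) auto
  next
    case 4 then show ?thesis using assms(4) by blast
  next
    case 5 then show ?thesis using assms(3) by blast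
  next
    case 6 then show ?thesis using assms(5) by blast
  qed
  then show "(p, r) \<in> tabrel T \<union> E" using mem by (auto simp: tabrel_def)
qed

lemma label_A: "x \<in> P \<Longrightarrow> l \<in> R x \<Longrightarrow> label l \<in> A"
  by (erule R_cases) auto

lemma flip_A: "p \<in> A \<Longrightarrow> flip p \<in> A" "p \<in> A \<Longrightarrow> flip (flip p) = p"
  by (cases p; simp)+

lemma E_carrier: "E\<beta> \<subseteq> A \<times> A" "E\<gamma> \<subseteq> A \<times> A" "E\<delta> \<subseteq> A \<times> A"
proof -
  show "E\<beta> \<subseteq> A \<times> A" using M_sub by (auto simp: E\<beta>_def)
  show "E\<gamma> \<subseteq> A \<times> A" using label_A by (auto simp: E\<gamma>_def)
  show "E\<delta> \<subseteq> A \<times> A" using label_A flip_A(1) by (auto simp: E\<delta>_def)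
qed

lemma label_kind: "x \<in> P \<Longrightarrow> l \<in> R x \<Longrightarrow> kind (label l) \<in> {6, 1, 3}"
  by (erule R_cases) auto

lemma flip_label_kind: "x \<in> P \<Longrightarrow> l \<in> R x \<Longrightarrow> kind (flip (label l)) \<in> {6, 1, 3}"
  by (erule R_cases) auto

lemma label_not_Plus: "label l \<noteq> Plus y" "flip (label l) \<noteq> Plus y"
  by (cases l; simp)+

lemma generators_Quo_e: "{\<alpha>, \<beta>, \<gamma>, \<delta>} \<subseteq> Quo_e (Id_on A)"
proof -
  have "trans \<alpha>"
    using trans_extension[OF tables_trans(1), of "{}"] by (simp add: \<alpha>_def)
  moreover have "trans \<beta>"
    unfolding \<beta>_def using extension_facts(1,2)
    by (intro trans_extension[OF tables_trans(2) E_carrier(1)]) (auto simp: E\<beta>_def)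
  moreover have "trans \<gamma>"
    unfolding \<gamma>_def
  proof (rule trans_extension[OF tables_trans(3) E_carrier(2)])
    show "(kind p, v) \<in> set tg" if pq: "(p, q) \<in> E\<gamma>" "(kind q, v) \<in> set tg" for p q v
    proof -
      obtain x l where "x \<in> P" "l \<in> R x" "p = Plus x" "q = label l"
        using pq(1) by (auto simp: E\<gamma>_def)
      then show ?thesis using label_kind[of x l] extension_facts(3-5) pq(2) by auto
    qed
    show "(v, kind q) \<in> set tg" if "(p, q) \<in> E\<gamma>" "(v, kind p) \<in> set tg" for p q v
      using that extension_facts(6) by (auto simp: E\<gamma>_def)
    show "p = r" if "(p, q) \<in> E\<gamma>" "(q, r) \<in> E\<gamma>" for p q r
      using that by (auto simp: label_not_Plus label_not_Plus[symmetric] E\<gamma>_def)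
  qed
  moreover have "trans \<delta>"
    unfolding \<delta>_def
  proof (rule trans_extension[OF tables_trans(4) E_carrier(3)])
    show "(v, kind q) \<in> set td" if pq: "(p, q) \<in> E\<delta>" "(v, kind p) \<in> set td" for p q v
    proof -
      obtain x l where "x \<in> P" "l \<in> R x" "p = flip (label l)" "q = Plus x"
        using pq(1) by (auto simp: E\<delta>_def)
      then show ?thesis using flip_label_kind[of x l] extension_facts(7-9) pq(2) by auto
    qed
    show "(kind p, v) \<in> set td" if "(p, q) \<in> E\<delta>" "(kind q, v) \<in> set td" for p q v
      using that extension_facts(10) by (auto simp: E\<delta>_def)
    show "p = r" if "(p, q) \<in> E\<delta>" "(q, r) \<in> E\<delta>" for p q r
      using that by (auto simp: label_not_Plus label_not_Plus[symmetric] E\<delta>_def)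
  qed
  ultimately show ?thesis
    using E_carrier by (auto simp: Quo_e_iff \<alpha>_def \<beta>_def \<gamma>_def \<delta>_def tabrel_def)
qed

abbreviation H :: "'w point rel set" where
  "H \<equiv> generated (Id_on A) {\<alpha>, \<beta>, \<gamma>, \<delta>}"

lemma generators_in_H: "\<alpha> \<in> H" "\<beta> \<in> H" "\<gamma> \<in> H" "\<delta> \<in> H"
  by (auto intro: generated.base)

subsection \<open>Reversing the order\<close>

definition dual :: "'w point rel \<Rightarrow> 'w point rel" where
  "dual \<rho> = {(p, q). p \<in> A \<and> q \<in> A \<and> (flip q, flip p) \<in> \<rho>}"

lemma flip_eq_iff: "p \<in> A \<Longrightarrow> q \<in> A \<Longrightarrow> flip p = flip q \<longleftrightarrow> p = q"
  by (metis flip_A(2))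

lemma kind_flip: "p \<in> A \<Longrightarrow> kind (flip p) = flip_kind (kind p)"
  by (cases p) (auto simp: flip_kind_def)

lemma flip_kind_flip_kind: "p \<in> A \<Longrightarrow> flip_kind (flip_kind (kind p)) = kind p"
  using kind_flip[of p] kind_flip[of "flip p"] flip_A[of p] by simp

lemma dual_dual: "\<rho> \<subseteq> A \<times> A \<Longrightarrow> dual (dual \<rho>) = \<rho>"
  unfolding dual_def by (auto simp: flip_A)

lemma trans_dual:
  assumes "trans \<rho>" shows "trans (dual \<rho>)"
proof (rule transI)
  fix p q r assume "(p, q) \<in> dual \<rho>" "(q, r) \<in> dual \<rho>"
  then show "(p, r) \<in> dual \<rho>"
    using transD[OF assms, of "flip r" "flip q" "flip p"] by (simp add: dual_def)
qed

lemma dual_mono: "\<rho> \<subseteq> \<sigma> \<Longrightarrow> dual \<rho> \<subseteq> dual \<sigma>"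
  by (auto simp: dual_def)

lemma dual_qcl:
  assumes "S \<subseteq> A \<times> A"
  shows "dual (qcl (Id_on A) S) = qcl (Id_on A) (dual S)"
proof
  have Id: "Id_on A \<subseteq> dual (qcl (Id_on A) T)" for T
  proof
    fix z assume "z \<in> Id_on A"
    then obtain p where p: "p \<in> A" "z = (p, p)" by auto
    moreover have "(flip p, flip p) \<in> qcl (Id_on A) T"
      using qcl_upper(1)[of "Id_on A" T] flip_A(1)[OF p(1)] by auto
    ultimately show "z \<in> dual (qcl (Id_on A) T)" by (simp add: dual_def)
  qed
  have "S = dual (dual S)" using dual_dual[OF assms] by simp
  also have "\<dots> \<subseteq> dual (qcl (Id_on A) (dual S))"
    by (intro dual_mono qcl_upper)
  finally have "qcl (Id_on A) S \<subseteq> dual (qcl (Id_on A) (dual S))"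
    by (rule qcl_least[OF Id _ trans_dual[OF trans_qcl]])
  then have "dual (qcl (Id_on A) S) \<subseteq> dual (dual (qcl (Id_on A) (dual S)))"
    by (rule dual_mono)
  moreover have "dual S \<subseteq> A \<times> A" by (auto simp: dual_def)
  ultimately show "dual (qcl (Id_on A) S) \<subseteq> qcl (Id_on A) (dual S)"
    using dual_dual[of "qcl (Id_on A) (dual S)"]
      Quo_eD(1)[OF qcl_in_Quo_e[OF Partial_order_Id_on'[of A], of "dual S"]] by simp
  show "qcl (Id_on A) (dual S) \<subseteq> dual (qcl (Id_on A) S)"
    by (rule qcl_least[OF Id dual_mono[OF qcl_upper(2)] trans_dual[OF trans_qcl]])
qed

lemma dual_tabrel:
  assumes "table_dual T T'" "table_dual T' T"
  shows "dual (tabrel T) = tabrel T'"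
proof -
  have "(flip_kind (kind q), flip_kind (kind p)) \<in> set T \<longleftrightarrow> (kind p, kind q) \<in> set T'"
    if "p \<in> A" "q \<in> A" for p q
  proof
    assume "(flip_kind (kind q), flip_kind (kind p)) \<in> set T"
    then have "(flip_kind (flip_kind (kind p)), flip_kind (flip_kind (kind q))) \<in> set T'"
      by (rule table_dualD[OF assms(1)])
    then show "(kind p, kind q) \<in> set T'" using that by (simp add: flip_kind_flip_kind)
  next
    assume "(kind p, kind q) \<in> set T'"
    then show "(flip_kind (kind q), flip_kind (kind p)) \<in> set T"
      by (rule table_dualD[OF assms(2)])
  qed
  then show ?thesis
    unfolding dual_def tabrel_def using flip_A(1) by (auto simp: kind_flip flip_eq_iff)
qed

lemma dual_generators: "dual \<alpha> = \<alpha>" "dual \<beta> = \<beta>" "dual \<gamma> = \<delta>" "dual \<delta> = \<gamma>"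
proof -
  have Un: "dual (\<rho> \<union> \<sigma>) = dual \<rho> \<union> dual \<sigma>" for \<rho> \<sigma> by (auto simp: dual_def)
  have "dual E\<beta> = E\<beta>"
  proof -
    have "flip p = Plus x \<longleftrightarrow> p = Plus x" "flip p = Minus x \<longleftrightarrow> p = Minus x" for p :: "'w point" and x
      by (cases p; simp)+
    then show ?thesis using M_sub by (auto simp: dual_def E\<beta>_def)
  qed
  moreover have *: "dual E\<gamma> = E\<delta>"
  proof -
    have Plus: "flip p = Plus x \<longleftrightarrow> p = Plus x" for p :: "'w point" and x by (cases p) auto
    have lab: "flip q = label l \<longleftrightarrow> q = flip (label l)" if "q \<in> A" "x \<in> P" "l \<in> R x" for q x l
      using flip_A(2)[OF that(1)] flip_A(2)[OF label_A[OF that(2,3)]] by auto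
    show ?thesis
    proof (rule set_eqI, clarify)
      fix p q
      show "(p, q) \<in> dual E\<gamma> \<longleftrightarrow> (p, q) \<in> E\<delta>"
      proof
        assume "(p, q) \<in> dual E\<gamma>"
        then obtain x l where "p \<in> A" "x \<in> P" "l \<in> R x" "flip q = Plus x" "flip p = label l"
          by (auto simp: dual_def E\<gamma>_def)
        then show "(p, q) \<in> E\<delta>" using lab Plus by (auto simp: E\<delta>_def)
      next
        assume "(p, q) \<in> E\<delta>"
        then obtain x l where x: "x \<in> P" "l \<in> R x" "p = flip (label l)" "q = Plus x"
          by (auto simp: E\<delta>_def)
        then show "(p, q) \<in> dual E\<gamma>"
          using flip_A label_A[OF x(1,2)] by (auto simp: dual_def E\<gamma>_def)
      qed
    qed
  qed
  moreover have "dual E\<delta> = E\<gamma>" using dual_dual[OF E_carrier(2)] * by simp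
  ultimately show "dual \<alpha> = \<alpha>" "dual \<beta> = \<beta>" "dual \<gamma> = \<delta>" "dual \<delta> = \<gamma>"
    unfolding \<alpha>_def \<beta>_def \<gamma>_def \<delta>_def Un using tables_dual by (simp_all add: dual_tabrel)
qed

text \<open>
  Reversing all quasiorders and flipping the skeleton exchanges the generators \<open>\<gamma>\<close> and \<open>\<delta>\<close> and keeps the other two.
  So every construction comes with its dual for free.
\<close>

lemma dual_in_H:
  assumes "\<rho> \<in> H" shows "dual \<rho> \<in> H"
proof (rule generated_transport[OF Partial_order_Id_on' generators_Quo_e assms])
  show "dual \<rho> \<in> H" if "\<rho> \<in> {\<alpha>, \<beta>, \<gamma>, \<delta>}" for \<rho>
    using that dual_generators generators_in_H by auto
  show "dual (qcl (Id_on A) (\<Union>X)) = qcl (Id_on A) (\<Union>(dual ` X))" if "X \<subseteq> Quo_e (Id_on A)" for X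
  proof -
    have "\<Union>X \<subseteq> A \<times> A"
    proof (rule Union_least)
      fix \<rho> assume "\<rho> \<in> X"
      then show "\<rho> \<subseteq> A \<times> A" using Quo_eD(1)[of \<rho> "Id_on A"] that by auto
    qed
    moreover have "dual (\<Union>X) = \<Union>(dual ` X)" by (auto simp: dual_def)
    ultimately show ?thesis using dual_qcl[of "\<Union>X"] by simp
  qed
  show "dual (\<Inter>X) = \<Inter>(dual ` X)" if "X \<noteq> {}" for X
    using that by (auto simp: dual_def)
qed

subsection \<open>Arrows\<close>

definition arrow :: "'w point \<Rightarrow> 'w point \<Rightarrow> 'w point rel" where
  "arrow p q = insert (p, q) (Id_on A)"

lemma qcl_arrow: "p \<in> A \<Longrightarrow> q \<in> A \<Longrightarrow> qcl (Id_on A) {(p, q)} = arrow p q"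
  by (subst qcl_single[OF Partial_order_Id_on']) (auto simp: arrow_def)

lemma flip_swap: "p \<in> A \<Longrightarrow> q \<in> A \<Longrightarrow> flip p = q \<longleftrightarrow> p = flip q"
  by (metis flip_A(2))

lemma dual_arrow:
  assumes "p \<in> A" "q \<in> A" shows "dual (arrow p q) = arrow (flip q) (flip p)"
  unfolding dual_def arrow_def using assms
  by (auto simp: flip_swap[OF _ assms(1)] flip_swap[OF _ assms(2)] flip_eq_iff flip_A)

lemma arrow_flip:
  assumes "arrow p q \<in> H" "p \<in> A" "q \<in> A" shows "arrow (flip q) (flip p) \<in> H"
  using dual_in_H[OF assms(1)] dual_arrow[OF assms(2,3)] by simp

lemma qcl_two_arrows:
  assumes "p \<in> A" "q \<in> A" "r \<in> A"
  shows "qcl (Id_on A) (arrow p q \<union> arrow q r) \<subseteq> {(p, q), (q, r), (p, r)} \<union> Id_on A"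
    "(p, r) \<in> qcl (Id_on A) (arrow p q \<union> arrow q r)"
proof -
  show "qcl (Id_on A) (arrow p q \<union> arrow q r) \<subseteq> {(p, q), (q, r), (p, r)} \<union> Id_on A"
  proof (rule qcl_least)
    show "trans ({(p, q), (q, r), (p, r)} \<union> Id_on A)"
      using assms by (auto simp: trans_def)
  qed (auto simp: arrow_def)
  have "(p, q) \<in> qcl (Id_on A) (arrow p q \<union> arrow q r)" "(q, r) \<in> qcl (Id_on A) (arrow p q \<union> arrow q r)"
    using qcl_upper(2)[of "arrow p q \<union> arrow q r" "Id_on A"] by (auto simp: arrow_def)
  then show "(p, r) \<in> qcl (Id_on A) (arrow p q \<union> arrow q r)"
    by (rule qcl_trans)
qed

lemma two_routes:
  assumes "arrow p a \<in> H" "arrow a q \<in> H" "arrow p b \<in> H" "arrow b q \<in> H"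
    and "p \<in> A" "q \<in> A" "a \<in> A" "b \<in> A" "a \<noteq> b"
  shows "arrow p q \<in> H"
proof (cases "q = a \<or> q = b \<or> p = a \<or> p = b")
  case True
  then show ?thesis using assms by auto
next
  case False
  define R1 R2 where "R1 = qcl (Id_on A) (arrow p a \<union> arrow a q)" and "R2 = qcl (Id_on A) (arrow p b \<union> arrow b q)"
  have "R1 \<inter> R2 \<in> H"
    unfolding R1_def R2_def using assms by (intro generated_Int generated_Un)
  moreover have "R1 \<inter> R2 = arrow p q"
  proof
    show "R1 \<inter> R2 \<subseteq> arrow p q"
      using qcl_two_arrows(1)[of p a q] qcl_two_arrows(1)[of p b q] False assms(5-9)
      unfolding R1_def R2_def arrow_def by blast
    show "arrow p q \<subseteq> R1 \<inter> R2"
      using qcl_two_arrows(2)[of p a q] qcl_two_arrows(2)[of p b q] assms(5-8)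
        qcl_upper(1)[of "Id_on A"] unfolding R1_def R2_def arrow_def by blast
  qed
  ultimately show ?thesis by simp
qed

definition good :: "'w point set \<Rightarrow> bool" where
  "good G \<longleftrightarrow> G \<subseteq> A \<and> (\<forall>p\<in>G. \<forall>q\<in>G. arrow p q \<in> H)"

lemma loop_in_H: "p \<in> A \<Longrightarrow> arrow p p \<in> H"
proof -
  assume "p \<in> A"
  then have "arrow p p = qcl (Id_on A) (\<Union>{})"
    unfolding qcl_def arrow_def by (simp add: insert_absorb Id_onI trans_Id_on trancl_id)
  then show ?thesis using generated.join[of "{}"] by auto
qed

text \<open>
  Arrows from \<open>p\<close> to two points of the skeleton yield, by duality, arrows from two other points of the skeleton to \<open>p\<close>. Two routes
  through different points then determine the direct connection.
\<close>

lemma good_insert: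
  assumes "good G" "Base ` {..<5} \<subseteq> G" "p \<in> A" "flip p = p"
    and "arrow p (Base 0) \<in> H" "arrow p (Base 1) \<in> H"
  shows "good (insert p G)"
proof -
  have B: "Base i \<in> G" if "i < 5" for i using that assms(2) by auto
  have GA: "q \<in> A" if "q \<in> G" for q using that assms(1) by (auto simp: good_def)
  have in_arrows: "arrow (Base 4) p \<in> H" "arrow (Base 3) p \<in> H"
    using arrow_flip[OF assms(5,3)] arrow_flip[OF assms(6,3)] assms(4) by auto
  have "arrow p q \<in> H \<and> arrow q p \<in> H" if "q \<in> G" for q
  proof
    show "arrow p q \<in> H"
      using assms(1) B that GA assms(3)
      by (intro two_routes[OF assms(5) _ assms(6)]) (auto simp: good_def)
    show "arrow q p \<in> H"
      using assms(1) B that GA assms(3)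
      by (intro two_routes[OF _ in_arrows(1) _ in_arrows(2)]) (auto simp: good_def)
  qed
  then show ?thesis
    using assms(1,3) loop_in_H[OF assms(3)] by (auto simp: good_def)
qed

end


definition base_pairs :: "(nat \<times> nat) list" where
  "base_pairs = [(0,1),(0,2),(0,3),(0,4),(1,0),(1,2),(1,3),(2,0),(2,1),(3,0),(3,1),(4,0)]"

lemma base_pairs_checks:
  "list_all (\<lambda>(u, v). u < 5 \<and> v < 5 \<and> (List.member ta (u, v) \<or> List.member tb (u, v))) base_pairs"
  "list_all (\<lambda>u. list_all (\<lambda>v. u = v \<or> List.member base_pairs (u, v) \<or>
     List.member base_pairs (4 - v, 4 - u)) [0..<5]) [0..<5]"
  by code_simp+

lemma base_pairs:
  assumes "(u, v) \<in> set base_pairs"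
  shows "u < 5" "v < 5" "(u, v) \<in> set ta \<or> (u, v) \<in> set tb"
  using bspec[OF base_pairs_checks(1)[unfolded list_all_iff] assms] by simp_all

lemma base_pairs_complete:
  assumes "u < 5" "v < 5"
  obtains "u = v" | "(u, v) \<in> set base_pairs" | "(4 - v, 4 - u) \<in> set base_pairs"
proof -
  have "u \<in> set [0..<5]" "v \<in> set [0..<5]" using assms by auto
  from bspec[OF bspec[OF base_pairs_checks(2)[unfolded list_all_iff] this(1)] this(2)]
  show ?thesis using that by (simp del: upt_rec_numeral) blast
qed

context antichain_code
begin

subsection \<open>Models of the structure\<close>

definition models :: "nat list \<Rightarrow> nat list \<Rightarrow> ('w point \<Rightarrow> nat) \<Rightarrow> (nat \<Rightarrow> 'w point) \<Rightarrow> bool" where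
  "models \<tau> L \<phi> \<iota> \<longleftrightarrow> (\<forall>p\<in>A. \<phi> p < length \<tau> \<and> \<tau> ! \<phi> p = kind p)
     \<and> (\<forall>i\<in>set L. i < length \<tau> \<and> \<iota> i \<in> A \<and> \<phi> (\<iota> i) = i)"

lemma models_kind: "models \<tau> L \<phi> \<iota> \<Longrightarrow> i \<in> set L \<Longrightarrow> kind (\<iota> i) = \<tau> ! i"
  unfolding models_def by metis

lemma finite_model_models: "models \<tau> L \<phi> \<iota> \<Longrightarrow> finite_model (length \<tau>) A \<phi>"
  unfolding models_def by unfold_locales auto

abbreviation gens :: "'w point rel set" where "gens \<equiv> {\<alpha>, \<beta>, \<gamma>, \<delta>}"

lemma H_carrier: "\<rho> \<in> H \<Longrightarrow> \<rho> \<subseteq> A \<times> A" "\<rho> \<in> H \<Longrightarrow> Id_on A \<subseteq> \<rho>"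
  using Quo_eD(1,2)[OF generated_in_Quo_e[OF Partial_order_Id_on' generators_Quo_e]] by auto

text \<open>
  The enclosures that the programs start with are instances of one scheme: a table, restricted to the chosen points
  below and pulled back along the map to the model above.
\<close>

lemma realised_table:
  assumes mod: "models \<tau> L \<phi> \<iota>" and "\<rho> \<in> H"
    and lower: "\<And>p q. p \<in> A \<Longrightarrow> q \<in> A \<Longrightarrow> \<forall>T\<in>set Ts. (kind p, kind q) \<in> set T \<Longrightarrow> (p, q) \<in> \<rho>"
    and extra: "\<And>i j. (i, j) \<in> set ps \<Longrightarrow> (\<iota> i, \<iota> j) \<in> \<rho>"
    and upper: "\<And>p q. (p, q) \<in> \<rho> \<Longrightarrow> p = q \<or> (\<forall>T\<in>set Ts. (kind p, kind q) \<in> set T) \<or> (\<phi> p, \<phi> q) \<in> set (ps @ qs)"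
  shows "finite_model.realised (length \<tau>) A \<phi> \<iota> gens (table_encl \<tau> L Ts ps qs)"
proof -
  interpret fm: finite_model "length \<tau>" A \<phi> \<iota> by (rule finite_model_models[OF mod])
  have L: "i < length \<tau>" "\<iota> i \<in> A" if "i \<in> set L" for i
    using mod that by (auto simp: models_def)
  have \<phi>: "\<phi> p < length \<tau>" "\<tau> ! \<phi> p = kind p" if "p \<in> A" for p
    using mod that by (auto simp: models_def)
  have "fm.encloses (table_encl \<tau> L Ts ps qs) \<rho>"
    unfolding fm.encloses_def
  proof (intro conjI)
    show "\<forall>(i, j)\<in>bmat_rel (fst (table_encl \<tau> L Ts ps qs)). (\<iota> i, \<iota> j) \<in> \<rho>"
    proof clarify
      fix i j assume "(i, j) \<in> bmat_rel (fst (table_encl \<tau> L Ts ps qs))"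
      then have ij: "i \<in> set L" "j \<in> set L"
        "i = j \<or> (i, j) \<in> set ps \<or> (\<forall>T\<in>set Ts. (\<tau> ! i, \<tau> ! j) \<in> set T)"
        by (auto simp: table_encl_def table_mat_def bmat_rel_mat_of list_all_iff)
      show "(\<iota> i, \<iota> j) \<in> \<rho>"
        using ij(3)
      proof (elim disjE)
        assume "i = j"
        then show ?thesis using H_carrier(2)[OF assms(2)] L(2)[OF ij(1)] by auto
      next
        assume "\<forall>T\<in>set Ts. (\<tau> ! i, \<tau> ! j) \<in> set T"
        then show ?thesis
          using lower[OF L(2)[OF ij(1)] L(2)[OF ij(2)]] models_kind[OF mod] ij(1,2) by simp
      qed (rule extra)
    qed
    show "\<forall>(p, q)\<in>\<rho>. (\<phi> p, \<phi> q) \<in> bmat_rel (snd (table_encl \<tau> L Ts ps qs))"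
    proof clarify
      fix p q assume pq: "(p, q) \<in> \<rho>"
      then have "p \<in> A" "q \<in> A" using H_carrier(1)[OF assms(2)] by auto
      then show "(\<phi> p, \<phi> q) \<in> bmat_rel (snd (table_encl \<tau> L Ts ps qs))"
        using upper[OF pq] \<phi>
        by (auto simp: table_encl_def table_mat_def bmat_rel_mat_of list_all_iff)
    qed
  qed (auto simp: table_encl_def table_mat_def bmat_rel_mat_of)
  then show ?thesis using assms(2) fm.realised_def by blast
qed

lemma realised_arrow:
  assumes mod: "models \<tau> L \<phi> \<iota>" and "i \<in> set L" "j \<in> set L" "arrow (\<iota> i) (\<iota> j) \<in> H"
  shows "finite_model.realised (length \<tau>) A \<phi> \<iota> gens (arrow_encl \<tau> L (i, j))"
  unfolding arrow_encl_def
proof (rule realised_table[OF mod assms(4)])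
  show "p = q \<or> (\<forall>T\<in>set [[]]. (kind p, kind q) \<in> set T) \<or> (\<phi> p, \<phi> q) \<in> set ([(i, j)] @ [])"
    if "(p, q) \<in> arrow (\<iota> i) (\<iota> j)" for p q
    using that mod assms(2,3) by (auto simp: arrow_def models_def)
qed (auto simp: arrow_def)

lemma same_kind:
  assumes "(p, q) \<in> \<alpha> \<or> (p, q) \<in> \<beta>" "kind p = kind q" shows "p = q"
proof -
  have "(k, k) \<notin> set ta" "(k, k) \<notin> set tb" for k unfolding ta_def tb_def by auto
  then show ?thesis
    using assms unfolding \<alpha>_def \<beta>_def tabrel_def E\<beta>_def by auto
qed

lemma pinned_in_H:
  assumes mod: "models \<tau> L \<phi> \<iota>"
    and env: "env \<noteq> []" "\<forall>e\<in>set env. finite_model.realised (length \<tau>) A \<phi> \<iota> gens e"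
    and pinned: "list_all (pinned n (exec n env prog)) ps" "n = length \<tau>"
    and uv: "(u, v) \<in> set ps" "u \<in> set L" "v \<in> set L"
    and edge: "(\<iota> u, \<iota> v) \<in> \<alpha> \<or> (\<iota> u, \<iota> v) \<in> \<beta>"
  shows "\<exists>\<rho>\<in>H. (\<iota> u, \<iota> v) \<in> \<rho> \<and> (\<forall>(p, q)\<in>\<rho>. p = q \<or> \<phi> p = u \<and> \<phi> q = v)"
proof -
  interpret fm: finite_model "length \<tau>" A \<phi> \<iota> by (rule finite_model_models[OF mod])
  have "u < length \<tau>" "v < length \<tau>" using mod uv(2,3) by (auto simp: models_def)
  from fm.pinned[OF generators_Quo_e env pinned(1)[unfolded pinned(2)] uv(1) this]
  obtain \<rho> where \<rho>: "\<rho> \<in> H" "(\<iota> u, \<iota> v) \<in> \<rho>" "\<forall>(p, q)\<in>\<rho>. \<phi> p = \<phi> q \<or> \<phi> p = u \<and> \<phi> q = v"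
    by blast
  obtain g where g: "g = \<alpha> \<or> g = \<beta>" "(\<iota> u, \<iota> v) \<in> g" using edge by blast
  have "\<rho> \<inter> g \<in> H" using \<rho>(1) g(1) generators_in_H by (auto intro: generated_Int)
  moreover have "p = q \<or> \<phi> p = u \<and> \<phi> q = v" if "(p, q) \<in> \<rho> \<inter> g" for p q
  proof (cases "\<phi> p = \<phi> q")
    case True
    moreover have "p \<in> A" "q \<in> A" using that H_carrier(1)[OF \<rho>(1)] by auto
    ultimately have "kind p = kind q" using mod unfolding models_def by metis
    then show ?thesis using same_kind that g(1) by blast
  next
    case False
    then show ?thesis using \<rho>(3) that by auto
  qed
  ultimately show ?thesis using \<rho>(2) g(2) by (intro bexI[of _ "\<rho> \<inter> g"]) auto
qed

lemma \<alpha>_cases: "(p, q) \<in> \<alpha> \<longleftrightarrow> p \<in> A \<and> q \<in> A \<and> (p = q \<or> (kind p, kind q) \<in> set ta)"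
  by (auto simp: \<alpha>_def tabrel_def)

lemma \<beta>_cases: "(p, q) \<in> \<beta> \<longleftrightarrow> p \<in> A \<and> q \<in> A \<and> (p = q \<or> (kind p, kind q) \<in> set tb)
    \<or> (\<exists>x\<in>M. p = Plus x \<and> q = Minus x \<or> p = Minus x \<and> q = Plus x)"
  by (auto simp: \<beta>_def tabrel_def E\<beta>_def)

lemma \<gamma>_cases: "(p, q) \<in> \<gamma> \<longleftrightarrow> p \<in> A \<and> q \<in> A \<and> (p = q \<or> (kind p, kind q) \<in> set tg)
    \<or> (\<exists>x\<in>P. \<exists>l\<in>R x. p = Plus x \<and> q = label l)"
  by (auto simp: \<gamma>_def tabrel_def E\<gamma>_def)

lemma \<delta>_cases: "(p, q) \<in> \<delta> \<longleftrightarrow> p \<in> A \<and> q \<in> A \<and> (p = q \<or> (kind p, kind q) \<in> set td)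
    \<or> (\<exists>x\<in>P. \<exists>l\<in>R x. p = flip (label l) \<and> q = Plus x)"
  by (auto simp: \<delta>_def tabrel_def E\<delta>_def)

lemma table_edge:
  assumes "p \<in> A" "q \<in> A"
  shows "(kind p, kind q) \<in> set ta \<Longrightarrow> (p, q) \<in> \<alpha>" "(kind p, kind q) \<in> set tb \<Longrightarrow> (p, q) \<in> \<beta>"
    "(kind p, kind q) \<in> set tg \<Longrightarrow> (p, q) \<in> \<gamma>" "(kind p, kind q) \<in> set td \<Longrightarrow> (p, q) \<in> \<delta>"
  using assms by (auto simp: \<alpha>_cases \<beta>_cases \<gamma>_cases \<delta>_cases)

subsection \<open>The base\<close>

lemma base_models: "models base_model [0,1,2,3,4] kind Base"
proof -
  have "kind p < length base_model \<and> base_model ! kind p = kind p" if "p \<in> A" for p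
  proof (cases p)
    case (Base i)
    then have "i \<in> {0,1,2,3,4}" using that by auto
    then show ?thesis using Base by (auto simp: base_model_def)
  qed (auto simp: base_model_def)
  then show ?thesis unfolding models_def by (auto simp: base_model_def)
qed

lemma base_realised: "\<forall>e\<in>set base_env. finite_model.realised (length base_model) A kind Base gens e"
proof -
  note rt = realised_table[OF base_models]
  have n: "(5, 6) \<notin> set ta" "(6, 5) \<notin> set ta" "(5, 1) \<notin> set ta" "(5, 3) \<notin> set ta" "(1, 5) \<notin> set ta"
    "(3, 5) \<notin> set ta" "(5, 6) \<notin> set tb" "(6, 5) \<notin> set tb" "(5, 3) \<notin> set tb" "(1, 5) \<notin> set tb"
    "(5, 6) \<notin> set tg" "(6, 5) \<notin> set tg" "(5, 6) \<notin> set td" "(6, 5) \<notin> set td"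
    unfolding ta_def tb_def tg_def td_def by simp_all
  have kinds: "kind (label l) = 6 \<or> kind (label l) = 1 \<or> kind (label l) = 3"
    "kind (flip (label l)) = 6 \<or> kind (flip (label l)) = 1 \<or> kind (flip (label l)) = 3"
    if "x \<in> P" "l \<in> R x" for x l using that by (auto elim!: R_cases)
  have self: "label l \<noteq> Minus x" "flip (label l) \<noteq> Minus x" if "x \<in> P" "l \<in> R x" for x l
    using not_self[OF that(1)] that(2) by (cases l; auto)+
  have up\<alpha>: "p = q \<or> (kind p, kind q) \<in> set ta" if "(p, q) \<in> \<alpha>" for p q
    using that by (auto simp: \<alpha>_cases)
  have up\<beta>: "p = q \<or> (kind p, kind q) \<in> set tb \<or> (kind p, kind q) \<in> {(5, 6), (6, 5)}" if "(p, q) \<in> \<beta>" for p q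
    using that by (auto simp: \<beta>_cases)
  have up\<gamma>: "p = q \<or> (kind p, kind q) \<in> set tg \<or> (kind p, kind q) \<in> {(5, 6), (5, 3), (5, 1)}"
    if "(p, q) \<in> \<gamma>" for p q using that kinds by (auto simp: \<gamma>_cases)
  have up\<delta>: "p = q \<or> (kind p, kind q) \<in> set td \<or> (kind p, kind q) \<in> {(6, 5), (1, 5), (3, 5)}"
    if "(p, q) \<in> \<delta>" for p q using that kinds by (auto simp: \<delta>_cases)
  have up\<beta>\<gamma>: "p = q \<or> (kind p, kind q) \<in> set tb \<and> (kind p, kind q) \<in> set tg \<or> (kind p, kind q) = (5, 1)"
    if "(p, q) \<in> \<beta>" "(p, q) \<in> \<gamma>" for p q
    using that(2) unfolding \<gamma>_cases
  proof (elim disjE bexE conjE)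
    assume "(kind p, kind q) \<in> set tg"
    then show ?thesis using up\<beta>[OF that(1)] n by auto
  next
    fix x l assume x: "x \<in> P" "l \<in> R x" "p = Plus x" "q = label l"
    then show ?thesis using that(1) self[OF x(1,2)] kinds[OF x(1,2)] n unfolding \<beta>_cases by auto
  qed simp
  have up\<beta>\<delta>: "p = q \<or> (kind p, kind q) \<in> set tb \<and> (kind p, kind q) \<in> set td \<or> (kind p, kind q) = (3, 5)"
    if "(p, q) \<in> \<beta>" "(p, q) \<in> \<delta>" for p q
    using that(2) unfolding \<delta>_cases
  proof (elim disjE bexE conjE)
    assume "(kind p, kind q) \<in> set td"
    then show ?thesis using up\<beta>[OF that(1)] n by auto
  next
    fix x l assume x: "x \<in> P" "l \<in> R x" "p = flip (label l)" "q = Plus x"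
    then show ?thesis using that(1) self[OF x(1,2)] kinds[OF x(1,2)] n unfolding \<beta>_cases by auto
  qed simp
  note G = generators_in_H generated_Int[OF generators_in_H(1) generators_in_H(2)]
    generated_Int[OF generators_in_H(1) generators_in_H(3)] generated_Int[OF generators_in_H(1) generators_in_H(4)]
    generated_Int[OF generators_in_H(2) generators_in_H(3)] generated_Int[OF generators_in_H(2) generators_in_H(4)]
  let ?r = "finite_model.realised (length base_model) A kind Base gens" and ?e = "table_encl base_model [0,1,2,3,4]"
  have "?r (?e [ta] [] [])"
  proof (rule rt[OF G(1)])
    show "p = q \<or> (\<forall>T\<in>set [ta]. (kind p, kind q) \<in> set T) \<or> (kind p, kind q) \<in> set ([] @ [])"
      if "(p, q) \<in> \<alpha>" for p q using up\<alpha>[OF that] by auto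
  qed (auto simp: table_edge)
  moreover have "?r (?e [tb] [] [(5,6),(6,5)])"
  proof (rule rt[OF G(2)])
    show "p = q \<or> (\<forall>T\<in>set [tb]. (kind p, kind q) \<in> set T) \<or> (kind p, kind q) \<in> set ([] @ [(5,6),(6,5)])"
      if "(p, q) \<in> \<beta>" for p q using up\<beta>[OF that] by auto
  qed (auto simp: table_edge)
  moreover have "?r (?e [tg] [] [(5,6),(5,3),(5,1)])"
  proof (rule rt[OF G(3)])
    show "p = q \<or> (\<forall>T\<in>set [tg]. (kind p, kind q) \<in> set T) \<or> (kind p, kind q) \<in> set ([] @ [(5,6),(5,3),(5,1)])"
      if "(p, q) \<in> \<gamma>" for p q using up\<gamma>[OF that] by auto
  qed (auto simp: table_edge)
  moreover have "?r (?e [td] [] [(6,5),(1,5),(3,5)])"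
  proof (rule rt[OF G(4)])
    show "p = q \<or> (\<forall>T\<in>set [td]. (kind p, kind q) \<in> set T) \<or> (kind p, kind q) \<in> set ([] @ [(6,5),(1,5),(3,5)])"
      if "(p, q) \<in> \<delta>" for p q using up\<delta>[OF that] by auto
  qed (auto simp: table_edge)
  moreover have "?r (?e [ta,tb] [] [])"
  proof (rule rt[OF G(5)])
    show "p = q \<or> (\<forall>T\<in>set [ta, tb]. (kind p, kind q) \<in> set T) \<or> (kind p, kind q) \<in> set ([] @ [])"
      if "(p, q) \<in> \<alpha> \<inter> \<beta>" for p q using that up\<alpha>[of p q] up\<beta>[of p q] n by auto
  qed (auto simp: table_edge)
  moreover have "?r (?e [ta,tg] [] [])"
  proof (rule rt[OF G(6)])
    show "p = q \<or> (\<forall>T\<in>set [ta, tg]. (kind p, kind q) \<in> set T) \<or> (kind p, kind q) \<in> set ([] @ [])"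
      if "(p, q) \<in> \<alpha> \<inter> \<gamma>" for p q using that up\<alpha>[of p q] up\<gamma>[of p q] n by auto
  qed (auto simp: table_edge)
  moreover have "?r (?e [ta,td] [] [])"
  proof (rule rt[OF G(7)])
    show "p = q \<or> (\<forall>T\<in>set [ta, td]. (kind p, kind q) \<in> set T) \<or> (kind p, kind q) \<in> set ([] @ [])"
      if "(p, q) \<in> \<alpha> \<inter> \<delta>" for p q using that up\<alpha>[of p q] up\<delta>[of p q] n by auto
  qed (auto simp: table_edge)
  moreover have "?r (?e [tb,tg] [] [(5,1)])"
  proof (rule rt[OF G(8)])
    show "p = q \<or> (\<forall>T\<in>set [tb, tg]. (kind p, kind q) \<in> set T) \<or> (kind p, kind q) \<in> set ([] @ [(5,1)])"
      if "(p, q) \<in> \<beta> \<inter> \<gamma>" for p q using that up\<beta>\<gamma>[of p q] by auto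
  qed (auto simp: table_edge)
  moreover have "?r (?e [tb,td] [] [(3,5)])"
  proof (rule rt[OF G(9)])
    show "p = q \<or> (\<forall>T\<in>set [tb, td]. (kind p, kind q) \<in> set T) \<or> (kind p, kind q) \<in> set ([] @ [(3,5)])"
      if "(p, q) \<in> \<beta> \<inter> \<delta>" for p q using that up\<beta>\<delta>[of p q] by auto
  qed (auto simp: table_edge)
  ultimately show ?thesis by (simp add: base_env_def Let_def)
qed

lemma base_good: "good (Base ` {..<5})"
proof -
  have A: "arrow (Base u) (Base v) \<in> H" if uv: "(u, v) \<in> set base_pairs" for u v
  proof -
    note b = base_pairs[OF uv]
    have L: "u \<in> set [0,1,2,3,4]" "v \<in> set [0,1,2,3,4]" using b(1,2) by auto
    have edge: "(Base u, Base v) \<in> \<alpha> \<or> (Base u, Base v) \<in> \<beta>"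
      using b table_edge[of "Base u" "Base v"] by auto
    have "base_env \<noteq> []" "7 = length base_model"
      by (simp_all add: base_env_def Let_def base_model_def)
    from pinned_in_H[OF base_models this(1) base_realised base_pinned[folded base_pairs_def] this(2) uv L edge]
    obtain \<rho> where \<rho>: "\<rho> \<in> H" "(Base u, Base v) \<in> \<rho>" "\<forall>(p, q)\<in>\<rho>. p = q \<or> kind p = u \<and> kind q = v"
      by blast
    have *: "p = Base (kind p)" if "kind p < 5" for p :: "'w point" using that by (cases p) auto
    have "\<rho> = arrow (Base u) (Base v)"
    proof
      show "\<rho> \<subseteq> arrow (Base u) (Base v)"
      proof (rule subrelI)
        fix p q assume pq: "(p, q) \<in> \<rho>"
        then have "p \<in> A" using H_carrier(1)[OF \<rho>(1)] by auto
        moreover have "p = q \<or> kind p = u \<and> kind q = v" using \<rho>(3) pq by auto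
        ultimately show "(p, q) \<in> arrow (Base u) (Base v)"
          using *[of p] *[of q] b(1,2) by (auto simp: arrow_def)
      qed
      show "arrow (Base u) (Base v) \<subseteq> \<rho>"
        using \<rho>(2) H_carrier(2)[OF \<rho>(1)] by (simp add: arrow_def)
    qed
    then show ?thesis using \<rho>(1) by simp
  qed
  have "arrow (Base u) (Base v) \<in> H" if "u < 5" "v < 5" for u v
    using that
  proof (cases rule: base_pairs_complete)
    case 1 then show ?thesis using loop_in_H that by auto
  next
    case 2 then show ?thesis by (rule A)
  next
    case 3
    have "4 - (4 - u) = u" "4 - (4 - v) = v" using that by auto
    then show ?thesis using arrow_flip[OF A[OF 3]] that by simp
  qed
  then show ?thesis by (auto simp: good_def)
qed

definition linked :: "'w point \<Rightarrow> bool" where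
  "linked p \<longleftrightarrow> p \<in> A \<and> good (insert p (Base ` {..<5}))"

lemma linked_intro:
  assumes "p \<in> A" "flip p = p" "arrow p (Base 0) \<in> H" "arrow p (Base 1) \<in> H"
  shows "linked p"
  unfolding linked_def using good_insert[OF base_good _ assms] assms(1) by auto

lemma linked_arrow:
  assumes "linked p" "linked q" shows "arrow p q \<in> H"
proof -
  have "arrow p (Base i) \<in> H" "arrow (Base i) q \<in> H" if "i < 5" for i
    using assms that unfolding linked_def good_def by auto
  then show ?thesis
    using two_routes[of p "Base 0" q "Base 1"] assms unfolding linked_def by auto
qed

lemma linked_Base: "i < 5 \<Longrightarrow> linked (Base i)"
  unfolding linked_def using base_good by (auto simp: insert_absorb)

subsection \<open>The inductive step\<close>

lemma label_step:
  assumes mod: "models \<tau> L \<phi> \<iota>"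
    and env: "env \<noteq> []" "\<forall>e\<in>set env. finite_model.realised (length \<tau>) A \<phi> \<iota> gens e"
    and pinned: "list_all (pinned n (exec n env prog)) [(c, 0), (c, 1)]" "n = length \<tau>"
    and L: "c \<in> set L" "0 \<in> set L" "1 \<in> set L"
    and \<iota>: "\<iota> c = Plus x \<or> \<iota> c = Minus x" "\<iota> 0 = Base 0" "\<iota> 1 = Base 1"
    and \<phi>: "\<And>i p. \<phi> p = i \<Longrightarrow> i < 5 \<Longrightarrow> p = Base i" "\<And>p. \<phi> p = c \<Longrightarrow> p \<in> S" and w01: "w \<in> {0, 1}"
  shows "\<exists>\<rho>\<in>H. (\<iota> c, Base w) \<in> \<rho> \<and> (\<forall>(p, q)\<in>\<rho>. p = q \<or> p \<in> S \<and> q = Base w)"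
proof -
  have w: "(c, w) \<in> set [(c, 0), (c, 1)]" "w \<in> set L" "\<iota> w = Base w"
    using w01 L \<iota>(2,3) by auto
  have "\<iota> c \<in> A" using mod L(1) by (simp add: models_def)
  moreover have "(5, 0) \<in> set tb" "(5, 1) \<in> set tb" "(6, 0) \<in> set tb" "(6, 1) \<in> set tb"
    unfolding tb_def by simp_all
  then have "(kind (\<iota> c), kind (Base w)) \<in> set tb"
    using \<iota>(1) w01 by (elim disjE insertE emptyE) simp_all
  moreover have "Base w \<in> A" using w01 by auto
  ultimately have "(\<iota> c, \<iota> w) \<in> \<beta>"
    unfolding w(3) by (intro table_edge(2))
  then obtain \<rho> where \<rho>: "\<rho> \<in> H" "(\<iota> c, \<iota> w) \<in> \<rho>" "\<forall>(p, q)\<in>\<rho>. p = q \<or> \<phi> p = c \<and> \<phi> q = w"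
    using pinned_in_H[OF mod env pinned w(1) L(1) w(2)] by blast
  have "w < 5" using w01 by auto
  have "p = q \<or> p \<in> S \<and> q = Base w" if "(p, q) \<in> \<rho>" for p q
  proof -
    have "p = q \<or> \<phi> p = c \<and> \<phi> q = w" using \<rho>(3) that by auto
    then show ?thesis using \<phi>(2)[of p] \<phi>(1)[of q w] \<open>w < 5\<close> by blast
  qed
  then show ?thesis using \<rho>(1,2) w(3) by (intro bexI[of _ \<rho>]) auto
qed

lemma minus_step:
  assumes x: "x \<in> P" "Inl a \<in> R x" and a: "a \<in> M" "linked (Minus a)" and w: "w \<in> {0, 1}"
  shows "\<exists>\<rho>\<in>H. (Plus x, Base w) \<in> \<rho> \<and>
    (\<forall>(p, q)\<in>\<rho>. p = q \<or> p \<in> {Plus y | y. y \<in> P \<and> Inl a \<in> R y} \<and> q = Base w)"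
proof -
  define \<phi> where "\<phi> p = (case p of Base i \<Rightarrow> if i < 5 then i else 7 | Plus y \<Rightarrow> if y \<in> P \<and> Inl a \<in> R y then 6 else 7
    | Minus y \<Rightarrow> if y = a then 5 else 8)" for p :: "'w point"
  define \<iota> where "\<iota> i = [Base 0, Base 1, Base 2, Base 3, Base 4, Minus a, Plus x] ! i" for i
  have mod: "models minus_model [0,1,2,3,4,5,6] \<phi> \<iota>"
  proof -
    have "\<phi> p < length minus_model \<and> minus_model ! \<phi> p = kind p" if "p \<in> A" for p
    proof (cases p)
      case (Base i)
      then have "i \<in> {0,1,2,3,4}" using that by auto
      then show ?thesis using Base by (auto simp: minus_model_def \<phi>_def)
    qed (auto simp: minus_model_def \<phi>_def)
    then show ?thesis unfolding models_def using x a(1) by (auto simp: minus_model_def \<phi>_def \<iota>_def)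
  qed
  have lk: "linked (\<iota> i)" if "i \<in> set [0,1,2,3,4,5]" for i
    using that a(2) linked_Base by (auto simp: \<iota>_def)
  have k: "finite_model.realised (length minus_model) A \<phi> \<iota> gens (arrow_encl minus_model [0,1,2,3,4,5,6] (i, j))"
    if "i \<in> set [0,1,2,3,4,5]" "j \<in> set [0,1,2,3,4,5]" for i j
    using that by (intro realised_arrow[OF mod] linked_arrow lk) auto
  have ra: "finite_model.realised (length minus_model) A \<phi> \<iota> gens
      (table_encl minus_model [0,1,2,3,4,5,6] [ta] [] [])"
    by (rule realised_table[OF mod generators_in_H(1)]) (auto simp: table_edge \<alpha>_cases)
  have rb: "finite_model.realised (length minus_model) A \<phi> \<iota> gens
      (table_encl minus_model [0,1,2,3,4,5,6] [tb] [] [(6,8),(8,6),(7,5),(5,7),(7,8),(8,7)])"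
  proof (rule realised_table[OF mod generators_in_H(2)])
    show "p = q \<or> (\<forall>T\<in>set [tb]. (kind p, kind q) \<in> set T)
        \<or> (\<phi> p, \<phi> q) \<in> set ([] @ [(6,8),(8,6),(7,5),(5,7),(7,8),(8,7)])"
      if "(p, q) \<in> \<beta>" for p q
      using that not_self M_sub by (auto simp: \<beta>_cases \<phi>_def split: if_splits)
  qed (auto simp: table_edge)
  have rg: "finite_model.realised (length minus_model) A \<phi> \<iota> gens
      (table_encl minus_model [0,1,2,3,4,5,6] [tg] [(6,5)] [(6,8),(7,8),(6,3),(6,1),(7,3),(7,1)])"
  proof (rule realised_table[OF mod generators_in_H(3)])
    show "(\<iota> i, \<iota> j) \<in> \<gamma>" if "(i, j) \<in> set [(6,5)]" for i j
      using that x by (force simp: \<gamma>_cases \<iota>_def)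
    show "p = q \<or> (\<forall>T\<in>set [tg]. (kind p, kind q) \<in> set T)
        \<or> (\<phi> p, \<phi> q) \<in> set ([(6,5)] @ [(6,8),(7,8),(6,3),(6,1),(7,3),(7,1)])"
      if pq: "(p, q) \<in> \<gamma>" for p q
      using pq unfolding \<gamma>_cases
    proof (elim disjE bexE conjE)
      fix y l assume y: "y \<in> P" "l \<in> R y" "p = Plus y" "q = label l"
      from y(1,2) show ?thesis
        using y by (cases rule: R_cases) (auto simp: \<phi>_def split: if_splits)
    qed auto
  qed (auto simp: table_edge)
  have env: "minus_env \<noteq> []" "\<forall>e\<in>set minus_env. finite_model.realised (length minus_model) A \<phi> \<iota> gens e"
    using ra rb rg k by (simp_all add: minus_env_def Let_def)
  have base: "p = Base i" if "\<phi> p = i" "i < 5" for i p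
    using that by (cases p) (auto simp: \<phi>_def split: if_splits)
  have top: "p \<in> {Plus y | y. y \<in> P \<and> Inl a \<in> R y}" if "\<phi> p = 6" for p
    using that by (cases p) (auto simp: \<phi>_def split: if_splits)
  have "9 = length minus_model" by (simp add: minus_model_def)
  from label_step[OF mod env minus_pinned this _ _ _ _ _ _ base top w, where x = x]
  show ?thesis by (auto simp: \<iota>_def)
qed

lemma sink_step:
  assumes x: "x \<in> P" "Inr s \<in> R x" and w: "w \<in> {0, 1}"
  shows "\<exists>\<rho>\<in>H. (Plus x, Base w) \<in> \<rho> \<and>
    (\<forall>(p, q)\<in>\<rho>. p = q \<or> p \<in> {Plus y | y. y \<in> P \<and> Inr s \<in> R y} \<and> q = Base w)"
proof -
  have s: "s = 1 \<or> s = 3" using R_cases[OF x] by auto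
  define \<phi> where "\<phi> p = (case p of Base i \<Rightarrow> if i < 5 then i else 7 | Plus y \<Rightarrow> if y \<in> P \<and> Inr s \<in> R y then 5 else 6
    | Minus y \<Rightarrow> 7)" for p :: "'w point"
  define \<iota> where "\<iota> i = [Base 0, Base 1, Base 2, Base 3, Base 4, Plus x] ! i" for i
  have mod: "models sink_model [0,1,2,3,4,5] \<phi> \<iota>"
  proof -
    have "\<phi> p < length sink_model \<and> sink_model ! \<phi> p = kind p" if "p \<in> A" for p
    proof (cases p)
      case (Base i)
      then have "i \<in> {0,1,2,3,4}" using that by auto
      then show ?thesis using Base by (auto simp: sink_model_def \<phi>_def)
    qed (auto simp: sink_model_def \<phi>_def)
    then show ?thesis unfolding models_def using x by (auto simp: sink_model_def \<phi>_def \<iota>_def)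
  qed
  have lk: "linked (\<iota> i)" if "i \<in> set [0,1,2,3,4]" for i
    using that linked_Base by (auto simp: \<iota>_def)
  have k: "finite_model.realised (length sink_model) A \<phi> \<iota> gens (arrow_encl sink_model [0,1,2,3,4,5] (i, j))"
    if "i \<in> set [0,1,2,3,4]" "j \<in> set [0,1,2,3,4]" for i j
    using that by (intro realised_arrow[OF mod] linked_arrow lk) auto
  have ra: "finite_model.realised (length sink_model) A \<phi> \<iota> gens
      (table_encl sink_model [0,1,2,3,4,5] [ta] [] [])"
    by (rule realised_table[OF mod generators_in_H(1)]) (auto simp: table_edge \<alpha>_cases)
  have rb: "finite_model.realised (length sink_model) A \<phi> \<iota> gens
      (table_encl sink_model [0,1,2,3,4,5] [tb] [] [(5,7),(7,5),(6,7),(7,6)])"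
  proof (rule realised_table[OF mod generators_in_H(2)])
    show "p = q \<or> (\<forall>T\<in>set [tb]. (kind p, kind q) \<in> set T)
        \<or> (\<phi> p, \<phi> q) \<in> set ([] @ [(5,7),(7,5),(6,7),(7,6)])"
      if "(p, q) \<in> \<beta>" for p q
      using that M_sub by (auto simp: \<beta>_cases \<phi>_def split: if_splits)
  qed (auto simp: table_edge)
  have rg: "finite_model.realised (length sink_model) A \<phi> \<iota> gens
      (table_encl sink_model [0,1,2,3,4,5] [tg] [(5,s)] [(5,7),(6,7),(5,4-s),(6,4-s)])"
  proof (rule realised_table[OF mod generators_in_H(3)])
    show "(\<iota> i, \<iota> j) \<in> \<gamma>" if "(i, j) \<in> set [(5,s)]" for i j
      using that x s by (force simp: \<gamma>_cases \<iota>_def)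
    show "p = q \<or> (\<forall>T\<in>set [tg]. (kind p, kind q) \<in> set T)
        \<or> (\<phi> p, \<phi> q) \<in> set ([(5,s)] @ [(5,7),(6,7),(5,4-s),(6,4-s)])"
      if pq: "(p, q) \<in> \<gamma>" for p q
      using pq unfolding \<gamma>_cases
    proof (elim disjE bexE conjE)
      fix y l assume y: "y \<in> P" "l \<in> R y" "p = Plus y" "q = label l"
      from y(1,2) show ?thesis
        using s y by (cases rule: R_cases) (auto simp: \<phi>_def split: if_splits)
    qed auto
  qed (auto simp: table_edge)
  have base: "p = Base i" if "\<phi> p = i" "i < 5" for i p
    using that by (cases p) (auto simp: \<phi>_def split: if_splits)
  have top: "p \<in> {Plus y | y. y \<in> P \<and> Inr s \<in> R y}" if "\<phi> p = 5" for p
    using that by (cases p) (auto simp: \<phi>_def split: if_splits)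
  have n: "8 = length sink_model" by (simp add: sink_model_def)
  show ?thesis
    using s
  proof
    assume s: "s = 1"
    have env: "sink1_env \<noteq> []" "\<forall>e\<in>set sink1_env. finite_model.realised (length sink_model) A \<phi> \<iota> gens e"
      using ra rb rg k s by (simp_all add: sink1_env_def Let_def)
    from label_step[OF mod env sink1_pinned n _ _ _ _ _ _ base top w, where x = x]
    show ?thesis by (auto simp: \<iota>_def)
  next
    assume s: "s = 3"
    have env: "sink3_env \<noteq> []" "\<forall>e\<in>set sink3_env. finite_model.realised (length sink_model) A \<phi> \<iota> gens e"
      using ra rb rg k s by (simp_all add: sink3_env_def Let_def)
    from label_step[OF mod env sink3_pinned n _ _ _ _ _ _ base top w, where x = x]
    show ?thesis by (auto simp: \<iota>_def)
  qed
qed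

text \<open>
  Once the positive point is linked to the skeleton, the second generator, in which the positive and the negative point
  are equivalent, carries the link over to the negative one.
\<close>

lemma partner_step:
  assumes x: "x \<in> M" "linked (Plus x)" and w: "w \<in> {0, 1}"
  shows "\<exists>\<rho>\<in>H. (Minus x, Base w) \<in> \<rho> \<and> (\<forall>(p, q)\<in>\<rho>. p = q \<or> p \<in> {Minus x} \<and> q = Base w)"
proof -
  define \<phi> where "\<phi> p = (case p of Base i \<Rightarrow> if i < 5 then i else 7 | Plus y \<Rightarrow> if y = x then 5 else 7
    | Minus y \<Rightarrow> if y = x then 6 else 8)" for p :: "'w point"
  define \<iota> where "\<iota> i = [Base 0, Base 1, Base 2, Base 3, Base 4, Plus x, Minus x] ! i" for i
  have xP: "x \<in> P" using x(1) M_sub by auto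
  have mod: "models partner_model [0,1,2,3,4,5,6] \<phi> \<iota>"
  proof -
    have "\<phi> p < length partner_model \<and> partner_model ! \<phi> p = kind p" if "p \<in> A" for p
    proof (cases p)
      case (Base i)
      then have "i \<in> {0,1,2,3,4}" using that by auto
      then show ?thesis using Base by (auto simp: partner_model_def \<phi>_def)
    qed (auto simp: partner_model_def \<phi>_def)
    then show ?thesis unfolding models_def using x(1) xP by (auto simp: partner_model_def \<phi>_def \<iota>_def)
  qed
  have lk: "linked (\<iota> i)" if "i \<in> set [0,1,2,3,4,5]" for i
    using that x(2) linked_Base by (auto simp: \<iota>_def)
  have k: "finite_model.realised (length partner_model) A \<phi> \<iota> gens (arrow_encl partner_model [0,1,2,3,4,5,6] (i, j))"
    if "i \<in> set [0,1,2,3,4,5]" "j \<in> set [0,1,2,3,4,5]" for i j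
    using that by (intro realised_arrow[OF mod] linked_arrow lk) auto
  have ra: "finite_model.realised (length partner_model) A \<phi> \<iota> gens
      (table_encl partner_model [0,1,2,3,4,5,6] [ta] [] [])"
    by (rule realised_table[OF mod generators_in_H(1)]) (auto simp: table_edge \<alpha>_cases)
  have rb: "finite_model.realised (length partner_model) A \<phi> \<iota> gens
      (table_encl partner_model [0,1,2,3,4,5,6] [tb] [(5,6),(6,5)] [(7,8),(8,7)])"
  proof (rule realised_table[OF mod generators_in_H(2)])
    show "(\<iota> i, \<iota> j) \<in> \<beta>" if "(i, j) \<in> set [(5,6),(6,5)]" for i j
      using that x by (auto simp: \<beta>_cases \<iota>_def)
    show "p = q \<or> (\<forall>T\<in>set [tb]. (kind p, kind q) \<in> set T)
        \<or> (\<phi> p, \<phi> q) \<in> set ([(5,6),(6,5)] @ [(7,8),(8,7)])"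
      if "(p, q) \<in> \<beta>" for p q
      using that M_sub by (auto simp: \<beta>_cases \<phi>_def split: if_splits)
  qed (auto simp: table_edge)
  have rg: "finite_model.realised (length partner_model) A \<phi> \<iota> gens
      (table_encl partner_model [0,1,2,3,4,5,6] [tg] [] [(5,8),(7,8),(7,6),(5,3),(5,1),(7,3),(7,1)])"
  proof (rule realised_table[OF mod generators_in_H(3)])
    show "p = q \<or> (\<forall>T\<in>set [tg]. (kind p, kind q) \<in> set T)
        \<or> (\<phi> p, \<phi> q) \<in> set ([] @ [(5,8),(7,8),(7,6),(5,3),(5,1),(7,3),(7,1)])"
      if pq: "(p, q) \<in> \<gamma>" for p q
      using pq unfolding \<gamma>_cases
    proof (elim disjE bexE conjE)
      fix y l assume y: "y \<in> P" "l \<in> R y" "p = Plus y" "q = label l"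
      from y(1,2) show ?thesis
        using not_self[OF xP] y by (cases rule: R_cases) (auto simp: \<phi>_def split: if_splits)
    qed auto
  qed (auto simp: table_edge)
  have env: "partner_env \<noteq> []" "\<forall>e\<in>set partner_env. finite_model.realised (length partner_model) A \<phi> \<iota> gens e"
    using ra rb rg k by (simp_all add: partner_env_def Let_def)
  have base: "p = Base i" if "\<phi> p = i" "i < 5" for i p
    using that by (cases p) (auto simp: \<phi>_def split: if_splits)
  have top: "p \<in> {Minus x}" if "\<phi> p = 6" for p
    using that by (cases p) (auto simp: \<phi>_def split: if_splits)
  have "9 = length partner_model" by (simp add: partner_model_def)
  from label_step[OF mod env partner_pinned this _ _ _ _ _ _ base top w, where x = x]
  show ?thesis by (auto simp: \<iota>_def)
qed

text \<open>
  Well-founded induction on \<open>x\<close>. For each label the program for the respective kind of label gives quasiorders that contain the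
  wanted arrow; all other positive points miss some label of \<open>x\<close>, so that the meet over the labels leaves the arrow alone.
\<close>

lemma linked_Plus:
  assumes x: "x \<in> P" and below: "\<And>a. a \<in> M \<Longrightarrow> (a, x) \<in> lt \<Longrightarrow> linked (Minus a)"
  shows "linked (Plus x)"
proof -
  have "arrow (Plus x) (Base w) \<in> H" if w: "w \<in> {0, 1}" for w
  proof -
    have "\<exists>\<rho>\<in>H. (Plus x, Base w) \<in> \<rho> \<and>
      (\<forall>(p, q)\<in>\<rho>. p = q \<or> p \<in> {Plus y | y. y \<in> P \<and> l \<in> R y} \<and> q = Base w)" if l: "l \<in> R x" for l
    proof (cases l)
      case (Inl a)
      have "a \<in> M" "(a, x) \<in> lt" using R_cases[OF x l] Inl by auto
      then show ?thesis using minus_step[OF x _ _ below w] l Inl by simp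
    next
      case (Inr s)
      then show ?thesis using sink_step[OF x _ w] l by simp
    qed
    then have "\<forall>l\<in>R x. \<exists>\<rho>. \<rho> \<in> H \<and> (Plus x, Base w) \<in> \<rho> \<and>
      (\<forall>(p, q)\<in>\<rho>. p = q \<or> p \<in> {Plus y | y. y \<in> P \<and> l \<in> R y} \<and> q = Base w)"
      by blast
    from bchoice[OF this] obtain \<rho> where choice: "\<forall>l\<in>R x. \<rho> l \<in> H \<and> (Plus x, Base w) \<in> \<rho> l \<and>
      (\<forall>(p, q)\<in>\<rho> l. p = q \<or> p \<in> {Plus y | y. y \<in> P \<and> l \<in> R y} \<and> q = Base w)"
      by blast
    have \<rho>: "\<rho> l \<in> H" "(Plus x, Base w) \<in> \<rho> l"
      "(p, q) \<in> \<rho> l \<Longrightarrow> p = q \<or> (\<exists>y. p = Plus y \<and> y \<in> P \<and> l \<in> R y) \<and> q = Base w"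
      if "l \<in> R x" for l p q
      using bspec[OF choice that] by auto
    define \<sigma> where "\<sigma> = (\<Inter>l\<in>R x. \<rho> l)"
    obtain l0 where l0: "l0 \<in> R x" using R_nonempty[OF x] by blast
    have \<sigma>H: "\<sigma> \<in> H"
      unfolding \<sigma>_def using R_nonempty[OF x] \<rho>(1) by (rule generated_meet_family)
    have "\<sigma> = arrow (Plus x) (Base w)"
    proof
      show "\<sigma> \<subseteq> arrow (Plus x) (Base w)"
      proof (rule subrelI)
        fix p q assume pq: "(p, q) \<in> \<sigma>"
        have "p = q \<and> p \<in> A \<or> p = Plus x \<and> q = Base w"
        proof (cases "p = q")
          case True
          then show ?thesis using H_carrier(1)[OF \<sigma>H] pq by auto
        next
          case False
          have *: "(\<exists>y. p = Plus y \<and> y \<in> P \<and> l \<in> R y) \<and> q = Base w" if "l \<in> R x" for l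
            using \<rho>(3)[OF that] pq that False unfolding \<sigma>_def by blast
          then obtain y where y: "p = Plus y" "y \<in> P" using l0 by blast
          then have "R x \<subseteq> R y" using * by auto
          then have "x = y" using R_antichain[OF x y(2)] by simp
          then show ?thesis using y *[OF l0] by simp
        qed
        then show "(p, q) \<in> arrow (Plus x) (Base w)" by (auto simp: arrow_def)
      qed
      show "arrow (Plus x) (Base w) \<subseteq> \<sigma>"
        using H_carrier(2)[OF \<sigma>H] \<rho>(2) by (auto simp: arrow_def \<sigma>_def)
    qed
    then show ?thesis using \<sigma>H by simp
  qed
  then show ?thesis using x by (intro linked_intro) auto
qed

lemma linked_Minus:
  assumes x: "x \<in> M" and "linked (Plus x)"
  shows "linked (Minus x)"
proof -
  have "arrow (Minus x) (Base w) \<in> H" if w: "w \<in> {0, 1}" for w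
  proof -
    obtain \<rho> where \<rho>: "\<rho> \<in> H" "(Minus x, Base w) \<in> \<rho>"
      "\<forall>(p, q)\<in>\<rho>. p = q \<or> p \<in> {Minus x} \<and> q = Base w"
      using partner_step[OF x assms(2) w] by blast
    have "\<rho> = arrow (Minus x) (Base w)"
      using \<rho>(2,3) H_carrier[OF \<rho>(1)] by (auto simp: arrow_def)
    then show ?thesis using \<rho>(1) by simp
  qed
  then show ?thesis using x by (intro linked_intro) auto
qed

lemma all_linked: "p \<in> A \<Longrightarrow> linked p"
proof -
  have *: "(x \<in> P \<longrightarrow> linked (Plus x)) \<and> (x \<in> M \<longrightarrow> linked (Minus x))" for x
  proof (induction x rule: wf_induct_rule[OF wf_lt])
    case (1 x)
    have "linked (Plus x)" if "x \<in> P"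
      using 1 by (intro linked_Plus[OF that]) blast
    then show ?case using linked_Minus M_sub by blast
  qed
  assume "p \<in> A"
  then show ?thesis using * linked_Base by (cases p) auto
qed

theorem four_generators: "complete_generating_set (Quo_e (Id_on A)) {\<alpha>, \<beta>, \<gamma>, \<delta>}"
  unfolding complete_generating_set_iff_generated[OF Partial_order_Id_on']
proof (intro conjI generators_Quo_e Quo_e_subset_generated)
  show "qcl (Id_on A) {(p, q)} \<in> H" if "p \<in> Field (Id_on A)" "q \<in> Field (Id_on A)" for p q
    using that linked_arrow[OF all_linked all_linked] qcl_arrow by simp
qed

end


subsection \<open>Transport along bijections\<close>

definition generated_by_at_most :: "nat \<Rightarrow> 'a set \<Rightarrow> bool" where
  "generated_by_at_most k A \<longleftrightarrow>
     (\<exists>Y. complete_generating_set (Quo_e (Id_on A)) Y \<and> finite Y \<and> card Y \<le> k)"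

lemma map_prod_qcl:
  assumes f: "bij_betw f A B" and R: "R \<subseteq> A \<times> A"
  shows "map_prod f f ` qcl (Id_on A) R = qcl (Id_on B) (map_prod f f ` R)"
proof
  have fB: "f x \<in> B" if "x \<in> A" for x using f that by (auto simp: bij_betw_def)
  have inj: "f x = f y \<Longrightarrow> x = y" if "x \<in> A" "y \<in> A" for x y
    using f that by (auto simp: bij_betw_def inj_on_def)
  let ?Q = "qcl (Id_on B) (map_prod f f ` R)"
  have step: "(f x, f y) \<in> ?Q" if "(x, y) \<in> Id_on A \<union> R" for x y
    using that
  proof
    assume "(x, y) \<in> Id_on A"
    then have "(f x, f y) \<in> Id_on B" using fB by auto
    then show ?thesis by (rule subsetD[OF qcl_upper(1)])
  next
    assume "(x, y) \<in> R"
    then have "(f x, f y) \<in> map_prod f f ` R" by force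
    then show ?thesis by (rule subsetD[OF qcl_upper(2)])
  qed
  have "(f x, f y) \<in> ?Q" if "(x, y) \<in> (Id_on A \<union> R)\<^sup>+" for x y
    using that
  proof (induction rule: trancl_induct)
    case (base y)
    then show ?case by (rule step)
  next
    case (step y z)
    then show ?case using qcl_trans[OF step.IH] \<open>\<And>x y. (x, y) \<in> Id_on A \<union> R \<Longrightarrow> (f x, f y) \<in> ?Q\<close> by blast
  qed
  then show "map_prod f f ` qcl (Id_on A) R \<subseteq> ?Q"
    unfolding qcl_def[of "Id_on A"] by auto
  have carrier: "qcl (Id_on A) R \<subseteq> A \<times> A"
    using Quo_eD(1)[OF qcl_in_Quo_e[OF Partial_order_Id_on'[of A], of R]] R by simp
  show "?Q \<subseteq> map_prod f f ` qcl (Id_on A) R"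
  proof (rule qcl_least)
    show "Id_on B \<subseteq> map_prod f f ` qcl (Id_on A) R"
    proof
      fix z assume "z \<in> Id_on B"
      then obtain y where "y \<in> B" "z = (y, y)" by auto
      moreover then obtain x where "x \<in> A" "y = f x" using f by (auto simp: bij_betw_def)
      moreover have "(x, x) \<in> qcl (Id_on A) R"
        using qcl_upper(1)[of "Id_on A" R] \<open>x \<in> A\<close> by auto
      ultimately show "z \<in> map_prod f f ` qcl (Id_on A) R" by force
    qed
    show "map_prod f f ` R \<subseteq> map_prod f f ` qcl (Id_on A) R"
      by (rule image_mono[OF qcl_upper(2)])
    show "trans (map_prod f f ` qcl (Id_on A) R)"
    proof (rule transI)
      fix u v w assume "(u, v) \<in> map_prod f f ` qcl (Id_on A) R" "(v, w) \<in> map_prod f f ` qcl (Id_on A) R"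
      then obtain x y y' z where 1: "(x, y) \<in> qcl (Id_on A) R" "(y', z) \<in> qcl (Id_on A) R"
        "u = f x" "v = f y" "v = f y'" "w = f z" by auto
      then have "y = y'" using carrier inj[of y y'] by auto
      then have "(x, z) \<in> qcl (Id_on A) R" using 1 qcl_trans[of x y "Id_on A" R z] by auto
      then show "(u, w) \<in> map_prod f f ` qcl (Id_on A) R" using 1 by force
    qed
  qed
qed

text \<open>
  The generation number depends on the cardinality only.
\<close>

lemma generated_by_at_most_bij:
  assumes f: "bij_betw f A B" and "generated_by_at_most k A"
  shows "generated_by_at_most k B"
proof -
  let ?F = "\<lambda>\<rho>. map_prod f f ` \<rho>"
  obtain Y where Y: "complete_generating_set (Quo_e (Id_on A)) Y" "finite Y" "card Y \<le> k"
    using assms(2) by (auto simp: generated_by_at_most_def)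
  have gen: "Y \<subseteq> Quo_e (Id_on A)" "Quo_e (Id_on A) \<subseteq> generated (Id_on A) Y"
    using Y(1) complete_generating_set_iff_generated[OF Partial_order_Id_on'] by auto
  have carrier: "\<rho> \<subseteq> A \<times> A" if "\<rho> \<in> Quo_e (Id_on A)" for \<rho>
    using Quo_eD(1)[OF that] by simp
  have inj: "inj_on (map_prod f f) (A \<times> A)"
    using f by (auto simp: bij_betw_def inj_on_def)
  have F_Quo: "?F \<rho> \<in> Quo_e (Id_on B)" if "\<rho> \<in> Quo_e (Id_on A)" for \<rho>
  proof -
    have "?F \<rho> = qcl (Id_on B) (?F \<rho>)"
      using map_prod_qcl[OF f carrier[OF that]] qcl_of_Quo_e[OF that] by simp
    moreover have "?F \<rho> \<subseteq> B \<times> B"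
      using carrier[OF that] f by (auto simp: bij_betw_def)
    ultimately show ?thesis using qcl_in_Quo_e[OF Partial_order_Id_on', of "?F \<rho>" B] by simp
  qed
  have trans: "?F \<rho> \<in> generated (Id_on B) (?F ` Y)" if "\<rho> \<in> Quo_e (Id_on A)" for \<rho>
  proof (rule generated_transport[OF Partial_order_Id_on' gen(1)])
    show "\<rho> \<in> generated (Id_on A) Y" using gen(2) that by blast
    show "?F \<rho> \<in> generated (Id_on B) (?F ` Y)" if "\<rho> \<in> Y" for \<rho>
      using that by (auto intro: generated.base)
    show "?F (qcl (Id_on A) (\<Union>X)) = qcl (Id_on B) (\<Union>(?F ` X))" if "X \<subseteq> Quo_e (Id_on A)" for X
    proof -
      have "\<Union>X \<subseteq> A \<times> A" using carrier that by (intro Union_least) auto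
      from map_prod_qcl[OF f this] show ?thesis by (simp add: image_Union)
    qed
    show "?F (\<Inter>X) = \<Inter>(?F ` X)" if "X \<subseteq> Quo_e (Id_on A)" "X \<noteq> {}" for X
    proof -
      have "\<forall>\<rho>\<in>X. \<rho> \<subseteq> A \<times> A" using carrier that(1) by auto
      from image_INT[OF inj this] that(2) show ?thesis by auto
    qed
  qed
  have "Quo_e (Id_on B) \<subseteq> generated (Id_on B) (?F ` Y)"
  proof (rule Quo_e_subset_generated)
    fix u v assume "u \<in> Field (Id_on B)" "v \<in> Field (Id_on B)"
    then obtain x y where xy: "x \<in> A" "y \<in> A" "u = f x" "v = f y"
      using f by (auto simp: bij_betw_def)
    then have "qcl (Id_on B) {(u, v)} = ?F (qcl (Id_on A) {(x, y)})"
      using map_prod_qcl[OF f, of "{(x, y)}"] by simp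
    moreover have "qcl (Id_on A) {(x, y)} \<in> Quo_e (Id_on A)"
      using xy by (intro qcl_in_Quo_e Partial_order_Id_on') auto
    ultimately show "qcl (Id_on B) {(u, v)} \<in> generated (Id_on B) (?F ` Y)" using trans by simp
  qed
  moreover have "?F ` Y \<subseteq> Quo_e (Id_on B)" using F_Quo gen(1) by auto
  ultimately have "complete_generating_set (Quo_e (Id_on B)) (?F ` Y)"
    using complete_generating_set_iff_generated[OF Partial_order_Id_on'] by blast
  moreover have "card (?F ` Y) \<le> k" using card_image_le[OF Y(2), of ?F] Y(3) by simp
  ultimately show ?thesis unfolding generated_by_at_most_def using Y(2) by blast
qed

subsection \<open>Small sets\<close>

definition small_env :: "nat \<Rightarrow> (nat \<times> nat) list list \<Rightarrow> enclosure list" where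
  "small_env n Ts = map (\<lambda>T. let m = mat_of n (\<lambda>i j. i = j \<or> List.member T (i, j)) in (m, m)) Ts"

definition all_pairs :: "nat \<Rightarrow> (nat \<times> nat) list" where
  "all_pairs n = [(u, v). u \<leftarrow> [0..<n], v \<leftarrow> [0..<n], u \<noteq> v]"

lemma small_generated:
  assumes n: "0 < n" "n \<le> 5" and trans: "list_all table_trans Ts" "Ts \<noteq> []"
    and pins: "list_all (pinned n (exec n (small_env n Ts) prog)) (all_pairs n)"
  shows "generated_by_at_most (length Ts) {..<n}"
proof -
  let ?A = "{..<n}"
  define rel where "rel T = {(i, j). i < n \<and> j < n \<and> (i = j \<or> (i, j) \<in> set T)}" for T :: "(nat \<times> nat) list"
  interpret fm: finite_model n ?A "\<lambda>i. i" "\<lambda>i. i" by unfold_locales auto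
  have Y: "set (map rel Ts) \<subseteq> Quo_e (Id_on ?A)"
  proof
    fix \<rho> assume "\<rho> \<in> set (map rel Ts)"
    then obtain T where T: "table_trans T" "\<rho> = rel T" using trans(1) by (auto simp: list_all_iff)
    have "trans \<rho>"
      unfolding T(2)
    proof (rule transI)
      fix i j k assume "(i, j) \<in> rel T" "(j, k) \<in> rel T"
      then show "(i, k) \<in> rel T" using table_transD[OF T(1), of i j k] by (auto simp: rel_def)
    qed
    then show "\<rho> \<in> Quo_e (Id_on ?A)" unfolding Quo_e_iff T(2) by (auto simp: rel_def)
  qed
  have enc: "\<forall>e\<in>set (small_env n Ts). fm.realised (set (map rel Ts)) e"
  proof
    fix e assume "e \<in> set (small_env n Ts)"
    then obtain T where T: "T \<in> set Ts"
      "e = (mat_of n (\<lambda>i j. i = j \<or> (i, j) \<in> set T), mat_of n (\<lambda>i j. i = j \<or> (i, j) \<in> set T))"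
      by (auto simp: small_env_def Let_def)
    have "fm.encloses e (rel T)"
      unfolding fm.encloses_def T(2) by (auto simp: bmat_rel_mat_of rel_def)
    then show "fm.realised (set (map rel Ts)) e"
      using T(1) unfolding fm.realised_def by (auto intro!: bexI[of _ "rel T"] generated.base)
  qed
  have ne: "small_env n Ts \<noteq> []" using trans(2) by (simp add: small_env_def)
  have "Quo_e (Id_on ?A) \<subseteq> generated (Id_on ?A) (set (map rel Ts))"
  proof (rule Quo_e_subset_generated)
    fix u v assume "u \<in> Field (Id_on ?A)" "v \<in> Field (Id_on ?A)"
    then have uv: "u < n" "v < n" by auto
    show "qcl (Id_on ?A) {(u, v)} \<in> generated (Id_on ?A) (set (map rel Ts))"
    proof (cases "u = v")
      case True
      have "qcl (Id_on ?A) {(u, v)} = qcl (Id_on ?A) (\<Union>{})"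
        using True uv by (subst qcl_single[OF Partial_order_Id_on']) (auto simp: qcl_def trancl_id trans_Id_on)
      then show ?thesis using generated.join[of "{}"] by auto
    next
      case False
      have "(u, v) \<in> set (all_pairs n)" using False uv by (auto simp: all_pairs_def)
      from fm.pinned[OF Y ne enc pins this uv] obtain \<rho> where \<rho>: "\<rho> \<in> generated (Id_on ?A) (set (map rel Ts))"
        "(u, v) \<in> \<rho>" "\<forall>(x, y)\<in>\<rho>. x = y \<or> x = u \<and> y = v" by blast
      have "\<rho> \<in> Quo_e (Id_on ?A)" by (rule generated_in_Quo_e[OF Partial_order_Id_on' Y \<rho>(1)])
      from Quo_eD(1,2)[OF this] have "\<rho> = insert (u, v) (Id_on ?A)" using \<rho>(2,3) by auto
      also have "\<dots> = qcl (Id_on ?A) {(u, v)}"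
        using uv by (subst qcl_single[OF Partial_order_Id_on']) auto
      finally show ?thesis using \<rho>(1) by simp
    qed
  qed
  then have "complete_generating_set (Quo_e (Id_on ?A)) (set (map rel Ts))"
    using Y complete_generating_set_iff_generated[OF Partial_order_Id_on'] by blast
  moreover have "card (set (map rel Ts)) \<le> length Ts" using card_length[of "map rel Ts"] by simp
  ultimately show ?thesis unfolding generated_by_at_most_def by blast
qed

lemma two_points: "generated_by_at_most 2 {..<2::nat}"
proof -
  have "list_all table_trans [[(0,1)],[(1,0)]]"
    "list_all (pinned 2 (exec 2 (small_env 2 [[(0,1)],[(1,0)]]) [])) (all_pairs 2)"
    by code_simp+
  from small_generated[OF _ _ this(1) _ this(2)] show ?thesis by (simp add: numeral_2_eq_2)
qed

definition three_tables :: "(nat \<times> nat) list list" where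
  "three_tables = [[(0,2),(2,0)], [(0,1),(0,2),(1,2),(2,1)], [(1,0),(1,2),(2,0),(2,1)], [(0,1),(1,0)]]"

definition three_prog :: "instr list" where
  "three_prog = [Meet 1 [3], Meet 0 [1], Meet 2 [3], Meet 0 [2], Join 5 [6], Meet 8 [1,2], Join 4 [7], Meet 10 [1,2]]"

lemma three_points: "generated_by_at_most 4 {..<3::nat}"
proof -
  have "list_all table_trans three_tables"
    "list_all (pinned 3 (exec 3 (small_env 3 three_tables) three_prog)) (all_pairs 3)"
    by code_simp+
  from small_generated[OF _ _ this(1) _ this(2)] show ?thesis by (simp add: three_tables_def eval_nat_numeral)
qed

definition four_tables :: "(nat \<times> nat) list list" where
  "four_tables = [[(0,1),(0,2),(1,0),(1,2),(2,0),(2,1)], [(0,1),(0,3),(3,0),(3,1)], [(1,0),(1,2),(1,3),(2,3),(3,2)],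
     [(0,3),(1,3),(2,1),(2,3)], [(0,2),(0,3),(2,0),(2,3),(3,0),(3,2)]]"

definition four_prog :: "instr list" where
  "four_prog = [Meet 0 [1], Meet 1 [3], Join 1 [3], Meet 2 [0,7], Meet 0 [4,7], Meet 0 [3],
    Meet 3 [2,4], Join 2 [5], Meet 0 [4,12], Join 6 [8], Meet 14 [2,3], Join 2 [9],
    Meet 1 [16], Join 13 [17], Meet 2 [18], Join 15 [19], Meet 0 [20], Join 10 [19], Meet 1 [22]]"

lemma four_points: "generated_by_at_most 5 {..<4::nat}"
proof -
  have "list_all table_trans four_tables"
    "list_all (pinned 4 (exec 4 (small_env 4 four_tables) four_prog)) (all_pairs 4)"
    by code_simp+
  from small_generated[OF _ _ this(1) _ this(2)] show ?thesis by (simp add: four_tables_def eval_nat_numeral)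
qed

subsection \<open>Larger finite sets\<close>

text \<open>
  Transport moves the four generators of the coded structure to any set of its size.
\<close>

lemma antichain_code_generated:
  assumes "antichain_code P M R lt"
  shows "generated_by_at_most 4 (antichain_code.A P M)"
proof -
  interpret antichain_code P M R lt by (rule assms)
  have "card {\<alpha>, \<beta>, \<gamma>, \<delta>} \<le> 4"
    using card_length[of "[\<alpha>, \<beta>, \<gamma>, \<delta>]"] by simp
  then show ?thesis unfolding generated_by_at_most_def using four_generators by blast
qed

lemma finite_five_points:
  assumes "finite B" "5 \<le> card B"
  shows "generated_by_at_most 4 B"
proof -
  define m where "m = card B - 5"
  let ?P = "{..<(m + 1) div 2}" and ?M = "{..<m div 2}"
  let ?R = "\<lambda>i. if i = 0 then {Inr 1} else {Inl (i - 1)} :: (nat + nat) set"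
  interpret antichain_code ?P ?M ?R less_than
    by unfold_locales (auto split: if_splits)
  have inj: "inj_on (Base :: nat \<Rightarrow> nat point) X" "inj_on Plus Y" "inj_on Minus Z" for X and Y Z :: "nat set"
    by (auto simp: inj_on_def)
  have "card A = card (Base ` {..<5} :: nat point set) + card (Plus ` ?P) + card (Minus ` ?M)"
    unfolding A_def by (subst card_Un_disjoint; (subst card_Un_disjoint)?; force)
  also have "\<dots> = 5 + m"
    unfolding card_image[OF inj(1)] card_image[OF inj(2)] card_image[OF inj(3)] by simp
  finally have "card A = card B" using assms(2) by (simp add: m_def)
  moreover have "finite A" unfolding A_def by simp
  ultimately obtain f where "bij_betw f A B" using assms(1) finite_same_card_bij by blast
  then show ?thesis
    using generated_by_at_most_bij antichain_code_generated[OF antichain_code_axioms] by blast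
qed


section \<open>Coding the points of an infinite set\<close>

lemma Field_Restr_underS:
  assumes "Well_order r"
  shows "Field (Restr r (underS r a)) = underS r a"
proof -
  have "(x, x) \<in> r" if "x \<in> underS r a" for x
    using that assms unfolding order_on_defs refl_on_def underS_def by (auto intro: FieldI1)
  then show ?thesis by (auto simp: Field_def)
qed

context
  fixes A :: "'a set"
  assumes inf: "infinite A"
begin

definition below :: "'a \<Rightarrow> 'a set" where "below x = underS |A| x"

lemma below_subset: "y \<in> below x \<Longrightarrow> y \<in> A" "y \<in> below x \<Longrightarrow> x \<in> A"
  unfolding below_def underS_def using Field_card_of[of A] by (auto simp: Field_def)

lemma wo: "Well_order |A|" "wo_rel |A|"
  using card_of_Well_order[of A] by (simp_all add: wo_rel_def)

lemma below_total: "x \<in> A \<Longrightarrow> y \<in> A \<Longrightarrow> x \<noteq> y \<Longrightarrow> x \<in> below y \<or> y \<in> below x"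
  using wo_rel.TOTALS[OF wo(2)] by (auto simp: below_def underS_def Field_card_of)

lemma below_trans: "x \<in> below y \<Longrightarrow> y \<in> below z \<Longrightarrow> x \<in> below z"
  using wo_rel.TRANS[OF wo(2)] wo_rel.ANTISYM[OF wo(2)]
  unfolding below_def underS_def trans_def antisym_def by blast

lemma below_irrefl: "x \<notin> below x"
  by (auto simp: below_def underS_def)

lemma below_asym: "x \<in> below y \<Longrightarrow> y \<notin> below x"
  using below_trans below_irrefl by blast

lemma wf_below: "wf {(x, y). x \<in> below y}"
proof -
  have "{(x, y). x \<in> below y} = |A| - Id" by (auto simp: below_def underS_def)
  then show ?thesis using wo_rel.WF[OF wo(2)] by simp
qed

lemma least_exists:
  assumes "x \<in> A" "Q x"
  shows "\<exists>m. m \<in> A \<and> Q m \<and> (\<forall>y\<in>below m. \<not> Q y) \<and> (m = x \<or> m \<in> below x)"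
proof -
  obtain m where m: "m \<in> {y \<in> A. Q y}" "\<And>y. (y, m) \<in> {(x, y). x \<in> below y} \<Longrightarrow> y \<notin> {y \<in> A. Q y}"
    using wfE_min[OF wf_below, of x "{y \<in> A. Q y}"] assms by blast
  then have "\<not> Q y" if "y \<in> below m" for y using that below_subset by blast
  moreover from this have "m = x \<or> m \<in> below x" using below_total[of m x] m(1) assms by blast
  ultimately show ?thesis using m(1) by blast
qed

lemma below_card:
  assumes "x \<in> A" "|B| <o |below x|"
  obtains y where "y \<in> below x" "|B| =o |below y|"
proof -
  have "|below x| \<le>o |A|" using below_subset by (intro card_of_mono1) blast
  then have "|B| <o |A|" by (rule ordLess_ordLeq_trans[OF assms(2)])
  then obtain y where y: "y \<in> A" "|B| =o Restr |A| (underS |A| y)"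
    using ordLess_iff_ordIso_Restr[OF wo(1) card_of_Well_order, of B] by (auto simp: Field_card_of)
  have "Field (Restr |A| (underS |A| y)) = underS |A| y"
    by (rule Field_Restr_underS[OF wo(1)])
  then have iso: "|B| =o |below y|"
    using card_of_cong[OF y(2)] by (simp add: Field_card_of below_def)
  have "y \<in> below x"
  proof (rule ccontr)
    assume "y \<notin> below x"
    then have "x = y \<or> x \<in> below y" using below_total[OF assms(1) y(1)] by blast
    then have "below x \<subseteq> below y" using below_trans by blast
    then have "|below x| \<le>o |below y|" by (rule card_of_mono1)
    then have "|below x| \<le>o |B|" using iso ordIso_symmetric ordLeq_ordIso_trans by blast
    then show False using assms(2) not_ordLess_ordLeq by blast
  qed
  then show ?thesis using that iso by blast
qed

text \<open>
  The initial segments of the well-order \<open>|A|\<close> play the role of ordinals, and the following is cofinality and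
  regularity for them.
\<close>

definition cofinal :: "'a \<Rightarrow> 'a set \<Rightarrow> bool" where
  "cofinal x C \<longleftrightarrow> C \<subseteq> below x \<and> (\<forall>z\<in>below x. \<exists>w\<in>C. z = w \<or> z \<in> below w)"

lemma cofinal_below: "cofinal x (below x)"
  by (auto simp: cofinal_def)

definition cof :: "'a \<Rightarrow> 'a" where
  "cof x = (SOME e. e \<in> A \<and> (\<exists>C. cofinal x C \<and> |C| \<le>o |below e| ) \<and>
     (\<forall>e'\<in>below e. \<not> (\<exists>C. cofinal x C \<and> |C| \<le>o |below e'| )) \<and> (e = x \<or> e \<in> below x))"

lemma cof:
  assumes "x \<in> A"
  shows "\<exists>C. cofinal x C \<and> |C| \<le>o |below (cof x)|"
    "\<And>e C. e \<in> below (cof x) \<Longrightarrow> cofinal x C \<Longrightarrow> \<not> |C| \<le>o |below e|" "cof x = x \<or> cof x \<in> below x"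
proof -
  have "\<exists>C. cofinal x C \<and> |C| \<le>o |below x|"
    using cofinal_below card_of_refl ordIso_iff_ordLeq by blast
  then have "\<exists>e. e \<in> A \<and> (\<exists>C. cofinal x C \<and> |C| \<le>o |below e| ) \<and>
     (\<forall>e'\<in>below e. \<not> (\<exists>C. cofinal x C \<and> |C| \<le>o |below e'| )) \<and> (e = x \<or> e \<in> below x)"
    by (rule least_exists[where Q = "\<lambda>e. \<exists>C. cofinal x C \<and> |C| \<le>o |below e|", OF assms])
  note c = someI_ex[OF this, folded cof_def]
  note * = conjunct1[OF conjunct2[OF c]] conjunct1[OF conjunct2[OF conjunct2[OF c]]]
    conjunct2[OF conjunct2[OF conjunct2[OF c]]]
  show "\<exists>C. cofinal x C \<and> |C| \<le>o |below (cof x)|" by (rule *(1))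
  show "cof x = x \<or> cof x \<in> below x" by (rule *(3))
  show "\<not> |C| \<le>o |below e|" if "e \<in> below (cof x)" "cofinal x C" for e C
    using bspec[OF *(2) that(1)] that(2) by simp
qed

lemma ladder_exists:
  assumes "x \<in> A"
  shows "\<exists>D. cofinal x D \<and> (\<forall>z\<in>below x. |D \<inter> below z| <o |below (cof x)| )"
proof -
  obtain C where C: "cofinal x C" "|C| \<le>o |below (cof x)|" using cof(1)[OF assms] by blast
  let ?s = "|C|"
  have ws: "wo_rel ?s" using card_of_Well_order[of C] by (simp add: wo_rel_def)
  define D where "D = {w \<in> C. \<forall>v\<in>underS ?s w. v \<in> below w}"
  have min: "\<exists>w\<in>D. z = w \<or> z \<in> below w" if z: "z \<in> below x" for z
  proof -
    let ?S = "{w \<in> C. z = w \<or> z \<in> below w}"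
    have ne: "?S \<noteq> {}" using C(1) z by (auto simp: cofinal_def)
    obtain w where w: "w \<in> ?S" "\<And>v. (v, w) \<in> ?s - Id \<Longrightarrow> v \<notin> ?S"
      using wfE_min'[OF wo_rel.WF[OF ws] ne] by blast
    have "v \<in> below w" if "v \<in> underS ?s w" for v
    proof -
      have "(v, w) \<in> ?s - Id" "v \<in> C"
        using that Field_card_of[of C] by (auto simp: underS_def Field_def)
      then have "v \<noteq> z" "z \<notin> below v" using w(2) by blast+
      moreover have "v \<in> A" "z \<in> A" using \<open>v \<in> C\<close> C(1) z below_subset by (auto simp: cofinal_def)
      ultimately have "v \<in> below z" using below_total by blast
      then show ?thesis using w(1) below_trans by blast
    qed
    then show ?thesis using w(1) by (auto simp: D_def)
  qed
  have "cofinal x D" using C(1) min by (auto simp: cofinal_def D_def)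
  moreover have "|D \<inter> below z| <o |below (cof x)|" if z: "z \<in> below x" for z
  proof -
    obtain w where w: "w \<in> D" "z = w \<or> z \<in> below w" using min[OF z] by blast
    have "D \<inter> below z \<subseteq> underS ?s w"
    proof
      fix y assume y: "y \<in> D \<inter> below z"
      then have yw: "y \<in> below w" using w(2) below_trans by blast
      then have ne: "y \<noteq> w" using below_irrefl by blast
      have mem: "y \<in> C" "w \<in> C" using y w(1) by (auto simp: D_def)
      have "w \<notin> underS ?s y"
        using y yw below_asym by (auto simp: D_def)
      then show "y \<in> underS ?s w"
        using wo_rel.TOTALS[OF ws] mem ne by (auto simp: underS_def Field_card_of)
    qed
    then have "|D \<inter> below z| \<le>o |underS ?s w|" by (rule card_of_mono1)
    moreover have "|underS ?s w| <o ?s"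
      using w(1) by (intro card_of_underS card_of_Card_order) (auto simp: Field_card_of D_def)
    ultimately show ?thesis
      using C(2) ordLeq_ordLess_trans ordLess_ordLeq_trans by blast
  qed
  ultimately show ?thesis by blast
qed

definition ladder :: "'a \<Rightarrow> 'a set" where
  "ladder x = (SOME D. cofinal x D \<and> (\<forall>z\<in>below x. |D \<inter> below z| <o |below (cof x)| ))"

lemma ladder:
  assumes "x \<in> A"
  shows "cofinal x (ladder x)" "\<And>z. z \<in> below x \<Longrightarrow> |ladder x \<inter> below z| <o |below (cof x)|"
  using someI_ex[OF ladder_exists[OF assms], folded ladder_def] by blast+

lemma ladder_inj:
  assumes "x \<in> A" "y \<in> A" "cof x = cof y" "ladder x \<subseteq> ladder y" "cof x \<in> below x"
  shows "x = y"
proof (rule ccontr)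
  assume "x \<noteq> y"
  then consider "x \<in> below y" | "y \<in> below x" using below_total assms(1,2) by blast
  then show False
  proof cases
    case 1
    let ?C = "ladder y \<inter> below x"
    have "|?C| <o |below (cof y)|" by (rule ladder(2)[OF assms(2) 1])
    moreover have "cof y \<in> A" using assms(3,5) below_subset by simp
    ultimately obtain e where e: "e \<in> below (cof y)" "|?C| =o |below e|"
      using below_card by blast
    have "cofinal x ?C"
      using ladder(1)[OF assms(1)] assms(4) unfolding cofinal_def by blast
    then show False
      using cof(2)[OF assms(1)] e assms(3) ordIso_iff_ordLeq by metis
  next
    case 2
    then obtain w where w: "w \<in> ladder x" "y = w \<or> y \<in> below w"
      using ladder(1)[OF assms(1)] by (auto simp: cofinal_def)
    then have "w \<in> below y" using assms(4) ladder(1)[OF assms(2)] by (auto simp: cofinal_def)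
    then show False using w(2) below_asym below_irrefl by blast
  qed
qed

lemma regular:
  assumes "x \<in> A" "cof x = x" "cofinal x C"
  shows "\<not> |C| <o |below x|" "e \<in> below x \<Longrightarrow> \<not> |C| \<le>o |below e|"
proof -
  show *: "\<not> |C| \<le>o |below e|" if "e \<in> below x" for e
    using cof(2)[OF assms(1) _ assms(3)] that assms(2) by simp
  show "\<not> |C| <o |below x|"
  proof
    assume "|C| <o |below x|"
    then obtain e where "e \<in> below x" "|C| =o |below e|" using below_card[OF assms(1)] by blast
    then show False using * ordIso_iff_ordLeq by blast
  qed
qed

lemma regular_below:
  assumes "x \<in> A" "cof x = x" "e \<in> below x"
  shows "|below e| <o |below x|"
proof -
  have "\<not> |below x| \<le>o |below e|" using regular(2)[OF assms(1,2) cofinal_below assms(3)] .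
  then show ?thesis using not_ordLeq_iff_ordLess[OF card_of_Well_order card_of_Well_order] by blast
qed

lemma Pow_cong: "|B| =o |C| \<Longrightarrow> |Pow B| =o |Pow C|"
  by (metis bij_betw_Pow card_of_ordIso)

lemma ctwo_cexp: "Card_order \<nu> \<Longrightarrow> |B| =o \<nu> \<Longrightarrow> ctwo ^c \<nu> =o |Pow B|"
proof -
  assume \<nu>: "Card_order \<nu>" "|B| =o \<nu>"
  have "ctwo ^c \<nu> = |Func (Field \<nu>) (UNIV :: bool set)|"
    by (simp add: cexp_def ctwo_def Field_card_of)
  also have "|Func (Field \<nu>) (UNIV :: bool set)| =o |Pow (Field \<nu>)|"
    using card_of_Pow_Func ordIso_symmetric by blast
  also have "|Pow (Field \<nu>)| =o |Pow B|"
  proof (rule Pow_cong)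
    show "|Field \<nu>| =o |B|"
      using card_of_Field_ordIso[OF \<nu>(1)] \<nu>(2) ordIso_symmetric ordIso_transitive by blast
  qed
  finally show ?thesis .
qed

text \<open>
  The failure of strong inaccessibility enters here: a regular uncountable initial segment is bounded by the power set of a smaller one.
\<close>

lemma not_strong_limit:
  assumes x: "x \<in> A" "cof x = x" and e0: "e0 \<in> below x" "infinite (below e0)" and acc: "accessible |A|"
  shows "\<exists>e\<in>below x. \<not> |Pow (below e)| <o |below x|"
proof (rule ccontr)
  assume "\<not> ?thesis"
  then have strong: "|Pow (below e)| <o |below x|" if "e \<in> below x" for e using that by blast
  have "strongly_inaccessible |below x|"
    unfolding strongly_inaccessible_def
  proof (intro conjI allI impI)
    show "Card_order |below x|" by (rule card_of_Card_order)
    have "natLeq \<le>o |below e0|" using e0(2) infinite_iff_natLeq_ordLeq by blast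
    then show "natLeq <o |below x|"
      using regular_below[OF x e0(1)] ordLeq_ordLess_trans by blast
  next
    fix \<nu> :: "'a rel" assume \<nu>: "Card_order \<nu> \<and> \<nu> <o |below x|"
    then have iso: "|Field \<nu>| =o \<nu>" using card_of_Field_ordIso by blast
    then have "|Field \<nu>| <o |below x|" using \<nu> ordIso_ordLess_trans by blast
    then obtain e where e: "e \<in> below x" "|Field \<nu>| =o |below e|" using below_card[OF x(1)] by blast
    have "|below e| =o \<nu>" using e(2) iso ordIso_symmetric ordIso_transitive by blast
    then have "ctwo ^c \<nu> =o |Pow (below e)|" using ctwo_cexp \<nu> by blast
    then show "ctwo ^c \<nu> <o |below x|" using strong[OF e(1)] ordIso_ordLess_trans by blast
  next
    fix I :: "'a rel set" and \<kappa> :: "'a rel"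
    assume I: "(\<forall>\<nu>\<in>I. Card_order \<nu> \<and> \<nu> <o |below x| ) \<and> |I| <o |below x| \<and> is_card_sup I \<kappa>"
    have "\<exists>e. e \<in> below x \<and> \<nu> =o |below e|" if "\<nu> \<in> I" for \<nu>
    proof -
      have iso: "|Field \<nu>| =o \<nu>" "\<nu> <o |below x|" using card_of_Field_ordIso I that by blast+
      then obtain e where "e \<in> below x" "|Field \<nu>| =o |below e|"
        using below_card[OF x(1)] ordIso_ordLess_trans by blast
      then show ?thesis using iso(1) ordIso_symmetric ordIso_transitive by blast
    qed
    then obtain f where f: "\<And>\<nu>. \<nu> \<in> I \<Longrightarrow> f \<nu> \<in> below x \<and> \<nu> =o |below (f \<nu>)|" by metis
    have "|f ` I| <o |below x|"
      using I card_of_image[of f I] ordLeq_ordLess_trans by blast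
    then have "\<not> cofinal x (f ` I)" using regular(1)[OF x] by blast
    then obtain z where z: "z \<in> below x" "\<And>w. w \<in> f ` I \<Longrightarrow> z \<noteq> w \<and> z \<notin> below w"
      using f unfolding cofinal_def by blast
    have le: "\<nu> \<le>o |below z|" if "\<nu> \<in> I" for \<nu>
    proof -
      have "f \<nu> \<in> below z"
        using z(2)[of "f \<nu>"] f[OF that] below_total[of z "f \<nu>"] below_subset z(1) that by blast
      then have "below (f \<nu>) \<subseteq> below z" using below_trans by blast
      then have "|below (f \<nu>)| \<le>o |below z|" by (rule card_of_mono1)
      then show ?thesis using f[OF that] ordIso_ordLeq_trans by blast
    qed
    have "\<kappa> \<le>o |below z|"
      using I le card_of_Card_order[of "below z"] unfolding is_card_sup_def by blast
    then show "\<kappa> <o |below x|" using regular_below[OF x z(1)] ordLeq_ordLess_trans by blast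
  qed
  moreover have "|below x| \<le>o |A|" using below_subset by (intro card_of_mono1) blast
  ultimately show False using acc unfolding accessible_def by blast
qed

text \<open>
  An injective coding by subsets becomes one by an antichain after replacing a subset by its graph of membership and non-membership.
\<close>

lemma antichain_coding:
  assumes "infinite B"
  shows "\<exists>h :: 'b set \<Rightarrow> 'b set. \<forall>p. p \<subseteq> B \<longrightarrow> h p \<subseteq> B \<and> (\<forall>q. q \<subseteq> B \<longrightarrow> h p \<subseteq> h q \<longrightarrow> p = q)"
proof -
  have "|B <+> B| =o |B|" using card_of_Plus_infinite1[OF assms] card_of_refl ordIso_iff_ordLeq by blast
  then obtain g where g: "bij_betw g (B <+> B) B" using card_of_ordIso by blast
  define h where "h p = g ` (p <+> (B - p))" for p
  have "h p \<subseteq> B" if "p \<subseteq> B" for p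
    using that g unfolding h_def bij_betw_def by blast
  moreover have "p = q" if pq: "p \<subseteq> B" "q \<subseteq> B" "h p \<subseteq> h q" for p q
  proof -
    have "inj_on g (B <+> B)" "p <+> (B - p) \<subseteq> B <+> B" "q <+> (B - q) \<subseteq> B <+> B"
      using g that by (auto simp: bij_betw_def)
    note g' = this
    have "p <+> (B - p) \<subseteq> q <+> (B - q)"
    proof
      fix z assume z: "z \<in> p <+> (B - p)"
      then obtain z' where z': "z' \<in> q <+> (B - q)" "g z = g z'" using pq(3) unfolding h_def by blast
      then have "z = z'" using inj_onD[OF g'(1)] z g'(2,3) by blast
      then show "z \<in> q <+> (B - q)" using z'(1) by simp
    qed
    then have sub: "Inl z \<in> p <+> (B - p) \<Longrightarrow> Inl z \<in> q <+> (B - q)"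
      "Inr z \<in> p <+> (B - p) \<Longrightarrow> Inr z \<in> q <+> (B - q)" for z by blast+
    show ?thesis
    proof
      show "p \<subseteq> q" using sub(1) by auto
      show "q \<subseteq> p" using sub(2) pq(2) by auto
    qed
  qed
  ultimately have "\<forall>p. p \<subseteq> B \<longrightarrow> h p \<subseteq> B \<and> (\<forall>q. q \<subseteq> B \<longrightarrow> h p \<subseteq> h q \<longrightarrow> p = q)" by simp
  then show ?thesis by (rule exI[of _ h])
qed

definition special :: "'a \<Rightarrow> bool" where
  "special x \<longleftrightarrow> cof x = x \<and> (\<forall>e\<in>below x. finite (below e))"

definition log_point :: "'a \<Rightarrow> 'a" where
  "log_point x = (SOME e. e \<in> below x \<and> infinite (below e) \<and> \<not> |Pow (below e)| <o |below x| )"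

lemma log_point:
  assumes "x \<in> A" "cof x = x" "\<not> special x" "accessible |A|"
  shows "log_point x \<in> below x" "infinite (below (log_point x))" "|below x| \<le>o |Pow (below (log_point x))|"
proof -
  obtain e0 where e0: "e0 \<in> below x" "infinite (below e0)" using assms(2,3) by (auto simp: special_def)
  obtain e where e: "e \<in> below x" "\<not> |Pow (below e)| <o |below x|"
    using not_strong_limit[OF assms(1,2) e0 assms(4)] by blast
  have "\<exists>e. e \<in> below x \<and> infinite (below e) \<and> \<not> |Pow (below e)| <o |below x|"
  proof (cases "finite (below e)")
    case True
    have "below e0 \<subseteq> below x" using e0(1) below_trans by blast
    then have "infinite (below x)" using e0(2) finite_subset by blast
    then have "|Pow (below e)| <o |below x|"
      using True by (intro finite_ordLess_infinite card_of_Well_order) (simp_all add: Field_card_of)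
    then show ?thesis using e(2) by blast
  qed (use e in blast)
  note * = someI_ex[OF this, folded log_point_def]
  show "log_point x \<in> below x" by (rule conjunct1[OF *])
  show "infinite (below (log_point x))" by (rule conjunct1[OF conjunct2[OF *]])
  show "|below x| \<le>o |Pow (below (log_point x))|"
    using conjunct2[OF conjunct2[OF *]] not_ordLess_iff_ordLeq[OF card_of_Well_order card_of_Well_order]
    by (rule iffD1[rotated])
qed

lemma regular_inj:
  assumes "x \<in> A" "cof x = x" "y \<in> A" "cof y = y" "|below x| =o |below y|"
  shows "x = y"
proof (rule ccontr)
  assume "x \<noteq> y"
  then have "x \<in> below y \<or> y \<in> below x" using below_total assms by blast
  then have "|below x| <o |below y| \<or> |below y| <o |below x|"
    using regular_below assms(1-4) by blast
  then show False using assms(5) not_ordLess_ordIso ordIso_symmetric by blast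
qed

lemma special_inj:
  assumes "x \<in> A" "y \<in> A" "special x" "special y"
    and "infinite (below x) \<longleftrightarrow> infinite (below y)" "below x = {} \<longleftrightarrow> below y = {}"
  shows "x = y"
proof -
  have False if xy: "x \<in> below y" "special x" "special y" "y \<in> A"
    "infinite (below x) \<longleftrightarrow> infinite (below y)" "below x = {} \<longleftrightarrow> below y = {}" for x y
  proof (cases "infinite (below x)")
    case True
    then show ?thesis using xy(1,3) by (auto simp: special_def)
  next
    case False
    then have fin: "finite (below y)" "below y \<noteq> {}" "below x \<noteq> {}" using xy by auto
    have "\<exists>m\<in>S. \<forall>w\<in>S. w = m \<or> w \<in> below m" if "finite S" "S \<noteq> {}" "S \<subseteq> A" for S
      using that
    proof (induction S rule: finite_ne_induct)
      case (insert s S)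
      then obtain m where m: "m \<in> S" "\<forall>w\<in>S. w = m \<or> w \<in> below m" by auto
      have "s = m \<or> s \<in> below m \<or> m \<in> below s" using below_total[of s m] insert.prems m(1) by auto
      then show ?case
      proof (elim disjE)
        assume s: "m \<in> below s"
        have "w \<in> below s" if "w \<in> S" for w using bspec[OF m(2) that] s below_trans[of w m s] by auto
        then show ?thesis by blast
      next
        assume "s = m" then show ?thesis using m by auto
      next
        assume "s \<in> below m" then show ?thesis using m by auto
      qed
    qed auto
    from this[OF fin(1,2)] obtain m where m: "m \<in> below y" "\<forall>w\<in>below y. w = m \<or> w \<in> below m"
      using below_subset by blast
    have "cofinal y {m}" using m by (auto simp: cofinal_def)
    moreover have "|{m}| \<le>o |below x|" using fin(3) by (simp add: card_of_singl_ordLeq)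
    ultimately show ?thesis using regular(2)[OF xy(4), of "{m}" x] xy(1,3) by (auto simp: special_def)
  qed
  note * = this
  show ?thesis
  proof (rule ccontr)
    assume "x \<noteq> y"
    then consider "x \<in> below y" | "y \<in> below x" using below_total[OF assms(1,2)] by blast
    then show False
    proof cases
      case 1 then show False using * assms by blast
    next
      case 2 then show False using *[OF 2 assms(4,3,1)] assms(5,6) by blast
    qed
  qed
qed

text \<open>
  A point with a short cofinal set below it is coded by a ladder. By accessibility, every other point, apart from the special
  ones, which are few, is coded by subsets of the initial segment of its \<open>log_point\<close>. In all cases the labels precede the point.
\<close>

lemma coding_exists:
  assumes acc: "accessible |A|"
  shows "\<exists>(k :: 'a \<Rightarrow> nat) (c :: 'a \<Rightarrow> 'a) (T :: 'a \<Rightarrow> 'a set).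
    (\<forall>x\<in>A. k x < 6 \<and> (k x < 3 \<longrightarrow> c x \<in> below x) \<and> T x \<subseteq> below x) \<and>
    (\<forall>x\<in>A. \<forall>y\<in>A. k x = k y \<longrightarrow> (k x < 3 \<longrightarrow> c x = c y) \<longrightarrow> T x \<subseteq> T y \<longrightarrow> x = y)"
proof -
  have "\<forall>B :: 'a set. \<exists>h :: 'a set \<Rightarrow> 'a set. infinite B \<longrightarrow>
      (\<forall>p. p \<subseteq> B \<longrightarrow> h p \<subseteq> B \<and> (\<forall>q. q \<subseteq> B \<longrightarrow> h p \<subseteq> h q \<longrightarrow> p = q))"
  proof
    fix B :: "'a set"
    show "\<exists>h :: 'a set \<Rightarrow> 'a set. infinite B \<longrightarrow>
      (\<forall>p. p \<subseteq> B \<longrightarrow> h p \<subseteq> B \<and> (\<forall>q. q \<subseteq> B \<longrightarrow> h p \<subseteq> h q \<longrightarrow> p = q))"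
      using antichain_coding[of B] by (cases "finite B") simp_all
  qed
  from choice[OF this] obtain h :: "'a set \<Rightarrow> 'a set \<Rightarrow> 'a set" where
    H: "\<forall>B. infinite B \<longrightarrow> (\<forall>p. p \<subseteq> B \<longrightarrow> h B p \<subseteq> B \<and> (\<forall>q. q \<subseteq> B \<longrightarrow> h B p \<subseteq> h B q \<longrightarrow> p = q))"
    ..
  have h: "h B p \<subseteq> B" "q \<subseteq> B \<Longrightarrow> h B p \<subseteq> h B q \<Longrightarrow> p = q" if "infinite B" "p \<subseteq> B" for B p q
    using H[rule_format, OF that] by simp_all
  define P where "P x = (SOME p. p \<subseteq> below (log_point x) \<and> |below x| =o |underS |Pow (below (log_point x))| p| )" for x
  have P: "P x \<subseteq> below (log_point x)" "|below x| =o |underS |Pow (below (log_point x))| (P x)|"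
    if lt: "|below x| <o |Pow (below (log_point x))|" for x
  proof -
    let ?s = "|Pow (below (log_point x))|"
    obtain p where p: "p \<in> Pow (below (log_point x))" "|below x| =o Restr ?s (underS ?s p)"
      using ordLess_iff_ordIso_Restr[OF card_of_Well_order[of "Pow (below (log_point x))"] card_of_Well_order[of "below x"]] lt
      by (auto simp: Field_card_of)
    have "Field (Restr ?s (underS ?s p)) = underS ?s p"
      by (rule Field_Restr_underS[OF card_of_Well_order])
    then have "|below x| =o |underS ?s p|" using card_of_cong[OF p(2)] by (simp add: Field_card_of)
    then have "\<exists>p. p \<subseteq> below (log_point x) \<and> |below x| =o |underS ?s p|" using p(1) by blast
    note * = someI_ex[OF this, folded P_def]
    show "P x \<subseteq> below (log_point x)" by (rule conjunct1[OF *])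
    show "|below x| =o |underS ?s (P x)|" by (rule conjunct2[OF *])
  qed
  define k :: "'a \<Rightarrow> nat" where "k x = (if cof x \<noteq> x then 0 else if special x then
      (if infinite (below x) then 3 else if below x = {} then 4 else 5)
      else if |below x| <o |Pow (below (log_point x))| then 1 else 2)" for x
  define c where "c x = (if cof x \<noteq> x then cof x else log_point x)" for x
  define T where "T x = (if k x = 0 then ladder x else if k x = 1 then h (below (log_point x)) (P x) else {})" for x
  have k1: "cof x = x \<and> \<not> special x \<and> |below x| <o |Pow (below (log_point x))|" if "k x = 1" for x
    using that by (auto simp: k_def split: if_splits)
  have k2: "cof x = x \<and> \<not> special x \<and> \<not> |below x| <o |Pow (below (log_point x))|" if "k x = 2" for x
    using that by (auto simp: k_def split: if_splits)
  have k3: "cof x = x \<and> special x" if "k x \<ge> 3" for x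
    using that by (auto simp: k_def split: if_splits)
  have k0: "cof x \<noteq> x" if "k x = 0" for x using that by (auto simp: k_def split: if_splits)
  have "k x < 6 \<and> (k x < 3 \<longrightarrow> c x \<in> below x) \<and> T x \<subseteq> below x" if x: "x \<in> A" for x
  proof (intro conjI impI)
    show "k x < 6" by (simp add: k_def)
    show "c x \<in> below x" if "k x < 3"
    proof (cases "cof x = x")
      case True
      then have "\<not> special x" using that by (auto simp: k_def split: if_splits)
      then show ?thesis using log_point(1)[OF x True _ acc] True by (simp add: c_def)
    next
      case False
      then show ?thesis using cof(3)[OF x] by (simp add: c_def)
    qed
    show "T x \<subseteq> below x"
    proof -
      have "ladder x \<subseteq> below x" using ladder(1)[OF x] by (simp add: cofinal_def)
      moreover have "h (below (log_point x)) (P x) \<subseteq> below x" if "k x = 1"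
      proof -
        note * = log_point[OF x _ _ acc] k1[OF that]
        then have "h (below (log_point x)) (P x) \<subseteq> below (log_point x)" using h(1) P(1) by blast
        also have "\<dots> \<subseteq> below x" using * below_trans by blast
        finally show ?thesis .
      qed
      ultimately show ?thesis by (simp add: T_def)
    qed
  qed
  moreover have "x = y" if xy: "x \<in> A" "y \<in> A" "k x = k y" "k x < 3 \<longrightarrow> c x = c y" "T x \<subseteq> T y" for x y
  proof -
    consider "k x = 0" | "k x = 1" | "k x = 2" | "k x \<ge> 3" by linarith
    then show ?thesis
    proof cases
      case 1
      then have "k y = 0" using xy(3) by simp
      then have "cof x \<noteq> x" "cof y \<noteq> y" using 1 k0 by blast+
      moreover then have "cof x = cof y" using xy(4) 1 by (simp add: c_def)
      moreover have "ladder x \<subseteq> ladder y" using xy(5) 1 \<open>k y = 0\<close> by (simp add: T_def)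
      ultimately show ?thesis using ladder_inj[OF xy(1,2)] cof(3)[OF xy(1)] by blast
    next
      case 2
      then have ky: "k y = 1" using xy(3) by simp
      note kx = k1[OF 2] and ky' = k1[OF ky]
      have pw: "log_point x = log_point y" using xy(4) 2 kx ky' by (simp add: c_def)
      have "h (below (log_point x)) (P x) \<subseteq> h (below (log_point x)) (P y)"
        using xy(5) 2 ky pw by (simp add: T_def)
      moreover have "P y \<subseteq> below (log_point x)" using P(1)[of y] ky' pw by simp
      moreover have "infinite (below (log_point x))" using log_point(2)[OF xy(1) _ _ acc] kx by blast
      ultimately have "P x = P y" using h(2)[of "below (log_point x)" "P x" "P y"] P(1)[of x] kx by blast
      then have "|below x| =o |below y|"
        using ordIso_transitive[OF P(2)[of x]] ordIso_symmetric[OF P(2)[of y]] kx ky' pw \<open>P x = P y\<close> by simp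
      then show ?thesis using regular_inj xy(1,2) kx ky' by blast
    next
      case 3
      then have ky: "k y = 2" using xy(3) by simp
      note kx = k2[OF 3] and ky' = k2[OF ky]
      have pw: "log_point x = log_point y" using xy(4) 3 kx ky' by (simp add: c_def)
      have top: "|below z| =o |Pow (below (log_point z))|"
        if "z \<in> A" "cof z = z" "\<not> special z" "\<not> |below z| <o |Pow (below (log_point z))|" for z
      proof -
        have "|Pow (below (log_point z))| \<le>o |below z|"
          by (rule iffD1[OF not_ordLess_iff_ordLeq[OF card_of_Well_order card_of_Well_order] that(4)])
        then show ?thesis using log_point(3)[OF that(1-3) acc] ordIso_iff_ordLeq by blast
      qed
      have "|below x| =o |Pow (below (log_point x))|" "|below y| =o |Pow (below (log_point x))|"
        using top[OF xy(1)] top[OF xy(2)] kx ky' pw by simp_all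
      then have "|below x| =o |below y|" using ordIso_transitive ordIso_symmetric by blast
      then show ?thesis using regular_inj xy(1,2) kx ky' by blast
    next
      case 4
      then have ky: "k y \<ge> 3" using xy(3) by simp
      note kx = k3[OF 4] and ky' = k3[OF ky]
      have "infinite (below x) \<longleftrightarrow> infinite (below y)" "below x = {} \<longleftrightarrow> below y = {}"
        using xy(3) kx ky' by (auto simp: k_def split: if_splits)
      then show ?thesis using special_inj[OF xy(1,2)] kx ky' by blast
    qed
  qed
  ultimately show ?thesis by blast
qed

end


subsection \<open>Infinite sets\<close>

text \<open>
  The coding turns an infinite set of accessible cardinality into the structure with four generators.
\<close>

lemma infinite_generated:
  fixes A :: "'a set"
  assumes inf: "infinite A" and acc: "accessible |A|"
  shows "generated_by_at_most 4 A"
proof -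
  obtain k :: "'a \<Rightarrow> nat" and c :: "'a \<Rightarrow> 'a" and T :: "'a \<Rightarrow> 'a set" where
    1: "\<forall>x\<in>A. k x < 6 \<and> (k x < 3 \<longrightarrow> c x \<in> below A x) \<and> T x \<subseteq> below A x" and
    2: "\<forall>x\<in>A. \<forall>y\<in>A. k x = k y \<longrightarrow> (k x < 3 \<longrightarrow> c x = c y) \<longrightarrow> T x \<subseteq> T y \<longrightarrow> x = y"
    using coding_exists[OF inf acc] by (elim exE conjE)
  define W :: "(nat + 'a \<times> bool) set" where "W = Inl ` {..<8} \<union> Inr ` (A \<times> UNIV)"
  define R :: "nat + 'a \<times> bool \<Rightarrow> ((nat + 'a \<times> bool) + nat) set" where
    "R = case_sum (\<lambda>n. if n = 0 then {Inr 1} else {Inl (Inl (n - 1)), Inr 3})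
      (\<lambda>(x, b). {Inl (Inl (if b then 0 else 1)), Inl (Inl (2 + k x))}
         \<union> (if k x < 3 then {Inl (Inr (c x, True))} else {}) \<union> (\<lambda>e. Inl (Inr (e, False))) ` T x)"
  define rank :: "nat + 'a \<times> bool \<Rightarrow> nat \<times> 'a" where
    "rank = case_sum (\<lambda>n. (n, undefined)) (\<lambda>(x, b). (8, x))"
  define lt where "lt = inv_image (less_than <*lex*> {(x, y). x \<in> below A y}) rank"
  have R_simps: "R (Inl n) = (if n = 0 then {Inr 1} else {Inl (Inl (n - 1)), Inr 3})"
    "R (Inr (x, b)) = {Inl (Inl (if b then 0 else 1)), Inl (Inl (2 + k x))}
         \<union> (if k x < 3 then {Inl (Inr (c x, True))} else {}) \<union> (\<lambda>e. Inl (Inr (e, False))) ` T x" for n x b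
    by (simp_all add: R_def)
  interpret antichain_code W W R lt
  proof
    show "wf lt"
      unfolding lt_def using wf_below[OF inf] by (intro wf_inv_image wf_lex_prod) simp_all
    show "W \<subseteq> W" by simp
    show "R w \<noteq> {}" for w by (cases w) (auto simp: R_def)
    show "R w \<subseteq> Inl ` {v \<in> W. (v, w) \<in> lt} \<union> Inr ` {1, 3}" if w: "w \<in> W" for w
    proof (cases w)
      case (Inl n)
      then show ?thesis using w by (auto simp: R_simps W_def lt_def rank_def)
    next
      case (Inr z)
      then obtain x b where z: "w = Inr (x, b)" "x \<in> A" using w by (cases z) (auto simp: W_def)
      have k: "k x < 6" "k x < 3 \<Longrightarrow> c x \<in> below A x" "T x \<subseteq> below A x" using 1 z(2) by auto
      then have "k x < 3 \<Longrightarrow> c x \<in> A" "T x \<subseteq> A" using below_subset(1)[OF inf] by auto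
      then show ?thesis using k unfolding z(1) R_simps
        by (auto simp: W_def lt_def rank_def inj_image_mem_iff)
    qed
    show "v = w" if vw: "v \<in> W" "w \<in> W" "R v \<subseteq> R w" for v w
    proof (cases v)
      case (Inl n)
      show ?thesis
      proof (cases w)
        case (Inl m)
        then show ?thesis using vw(3) \<open>v = Inl n\<close> by (auto simp: R_simps split: if_splits)
      next
        case (Inr z)
        have "\<exists>s. Inr s \<in> R v" using Inl by (auto simp: R_simps)
        moreover have "Inr s \<notin> R w" for s using Inr by (cases z) (auto simp: R_simps)
        ultimately show ?thesis using vw(3) by blast
      qed
    next
      case (Inr z)
      obtain x b where z: "v = Inr (x, b)" "x \<in> A" using vw(1) Inr by (cases z) (auto simp: W_def)
      have mem: "Inl (Inl (if b then 0 else 1)) \<in> R w" "Inl (Inl (2 + k x)) \<in> R w"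
        using vw(3) unfolding z(1) R_simps by auto
      show ?thesis
      proof (cases w)
        case (Inl m)
        then show ?thesis using mem by (auto simp: R_simps split: if_splits)
      next
        case (Inr z')
        then obtain y b' where y: "w = Inr (y, b')" "y \<in> A" using vw(2) by (cases z') (auto simp: W_def)
        have "b = b'" "k x = k y" using mem unfolding y(1) R_simps by (auto split: if_splits)
        moreover have "k x < 3 \<longrightarrow> c x = c y" 
        proof
          assume kx: "k x < 3"
          have "Inl (Inr (c x, True)) \<in> R v" using kx unfolding z(1) R_simps by simp
          then have "Inl (Inr (c x, True)) \<in> R w" using vw(3) by blast
          then show "c x = c y" unfolding y(1) R_simps by (auto split: if_splits)
        qed
        moreover have "T x \<subseteq> T y"
        proof
          fix e assume "e \<in> T x"
          then have "Inl (Inr (e, False)) \<in> R v" unfolding z(1) R_simps by simp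
          then have "Inl (Inr (e, False)) \<in> R w" using vw(3) by blast
          then show "e \<in> T y" unfolding y(1) R_simps by (auto split: if_splits)
        qed
        ultimately have "x = y" using bspec[OF bspec[OF 2 z(2)] y(2)] by simp
        then show ?thesis using z(1) y(1) \<open>b = b'\<close> by simp
      qed
    qed
  qed
  let ?P = "antichain_code.A W W"
  have inf': "\<not> finite (Field |A| )" using inf by (simp add: Field_card_of)
  have fin: "|S| \<le>o |A|" if "finite S" for S :: "'z set"
    using that inf' by (intro ordLess_imp_ordLeq finite_ordLess_infinite card_of_Well_order)
      (simp_all add: Field_card_of)
  have Un: "|S1 \<union> S2| \<le>o |A|" if "|S1| \<le>o |A|" "|S2| \<le>o |A|" for S1 S2 :: "'z set"
    by (rule card_of_Un_ordLeq_infinite_Field[OF inf' that card_of_Card_order])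
  have im: "|f ` S| \<le>o |A|" if "|S| \<le>o |A|" for f :: "'y \<Rightarrow> 'z" and S
    using card_of_image that ordLeq_transitive by blast
  have "|A \<times> (UNIV :: bool set)| \<le>o |A|"
    using fin[of "UNIV :: bool set"] card_of_refl[of A] ordIso_iff_ordLeq
    by (intro card_of_Times_ordLeq_infinite_Field[OF inf' _ _ card_of_Card_order]) auto
  then have "|Inr ` (A \<times> UNIV) :: (nat + 'a \<times> bool) set| \<le>o |A|"
    using card_of_image ordLeq_transitive by blast
  moreover have "|Inl ` {..<8} :: (nat + 'a \<times> bool) set| \<le>o |A|"
    using inf' by (intro ordLess_imp_ordLeq finite_ordLess_infinite card_of_Well_order)
      (simp_all add: Field_card_of)
  ultimately have "|W| \<le>o |A|"
    unfolding W_def by (intro card_of_Un_ordLeq_infinite_Field[OF inf' _ _ card_of_Card_order])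
  then have WP: "|Plus ` W| \<le>o |A|" "|Minus ` W| \<le>o |A|"
    using card_of_image ordLeq_transitive by blast+
  have "|Base ` {..<5} :: (nat + 'a \<times> bool) point set| \<le>o |A|"
    using inf' by (intro ordLess_imp_ordLeq finite_ordLess_infinite card_of_Well_order)
      (simp_all add: Field_card_of)
  then have "|?P| \<le>o |A|"
    unfolding A_def using WP
    by (intro card_of_Un_ordLeq_infinite_Field[OF inf' _ _ card_of_Card_order])
  moreover have "|A| \<le>o |?P|"
  proof (rule card_of_ordLeqI)
    show "inj_on (\<lambda>x. Plus (Inr (x, True))) A" by (auto simp: inj_on_def)
    show "Plus (Inr (x, True)) \<in> ?P" if "x \<in> A" for x
    proof -
      have "Inr (x, True) \<in> W" using that by (auto simp: W_def)
      then show ?thesis by simp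
    qed
  qed
  ultimately have "|?P| =o |A|" using ordIso_iff_ordLeq by blast
  then obtain f where "bij_betw f ?P A" using card_of_ordIso by blast
  then show ?thesis
    using generated_by_at_most_bij antichain_code_generated[OF antichain_code_axioms] by blast
qed

lemma card_of_ordIso_natLeq_on: "|B| =o natLeq_on n \<longleftrightarrow> finite B \<and> card B = n"
proof
  assume "|B| =o natLeq_on n"
  from card_of_cong[OF this] have "|B| =o |{x. x < n}|"
    by (simp add: Field_card_of Field_natLeq_on)
  then obtain f where "bij_betw f B {x. x < n}" using card_of_ordIso by blast
  then show "finite B \<and> card B = n"
    using bij_betw_finite bij_betw_same_card by fastforce
next
  assume B: "finite B \<and> card B = n"
  then obtain f where "bij_betw f B {x. x < n}"
    using finite_same_card_bij[of B "{x. x < n}"] by auto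
  then have 1: "|B| =o |{x. x < n}|" using card_of_ordIso by blast
  have "well_order_on {x. x < n} (natLeq_on n)"
    using natLeq_on_Well_order[of n] by (simp add: Field_natLeq_on)
  then have "|{x. x < n}| =o natLeq_on n"
    using finite_well_order_on_ordIso[of "{x. x < n}"] card_of_well_order_on by blast
  then show "|B| =o natLeq_on n" using 1 ordIso_transitive by blast
qed

text \<open>
  Sizes two, three and four are settled by explicit programs, all larger sizes by the coded structure.
\<close>

theorem f4_generated:
  fixes A :: "'a set"
  assumes acc: "accessible |A|" and two: "x \<in> A" "y \<in> A" "x \<noteq> y"
  shows "generated_by_at_most (f4 |A| ) A"
proof (cases "finite A")
  case False
  then have "f4 |A| = 4" unfolding f4_def card_of_ordIso_natLeq_on by simp
  then show ?thesis using infinite_generated[OF False acc] by simp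
next
  case True
  have "card {x, y} \<le> card A" using two True by (intro card_mono) auto
  then have ge2: "2 \<le> card A" using two by simp
  have small: "generated_by_at_most k A" if gen: "generated_by_at_most k {..<n::nat}" and n: "card A = n" for k n
  proof -
    obtain f where "bij_betw f {..<n} A" using finite_same_card_bij[of "{..<n}" A] True n by auto
    then show ?thesis using generated_by_at_most_bij gen by blast
  qed
  consider "card A = 2" | "card A = 3" | "card A = 4" | "card A \<ge> 5" using ge2 by linarith
  then show ?thesis
  proof cases
    case 1
    then have "f4 |A| = 2" unfolding f4_def card_of_ordIso_natLeq_on by (simp add: True)
    then show ?thesis using small[OF two_points 1] by simp
  next
    case 2
    then have "f4 |A| = 4" unfolding f4_def card_of_ordIso_natLeq_on by (simp add: True)
    then show ?thesis using small[OF three_points 2] by simp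
  next
    case 3
    then have "f4 |A| = 5" unfolding f4_def card_of_ordIso_natLeq_on by (simp add: True)
    then show ?thesis using small[OF four_points 3] by simp
  next
    case 4
    then have "f4 |A| = 4" unfolding f4_def card_of_ordIso_natLeq_on by (simp add: True)
    then show ?thesis using finite_five_points[OF True 4] by simp
  qed
qed

lemma f4_cong:
  assumes "\<kappa> =o \<kappa>'" shows "f4 \<kappa> = f4 \<kappa>'"
proof -
  have eq: "\<kappa> =o \<nu> \<longleftrightarrow> \<kappa>' =o \<nu>" for \<nu> :: "nat rel"
    using ordIso_transitive[OF assms, of \<nu>] ordIso_transitive[OF ordIso_symmetric[OF assms], of \<nu>] by auto
  show ?thesis unfolding f4_def eq ..
qed


section \<open>Components\<close>

locale finite_component_poset =
  fixes \<mu> :: "'a rel"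
  assumes po: "Partial_order \<mu>" and fcs: "finite_component_size \<mu>"
begin

abbreviation E where "E \<equiv> component_equiv \<mu>"

definition cls :: "'a \<Rightarrow> 'a set" where "cls x = E `` {x}"

lemma refl_mu: "x \<in> Field \<mu> \<Longrightarrow> (x, x) \<in> \<mu>"
  using po unfolding order_on_defs refl_on_def by auto

lemma trans_mu: "(x, y) \<in> \<mu> \<Longrightarrow> (y, z) \<in> \<mu> \<Longrightarrow> (x, z) \<in> \<mu>"
  using po unfolding order_on_defs trans_def by blast

lemma antisym_mu: "(x, y) \<in> \<mu> \<Longrightarrow> (y, x) \<in> \<mu> \<Longrightarrow> x = y"
  using po unfolding order_on_defs antisym_def by blast

lemma mu_Field: "(x, y) \<in> \<mu> \<Longrightarrow> x \<in> Field \<mu>" "(x, y) \<in> \<mu> \<Longrightarrow> y \<in> Field \<mu>"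
  by (auto simp: Field_def)

lemma Edge_mu: "(x, y) \<in> Edge \<mu> \<Longrightarrow> (x, y) \<in> \<mu>" "(x, y) \<in> Edge \<mu> \<Longrightarrow> x \<noteq> y"
  by (auto simp: Edge_def)

lemma equiv_E: "equiv (Field \<mu>) E"
proof -
  have "Edge \<mu> \<subseteq> Field \<mu> \<times> Field \<mu>"
  proof (rule subrelI)
    fix x y assume "(x, y) \<in> Edge \<mu>"
    then have "(x, y) \<in> \<mu>" by (rule Edge_mu(1))
    then show "(x, y) \<in> Field \<mu> \<times> Field \<mu>" using mu_Field[of x y] by simp
  qed
  then have top: "Field \<mu> \<times> Field \<mu> \<in> {\<theta>. equiv (Field \<mu>) \<theta> \<and> Edge \<mu> \<subseteq> \<theta>}"
    by (auto simp: equiv_def refl_on_def sym_def trans_def)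
  show ?thesis
  proof (rule equivI)
    show "E \<subseteq> Field \<mu> \<times> Field \<mu>" unfolding component_equiv_def by (rule Inter_lower[OF top])
    show "refl_on (Field \<mu>) E" unfolding component_equiv_def
      by (auto simp: refl_on_def equiv_def)
    show "sym E" unfolding component_equiv_def by (rule symI) (auto simp: equiv_def dest: symD)
    show "trans E"
    proof (rule transI)
      fix x y z assume xy: "(x, y) \<in> E" and yz: "(y, z) \<in> E"
      show "(x, z) \<in> E"
        unfolding component_equiv_def
      proof (rule InterI)
        fix \<theta> assume t: "\<theta> \<in> {\<theta>. equiv (Field \<mu>) \<theta> \<and> Edge \<mu> \<subseteq> \<theta>}"
        then have "(x, y) \<in> \<theta>" "(y, z) \<in> \<theta>" "trans \<theta>"
          using xy yz unfolding component_equiv_def by (auto simp: equiv_def)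
        then show "(x, z) \<in> \<theta>" by (meson transD)
      qed
    qed
  qed
qed

lemma Edge_E: "Edge \<mu> \<subseteq> E"
  unfolding component_equiv_def by auto

lemma E_refl: "x \<in> Field \<mu> \<Longrightarrow> (x, x) \<in> E"
  using equiv_E by (auto simp: equiv_def refl_on_def)

lemma E_sym: "(x, y) \<in> E \<Longrightarrow> (y, x) \<in> E"
  using equiv_E by (auto simp: equiv_def dest: symD)

lemma E_trans: "(x, y) \<in> E \<Longrightarrow> (y, z) \<in> E \<Longrightarrow> (x, z) \<in> E"
  using equiv_E unfolding equiv_def by (meson transD)

lemma E_Field: "(x, y) \<in> E \<Longrightarrow> x \<in> Field \<mu>" "(x, y) \<in> E \<Longrightarrow> y \<in> Field \<mu>"
  using equiv_E by (auto simp: equiv_def)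

text \<open>
  A chain of maximal size in an interval consists of covering pairs; induction on that size avoids
  constructing it.
\<close>

lemma mu_Edge_path:
  assumes "(x, y) \<in> \<mu>" shows "(x, y) \<in> (Edge \<mu>)\<^sup>*"
proof -
  obtain n where n: "\<not> (\<exists>C\<in>Chains \<mu>. finite C \<and> card C = n + 2)"
    using fcs unfolding finite_component_size_def finite_length_def by blast
  have bound: "card C \<le> n + 1" if C: "C \<in> Chains \<mu>" "finite C" for C
  proof (rule ccontr)
    assume "\<not> ?thesis"
    then have "n + 2 \<le> card C" by simp
    then obtain D where "D \<subseteq> C" "card D = n + 2" "finite D"
      by (meson obtain_subset_with_card_n)
    moreover from this have "D \<in> Chains \<mu>" using C(1) unfolding Chains_def by blast
    ultimately show False using n by blast
  qed
  define chains where "chains x y = {C \<in> Chains \<mu>. finite C \<and> (\<forall>z\<in>C. (x, z) \<in> \<mu> \<and> (z, y) \<in> \<mu>)}" for x y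
  define size where "size x y = Max (card ` chains x y)" for x y
  have fin: "finite (card ` chains x y)" for x y
    by (rule finite_subset[of _ "{..n + 1}"]) (use bound in \<open>auto simp: chains_def\<close>)
  have ne: "chains x y \<noteq> {}" for x y
    by (auto simp: chains_def Chains_def intro!: exI[of _ "{}"])
  have attained: "\<exists>C\<in>chains x y. card C = size x y" for x y
    using Max_in[OF fin[of x y]] ne[of x y] unfolding size_def by auto
  have larger: "card C \<le> size x y" if "C \<in> chains x y" for C x y
    unfolding size_def using that fin by (intro Max_ge) auto
  have "(x, y) \<in> \<mu> \<Longrightarrow> (x, y) \<in> (Edge \<mu>)\<^sup>*" for x y
  proof (induction "size x y" arbitrary: x y rule: less_induct)
    case less
    show ?case
    proof (cases "x = y \<or> (x, y) \<in> Edge \<mu>")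
      case True
      then show ?thesis by auto
    next
      case False
      then obtain z where z: "z \<noteq> x" "z \<noteq> y" "(x, z) \<in> \<mu>" "(z, y) \<in> \<mu>"
        using less.prems by (auto simp: Edge_def)
      obtain C where C: "C \<in> chains x z" "card C = size x z" using attained by blast
      have yC: "y \<notin> C" using C(1) z antisym_mu by (auto simp: chains_def)
      have "insert y C \<in> Chains \<mu>"
        unfolding Chains_def
      proof (intro CollectI ballI)
        have Cz: "(u, y) \<in> \<mu>" if "u \<in> C" for u using C(1) that z(4) trans_mu by (auto simp: chains_def)
        have Cc: "(u, v) \<in> \<mu> \<or> (v, u) \<in> \<mu>" if "u \<in> C" "v \<in> C" for u v
          using C(1) that by (auto simp: chains_def Chains_def)
        fix u v assume "u \<in> insert y C" "v \<in> insert y C"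
        then show "(u, v) \<in> \<mu> \<or> (v, u) \<in> \<mu>" using Cz Cc refl_mu mu_Field(2)[OF z(4)] by auto
      qed
      moreover have "(x, u) \<in> \<mu> \<and> (u, y) \<in> \<mu>" if "u \<in> insert y C" for u
      proof (cases "u = y")
        case True
        then show ?thesis using less.prems refl_mu[OF mu_Field(2)[OF less.prems]] by simp
      next
        case False
        then show ?thesis using C(1) that trans_mu[OF _ z(4), of u] by (auto simp: chains_def)
      qed
      ultimately have "insert y C \<in> chains x y" using C(1) by (auto simp: chains_def)
      from larger[OF this] have 1: "size x z < size x y"
        using C yC by (simp add: chains_def)
      obtain D where D: "D \<in> chains z y" "card D = size z y" using attained by blast
      have xD: "x \<notin> D" using D(1) z antisym_mu by (auto simp: chains_def)
      have "insert x D \<in> Chains \<mu>"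
        unfolding Chains_def
      proof (intro CollectI ballI)
        have Dz: "(x, u) \<in> \<mu>" if "u \<in> D" for u using D(1) that z(3) trans_mu by (auto simp: chains_def)
        have Dc: "(u, v) \<in> \<mu> \<or> (v, u) \<in> \<mu>" if "u \<in> D" "v \<in> D" for u v
          using D(1) that by (auto simp: chains_def Chains_def)
        fix u v assume "u \<in> insert x D" "v \<in> insert x D"
        then show "(u, v) \<in> \<mu> \<or> (v, u) \<in> \<mu>" using Dz Dc refl_mu[OF mu_Field(1)[OF z(3)]] by auto
      qed
      moreover have "(x, u) \<in> \<mu> \<and> (u, y) \<in> \<mu>" if "u \<in> insert x D" for u
      proof (cases "u = x")
        case True
        then show ?thesis using less.prems refl_mu[OF mu_Field(1)[OF less.prems]] by simp
      next
        case False
        then show ?thesis using D(1) that trans_mu[OF z(3), of u] by (auto simp: chains_def)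
      qed
      ultimately have "insert x D \<in> chains x y" using D(1) by (auto simp: chains_def)
      from larger[OF this] have 2: "size z y < size x y"
        using D xD by (simp add: chains_def)
      show ?thesis using less.hyps[OF 1 z(3)] less.hyps[OF 2 z(4)] by (rule rtrancl_trans)
    qed
  qed
  then show ?thesis using assms by blast
qed

lemma mu_E: assumes "(x, y) \<in> \<mu>" shows "(x, y) \<in> E"
  using mu_Edge_path[OF assms]
proof (induction rule: rtrancl_induct)
  case base
  then show ?case using E_refl mu_Field(1)[OF assms] by blast
next
  case (step y z)
  then show ?case using E_trans Edge_E by blast
qed

lemma cls_eq: "(x, y) \<in> E \<Longrightarrow> cls x = cls y"
  unfolding cls_def by (rule equiv_class_eq[OF equiv_E])

lemma in_cls: "x \<in> Field \<mu> \<Longrightarrow> x \<in> cls x" "y \<in> cls x \<Longrightarrow> (x, y) \<in> E"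
  using E_refl by (auto simp: cls_def)

lemma cls_eq_iff: "x \<in> Field \<mu> \<Longrightarrow> y \<in> Field \<mu> \<Longrightarrow> cls x = cls y \<longleftrightarrow> (x, y) \<in> E"
  using cls_eq in_cls by blast

definition classes :: "'a set set" where "classes = cls ` Field \<mu>"

lemma classes_quotient: "Field \<mu> // E = classes"
  by (auto simp: quotient_def classes_def cls_def)

lemma class_sub: "B \<in> classes \<Longrightarrow> B \<subseteq> Field \<mu>"
  using E_Field by (auto simp: classes_def cls_def)

lemma class_of:
  assumes "B \<in> classes" "x \<in> B" shows "cls x = B"
proof -
  obtain y where "B = cls y" using assms(1) by (auto simp: classes_def)
  then show ?thesis using cls_eq[OF in_cls(2)[of x y]] assms(2) by simp
qed

lemma cls_classes: "x \<in> Field \<mu> \<Longrightarrow> cls x \<in> classes"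
  by (auto simp: classes_def)

lemma class_closed:
  assumes "B \<in> classes" "x \<in> B" "(x, y) \<in> E" shows "y \<in> B"
proof -
  have "y \<in> cls x" using assms(3) by (simp add: cls_def)
  then show ?thesis using class_of[OF assms(1,2)] by simp
qed

lemma class_mu: "B \<in> classes \<Longrightarrow> (x, y) \<in> \<mu> \<Longrightarrow> x \<in> B \<longleftrightarrow> y \<in> B"
  using class_closed[of B x y] class_closed[of B y x] mu_E[of x y] E_sym[of x y] by blast

lemma class_disjoint: "B \<in> classes \<Longrightarrow> C \<in> classes \<Longrightarrow> B \<noteq> C \<Longrightarrow> B \<inter> C = {}"
  using class_of[of B] class_of[of C] by blast

lemma class_ne: "B \<in> classes \<Longrightarrow> B \<noteq> {}"
  unfolding classes_def using in_cls(1) by blast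

lemma Field_Restr_class: "B \<in> classes \<Longrightarrow> Field (Restr \<mu> B) = B"
proof -
  assume B: "B \<in> classes"
  have "(x, x) \<in> Restr \<mu> B" if "x \<in> B" for x using that class_sub[OF B] refl_mu by auto
  then have "B \<subseteq> Field (Restr \<mu> B)" by (auto intro: FieldI1)
  moreover have "Field (Restr \<mu> B) \<subseteq> B" by (auto simp: Field_def)
  ultimately show ?thesis by blast
qed

lemma Comp_eq: "Comp \<mu> = (\<lambda>B. Restr \<mu> B) ` classes"
  by (simp add: Comp_def classes_quotient)

lemma Restr_class_inj: "inj_on (\<lambda>B. Restr \<mu> B) classes"
proof (rule inj_onI)
  fix B C assume BC: "B \<in> classes" "C \<in> classes" "Restr \<mu> B = Restr \<mu> C"
  have "B = Field (Restr \<mu> B)" by (rule Field_Restr_class[OF BC(1), symmetric])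
  also have "\<dots> = Field (Restr \<mu> C)" by (rule arg_cong[OF BC(3)])
  also have "\<dots> = C" by (rule Field_Restr_class[OF BC(2)])
  finally show "B = C" .
qed

lemma class_bound: "\<exists>k. \<forall>B\<in>classes. finite B \<and> card B \<le> k"
proof -
  obtain k where k: "\<forall>X\<in>Comp \<mu>. finite (Field X) \<and> card (Field X) \<le> k"
    using fcs by (auto simp: finite_component_size_def)
  have "finite B \<and> card B \<le> k" if B: "B \<in> classes" for B
  proof -
    have "Restr \<mu> B \<in> Comp \<mu>" unfolding Comp_eq by (rule imageI[OF B])
    from bspec[OF k this] show ?thesis unfolding Field_Restr_class[OF B] .
  qed
  then show ?thesis by blast
qed

lemma finite_class: "B \<in> classes \<Longrightarrow> finite B"
  using class_bound by blast

lemma Partial_order_class: "Partial_order (Restr \<mu> B)"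
  using po by (rule Partial_order_Restr)

lemma max_above:
  assumes "x \<in> Field \<mu>" obtains m where "(x, m) \<in> \<mu>" "m \<in> max_elems (Restr \<mu> (cls x))"
proof -
  let ?U = "{y \<in> cls x. (x, y) \<in> \<mu>}"
  have fin: "finite ?U" using finite_class[OF cls_classes[OF assms]] by simp
  have ne: "?U \<noteq> {}" using in_cls(1)[OF assms] refl_mu[OF assms] by auto
  have "\<exists>m\<in>S. \<forall>y\<in>S. (m, y) \<in> \<mu> \<longrightarrow> y = m" if "finite S" "S \<noteq> {}" "S \<subseteq> Field \<mu>" for S
    using that
  proof (induction S rule: finite_ne_induct)
    case (insert s S)
    then obtain m where m: "m \<in> S" "\<forall>y\<in>S. (m, y) \<in> \<mu> \<longrightarrow> y = m" by auto
    show ?case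
    proof (cases "(m, s) \<in> \<mu>")
      case True
      have "y = s" if "y \<in> S" "(s, y) \<in> \<mu>" for y
        using m(2) that trans_mu[OF True that(2)] True antisym_mu[of m s] that(2) by auto
      then show ?thesis by auto
    next
      case False
      then show ?thesis using m by auto
    qed
  qed auto
  moreover have "?U \<subseteq> Field \<mu>" using mu_Field by auto
  ultimately obtain m where m: "m \<in> ?U" "\<forall>y\<in>?U. (m, y) \<in> \<mu> \<longrightarrow> y = m" using fin ne by blast
  have "m \<in> max_elems (Restr \<mu> (cls x))"
    unfolding max_elems_def Field_Restr_class[OF cls_classes[OF assms]]
    using m trans_mu[of x m] by auto
  then show ?thesis using that m(1) by blast
qed

lemma min_below:
  assumes "x \<in> Field \<mu>" obtains m where "(m, x) \<in> \<mu>" "m \<in> min_elems (Restr \<mu> (cls x))"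
proof -
  let ?U = "{y \<in> cls x. (y, x) \<in> \<mu>}"
  have fin: "finite ?U" using finite_class[OF cls_classes[OF assms]] by simp
  have ne: "?U \<noteq> {}" using in_cls(1)[OF assms] refl_mu[OF assms] by auto
  have "\<exists>m\<in>S. \<forall>y\<in>S. (y, m) \<in> \<mu> \<longrightarrow> y = m" if "finite S" "S \<noteq> {}" "S \<subseteq> Field \<mu>" for S
    using that
  proof (induction S rule: finite_ne_induct)
    case (insert s S)
    then obtain m where m: "m \<in> S" "\<forall>y\<in>S. (y, m) \<in> \<mu> \<longrightarrow> y = m" by auto
    show ?case
    proof (cases "(s, m) \<in> \<mu>")
      case True
      have "y = s" if "y \<in> S" "(y, s) \<in> \<mu>" for y
        using m(2) that trans_mu[OF that(2) True] True antisym_mu[of m s] that(2) by auto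
      then show ?thesis by auto
    next
      case False
      then show ?thesis using m by auto
    qed
  qed auto
  moreover have "?U \<subseteq> Field \<mu>" using mu_Field by auto
  ultimately obtain m where m: "m \<in> ?U" "\<forall>y\<in>?U. (y, m) \<in> \<mu> \<longrightarrow> y = m" using fin ne by blast
  have "m \<in> min_elems (Restr \<mu> (cls x))"
    unfolding min_elems_def Field_Restr_class[OF cls_classes[OF assms]]
    using m trans_mu[of _ m x] by auto
  then show ?thesis using that m(1) by blast
qed

lemma qcl_two_steps:
  assumes "a \<in> Field \<mu>" "m \<in> Field \<mu>" "b \<in> Field \<mu>"
  shows "qcl \<mu> {(a, m), (m, b)} \<subseteq> \<mu> \<union> {(u, v). (u, a) \<in> \<mu> \<and> (m, v) \<in> \<mu>}
      \<union> {(u, v). (u, m) \<in> \<mu> \<and> (b, v) \<in> \<mu>} \<union> {(u, v). (u, a) \<in> \<mu> \<and> (b, v) \<in> \<mu>}" (is "_ \<subseteq> ?r")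
    "qcl \<mu> {(a, b)} \<subseteq> qcl \<mu> {(a, m), (m, b)}"
proof -
  have "trans ?r"
  proof (rule transI)
    fix u v w assume "(u, v) \<in> ?r" "(v, w) \<in> ?r"
    then show "(u, w) \<in> ?r"
      using trans_mu[of u v w] trans_mu[of u v a] trans_mu[of u v m] trans_mu[of m v w] trans_mu[of b v w]
        trans_mu[of u m w] trans_mu[of m v a] trans_mu[of b v a] trans_mu[of m v m] trans_mu[of b v m]
      by auto
  qed
  then show "qcl \<mu> {(a, m), (m, b)} \<subseteq> ?r"
    using refl_mu assms by (intro qcl_least) auto
  have "(a, m) \<in> qcl \<mu> {(a, m), (m, b)}" "(m, b) \<in> qcl \<mu> {(a, m), (m, b)}"
    using qcl_upper(2)[of "{(a, m), (m, b)}" \<mu>] by auto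
  then have "(a, b) \<in> qcl \<mu> {(a, m), (m, b)}" by (rule qcl_trans)
  then show "qcl \<mu> {(a, b)} \<subseteq> qcl \<mu> {(a, m), (m, b)}"
    by (intro qcl_least qcl_upper trans_qcl) auto
qed

lemma qcl_pair_generated:
  "qcl \<mu> {p} \<in> generated \<mu> Y \<Longrightarrow> qcl \<mu> {q} \<in> generated \<mu> Y \<Longrightarrow> qcl \<mu> {p, q} \<in> generated \<mu> Y"
  by (rule qcl_in_generated) auto

text \<open>
  The meet of two routes through different components retains only the direct connection.
\<close>

lemma two_routes:
  assumes "qcl \<mu> {(a, m)} \<in> generated \<mu> Y" "qcl \<mu> {(m, b)} \<in> generated \<mu> Y"
    and "qcl \<mu> {(a, m')} \<in> generated \<mu> Y" "qcl \<mu> {(m', b)} \<in> generated \<mu> Y"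
    and F: "a \<in> Field \<mu>" "b \<in> Field \<mu>" "m \<in> Field \<mu>" "m' \<in> Field \<mu>"
    and diff: "(m, m') \<notin> E" "(a, m) \<notin> E" "(a, m') \<notin> E" "(b, m) \<notin> E" "(b, m') \<notin> E"
  shows "qcl \<mu> {(a, b)} \<in> generated \<mu> Y"
proof -
  have 1: "(u, v) \<in> E" if "(u, v) \<in> \<mu> \<or> (v, u) \<in> \<mu>" for u v using that mu_E E_sym by blast
  have "qcl \<mu> {(a, m), (m, b)} \<inter> qcl \<mu> {(a, m'), (m', b)} \<subseteq> qcl \<mu> {(a, b)}"
  proof (rule subrelI)
    fix u v assume "(u, v) \<in> qcl \<mu> {(a, m), (m, b)} \<inter> qcl \<mu> {(a, m'), (m', b)}"
    then have A: "(u, v) \<in> \<mu> \<or> (u, a) \<in> \<mu> \<and> (m, v) \<in> \<mu> \<or> (u, m) \<in> \<mu> \<and> (b, v) \<in> \<mu> \<or> (u, a) \<in> \<mu> \<and> (b, v) \<in> \<mu>"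
      and B: "(u, v) \<in> \<mu> \<or> (u, a) \<in> \<mu> \<and> (m', v) \<in> \<mu> \<or> (u, m') \<in> \<mu> \<and> (b, v) \<in> \<mu> \<or> (u, a) \<in> \<mu> \<and> (b, v) \<in> \<mu>"
      using qcl_two_steps(1)[OF F(1) F(3) F(2)] qcl_two_steps(1)[OF F(1) F(4) F(2)] by auto
    have up: "(p, q) \<in> E" if "(p, w) \<in> \<mu>" "(q, w) \<in> \<mu>" for p q w
      using E_trans[of p w q] 1[of p w] 1[of w q] that by simp
    have down: "(p, q) \<in> E" if "(w, p) \<in> \<mu>" "(w, q) \<in> \<mu>" for p q w
      using E_trans[of p w q] 1[of p w] 1[of w q] that by simp
    have n: "\<not> ((m, v) \<in> \<mu> \<and> (m', v) \<in> \<mu>)" "\<not> ((u, m) \<in> \<mu> \<and> (u, m') \<in> \<mu>)"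
      "\<not> ((u, a) \<in> \<mu> \<and> (u, m) \<in> \<mu>)" "\<not> ((u, a) \<in> \<mu> \<and> (u, m') \<in> \<mu>)"
      "\<not> ((b, v) \<in> \<mu> \<and> (m, v) \<in> \<mu>)" "\<not> ((b, v) \<in> \<mu> \<and> (m', v) \<in> \<mu>)"
      using diff up[of m v m'] down[of u m m'] down[of u a m] down[of u a m'] up[of b v m] up[of b v m'] by blast+
    have "(u, v) \<in> \<mu> \<or> (u, a) \<in> \<mu> \<and> (b, v) \<in> \<mu>" using A B n by argo
    then show "(u, v) \<in> qcl \<mu> {(a, b)}" unfolding qcl_single[OF po F(1,2)] by auto
  qed
  then have "qcl \<mu> {(a, m), (m, b)} \<inter> qcl \<mu> {(a, m'), (m', b)} = qcl \<mu> {(a, b)}"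
    using qcl_two_steps(2)[OF F(1) F(3) F(2)] qcl_two_steps(2)[OF F(1) F(4) F(2)] by blast
  moreover have "qcl \<mu> {(a, m), (m, b)} \<inter> qcl \<mu> {(a, m'), (m', b)} \<in> generated \<mu> Y"
    using assms(1-4) by (intro generated_Int qcl_pair_generated)
  ultimately show ?thesis by simp
qed

text \<open>
  Going down, across at the bottom, or up, across at the top, gives two routes from \<open>a\<close> to the other component. The first one ends
  too low and the second one starts too high, and their meet is the pair itself.
\<close>

lemma cross_pair:
  assumes gen: "qcl \<mu> {(a, c)} \<in> generated \<mu> Y" "qcl \<mu> {(c, d)} \<in> generated \<mu> Y"
    "qcl \<mu> {(a', b')} \<in> generated \<mu> Y" "qcl \<mu> {(b', b)} \<in> generated \<mu> Y"
    and le: "(c, a) \<in> \<mu>" "(a, a') \<in> \<mu>" "(d, b) \<in> \<mu>" "(b, b') \<in> \<mu>" and diff: "(a, b) \<notin> E"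
  shows "qcl \<mu> {(a, b)} \<in> generated \<mu> Y"
proof -
  have F: "a \<in> Field \<mu>" "b \<in> Field \<mu>" "c \<in> Field \<mu>" "d \<in> Field \<mu>" "a' \<in> Field \<mu>" "b' \<in> Field \<mu>"
    using le mu_Field by blast+
  have 1: "(u, v) \<in> E" if "(u, v) \<in> \<mu> \<or> (v, u) \<in> \<mu>" for u v using that mu_E E_sym by blast
  have R1: "qcl \<mu> {(a, d)} \<subseteq> qcl \<mu> {(a, c), (c, d)}" by (rule qcl_two_steps(2)[OF F(1,3,4)])
  have R2: "qcl \<mu> {(a', b)} \<subseteq> qcl \<mu> {(a', b'), (b', b)}" by (rule qcl_two_steps(2)[OF F(5,6,2)])
  have "qcl \<mu> {(a, c), (c, d)} \<inter> qcl \<mu> {(a', b'), (b', b)} \<subseteq> qcl \<mu> {(a, b)}"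
  proof (rule subrelI)
    fix u v assume "(u, v) \<in> qcl \<mu> {(a, c), (c, d)} \<inter> qcl \<mu> {(a', b'), (b', b)}"
    then have A: "(u, v) \<in> \<mu> \<or> (u, a) \<in> \<mu> \<and> (c, v) \<in> \<mu> \<or> (u, c) \<in> \<mu> \<and> (d, v) \<in> \<mu> \<or> (u, a) \<in> \<mu> \<and> (d, v) \<in> \<mu>"
      and B: "(u, v) \<in> \<mu> \<or> (u, a') \<in> \<mu> \<and> (b', v) \<in> \<mu> \<or> (u, b') \<in> \<mu> \<and> (b, v) \<in> \<mu> \<or> (u, a') \<in> \<mu> \<and> (b, v) \<in> \<mu>"
      using qcl_two_steps(1)[OF F(1,3,4)] qcl_two_steps(1)[OF F(5,6,2)] by auto
    have ca: "(c, a) \<in> E" "(b, b') \<in> E" using 1 le by blast+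
    have n1: "\<not> ((c, v) \<in> \<mu> \<and> (b', v) \<in> \<mu>)"
    proof
      assume "(c, v) \<in> \<mu> \<and> (b', v) \<in> \<mu>"
      then have "(c, v) \<in> E" "(v, b') \<in> E" using 1 by blast+
      then show False using ca diff E_trans[of a c v] E_trans[of a v b'] E_trans[of a v b] E_trans[of a u b'] E_trans[of a b' b]
          E_sym[of c a] E_sym[of b b'] by blast
    qed
    have n2: "\<not> ((c, v) \<in> \<mu> \<and> (b, v) \<in> \<mu>)"
    proof
      assume "(c, v) \<in> \<mu> \<and> (b, v) \<in> \<mu>"
      then have "(c, v) \<in> E" "(v, b) \<in> E" using 1 by blast+
      then show False using ca diff E_trans[of a c v] E_trans[of a v b'] E_trans[of a v b] E_trans[of a u b'] E_trans[of a b' b]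
          E_sym[of c a] E_sym[of b b'] by blast
    qed
    have n3: "\<not> ((u, a) \<in> \<mu> \<and> (u, b') \<in> \<mu>)"
    proof
      assume "(u, a) \<in> \<mu> \<and> (u, b') \<in> \<mu>"
      then have "(a, u) \<in> E" "(u, b') \<in> E" using 1 by blast+
      then show False using ca diff E_trans[of a c v] E_trans[of a v b'] E_trans[of a v b] E_trans[of a u b'] E_trans[of a b' b]
          E_sym[of c a] E_sym[of b b'] by blast
    qed
    have n4: "(u, c) \<in> \<mu> \<Longrightarrow> (u, a) \<in> \<mu>" "(b', v) \<in> \<mu> \<Longrightarrow> (b, v) \<in> \<mu>" using trans_mu le by blast+
    have "(u, v) \<in> \<mu> \<or> (u, a) \<in> \<mu> \<and> (b, v) \<in> \<mu>" using A B n1 n2 n3 n4 by argo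
    then show "(u, v) \<in> qcl \<mu> {(a, b)}" unfolding qcl_single[OF po F(1,2)] by auto
  qed
  moreover have "qcl \<mu> {(a, b)} \<subseteq> qcl \<mu> {(a, d)} \<inter> qcl \<mu> {(a', b)}"
    unfolding qcl_single[OF po F(1,2)] qcl_single[OF po F(1,4)] qcl_single[OF po F(5,2)]
    using trans_mu le by auto
  ultimately have "qcl \<mu> {(a, c), (c, d)} \<inter> qcl \<mu> {(a', b'), (b', b)} = qcl \<mu> {(a, b)}"
    using R1 R2 by blast
  moreover have "qcl \<mu> {(a, c), (c, d)} \<inter> qcl \<mu> {(a', b'), (b', b)} \<in> generated \<mu> Y"
    using gen by (intro generated_Int qcl_pair_generated)
  ultimately show ?thesis by simp
qed

text \<open>
  A reversed comparability is the join of the reversed coverings along a maximal chain.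
\<close>

lemma below_generated:
  assumes "(c, a) \<in> \<mu>" and edges: "\<And>x y. (x, y) \<in> Edge \<mu> \<Longrightarrow> (a, x) \<in> E \<Longrightarrow> qcl \<mu> {(y, x)} \<in> generated \<mu> Y"
  shows "qcl \<mu> {(a, c)} \<in> generated \<mu> Y"
proof -
  have "(c, a) \<in> (Edge \<mu>)\<^sup>*" by (rule mu_Edge_path[OF assms(1)])
  then have "(a, c) \<in> E \<longrightarrow> qcl \<mu> {(a, c)} \<in> generated \<mu> Y"
  proof (induction rule: converse_rtrancl_induct)
    case base
    have aF: "a \<in> Field \<mu>" using assms(1) mu_Field by blast
    have "qcl \<mu> {(a, a)} = qcl \<mu> (\<Union>{})"
      using refl_mu[OF aF] by (simp add: qcl_def insert_absorb)
    then show ?case using generated.join[of "{}"] by auto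
  next
    case (step c b)
    show ?case
    proof
      assume acE: "(a, c) \<in> E"
      have cb: "(c, b) \<in> \<mu>" "(c, b) \<in> E" using step(1) Edge_mu Edge_E by auto
      have ba: "(b, a) \<in> \<mu>"
        using step(2)
      proof (induction rule: rtrancl_induct)
        case base then show ?case using refl_mu mu_Field(2)[OF cb(1)] by blast
      next
        case (step y z) then show ?case using trans_mu Edge_mu(1) by blast
      qed
      have "(a, b) \<in> E" using acE cb(2) E_trans by blast
      then have 1: "qcl \<mu> {(a, b)} \<in> generated \<mu> Y" using step(3) by blast
      have 2: "qcl \<mu> {(b, c)} \<in> generated \<mu> Y" by (rule edges[OF step(1) acE])
      have F: "a \<in> Field \<mu>" "b \<in> Field \<mu>" "c \<in> Field \<mu>" using cb ba mu_Field by blast+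
      have "(a, b) \<in> qcl \<mu> {(a, c)}" "(b, c) \<in> qcl \<mu> {(a, c)}"
        unfolding qcl_single[OF po F(1,3)] using refl_mu F cb ba by auto
      then have "qcl \<mu> {(a, b), (b, c)} \<subseteq> qcl \<mu> {(a, c)}"
        by (intro qcl_least qcl_upper trans_qcl) auto
      then have "qcl \<mu> {(a, c)} = qcl \<mu> {(a, b), (b, c)}"
        using qcl_two_steps(2)[OF F] by blast
      then show "qcl \<mu> {(a, c)} \<in> generated \<mu> Y" using qcl_pair_generated[OF 1 2] by simp
    qed
  qed
  then show ?thesis using mu_E[OF assms(1)] E_sym by blast
qed

text \<open>
  Pairs inside components cannot interact across components.
\<close>

lemma qcl_within_class:
  assumes R: "R \<subseteq> E" and "B \<in> classes"
  shows "qcl \<mu> R \<inter> B \<times> B \<subseteq> qcl \<mu> (R \<inter> B \<times> B)"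
proof -
  let ?S = "{(u, v). (u, v) \<in> E \<and> (u \<in> B \<longrightarrow> (u, v) \<in> qcl \<mu> (R \<inter> B \<times> B))}"
  have "qcl \<mu> R \<subseteq> ?S"
  proof (rule qcl_least)
    show "\<mu> \<subseteq> ?S" using mu_E qcl_upper(1)[of \<mu>] by auto
    show "R \<subseteq> ?S"
    proof (rule subrelI)
      fix u v assume uv: "(u, v) \<in> R"
      then have "(u, v) \<in> E" using R by auto
      moreover have "(u, v) \<in> qcl \<mu> (R \<inter> B \<times> B)" if "u \<in> B"
        using uv that class_closed[OF assms(2) that \<open>(u, v) \<in> E\<close>] qcl_upper(2)[of "R \<inter> B \<times> B" \<mu>] by auto
      ultimately show "(u, v) \<in> ?S" by simp
    qed
    show "trans ?S"
    proof (rule transI)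
      fix u v w assume uv: "(u, v) \<in> ?S" and vw: "(v, w) \<in> ?S"
      then have "(u, w) \<in> E" using E_trans[of u v w] by simp
      moreover have "(u, w) \<in> qcl \<mu> (R \<inter> B \<times> B)" if "u \<in> B"
        using uv vw that class_closed[OF assms(2) that, of v] qcl_trans[of u v \<mu> "R \<inter> B \<times> B" w] by simp
      ultimately show "(u, w) \<in> ?S" by simp
    qed
  qed
  then show ?thesis by auto
qed

end


context finite_component_poset
begin

subsection \<open>Lifting quasiorders of transversals\<close>

text \<open>
  One point in every component. On a transversal, the order \<open>\<mu>\<close> is trivial, and the lattice of all its quasiorders is known to be
  generated by few elements.
\<close>

definition transversal :: "'a set \<Rightarrow> bool" where
  "transversal T \<longleftrightarrow> T \<subseteq> Field \<mu> \<and> (\<forall>s\<in>T. \<forall>t\<in>T. (s, t) \<in> E \<longrightarrow> s = t) \<and> cls ` T = classes"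

text \<open>
  Between two points of a transversal no use can be made of \<open>\<mu>\<close>, so that one detour suffices.
\<close>

lemma qcl_transversal:
  assumes T: "transversal T" and \<rho>: "\<rho> \<in> Quo_e (Id_on T)"
  shows "qcl \<mu> \<rho> = \<mu> \<union> {(x, y). \<exists>(s, t)\<in>\<rho>. (x, s) \<in> \<mu> \<and> (t, y) \<in> \<mu>}" (is "_ = ?r")
proof
  have \<rho>T: "s \<in> T" "t \<in> T" if "(s, t) \<in> \<rho>" for s t using Quo_eD(1)[OF \<rho>] that by auto
  have TF: "s \<in> Field \<mu>" if "s \<in> T" for s using T that by (auto simp: transversal_def)
  have one: "s = t" if "s \<in> T" "t \<in> T" "(s, t) \<in> \<mu>" for s t
    using T that mu_E[OF that(3)] by (auto simp: transversal_def)
  show "qcl \<mu> \<rho> \<subseteq> ?r"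
  proof (rule qcl_least)
    show "\<rho> \<subseteq> ?r"
    proof (rule subrelI)
      fix s t assume st: "(s, t) \<in> \<rho>"
      then show "(s, t) \<in> ?r" using refl_mu[OF TF[OF \<rho>T(1)[OF st]]] refl_mu[OF TF[OF \<rho>T(2)[OF st]]] by auto
    qed
    show "trans ?r"
    proof (rule transI)
      fix u v w assume uv: "(u, v) \<in> ?r" and vw: "(v, w) \<in> ?r"
      show "(u, w) \<in> ?r"
      proof (cases "(u, v) \<in> \<mu>")
        case True
        then show ?thesis using vw trans_mu[OF True] by auto
      next
        case False
        then obtain s t where st: "(s, t) \<in> \<rho>" "(u, s) \<in> \<mu>" "(t, v) \<in> \<mu>" using uv by auto
        show ?thesis
        proof (cases "(v, w) \<in> \<mu>")
          case True
          then show ?thesis using st trans_mu[OF st(3) True] by auto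
        next
          case False
          then obtain s' t' where st': "(s', t') \<in> \<rho>" "(v, s') \<in> \<mu>" "(t', w) \<in> \<mu>" using vw by auto
          have "t = s'" using one[OF \<rho>T(2)[OF st(1)] \<rho>T(1)[OF st'(1)] trans_mu[OF st(3) st'(2)]] .
          then have "(s, t') \<in> \<rho>" using transD[OF Quo_eD(3)[OF \<rho>]] st(1) st'(1) by blast
          then show ?thesis using st(2) st'(3) by auto
        qed
      qed
    qed
  qed auto
  show "?r \<subseteq> qcl \<mu> \<rho>"
  proof (rule subrelI)
    fix x y assume "(x, y) \<in> ?r"
    then consider "(x, y) \<in> \<mu>" | s t where "(s, t) \<in> \<rho>" "(x, s) \<in> \<mu>" "(t, y) \<in> \<mu>" by auto
    then show "(x, y) \<in> qcl \<mu> \<rho>"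
    proof cases
      case 1 then show ?thesis using qcl_upper(1) by blast
    next
      case 2
      then have "(x, s) \<in> qcl \<mu> \<rho>" "(s, t) \<in> qcl \<mu> \<rho>" "(t, y) \<in> qcl \<mu> \<rho>"
        using qcl_upper(1)[of \<mu> \<rho>] qcl_upper(2)[of \<rho> \<mu>] by auto
      then show ?thesis using qcl_trans[of x s \<mu> \<rho> t] qcl_trans[of x t \<mu> \<rho> y] by simp
    qed
  qed
qed

text \<open>
  By \<open>qcl_transversal\<close>, lifting from the transversal preserves joins and meets; so the generators on the transversal generate
  what they generated there.
\<close>

lemma transversal_generated:
  assumes T: "transversal T" and Z: "complete_generating_set (Quo_e (Id_on T)) Z" and st: "s \<in> T" "t \<in> T"
  shows "qcl \<mu> {(s, t)} \<in> generated \<mu> (qcl \<mu> ` Z)"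
proof -
  have IdT: "Id_on T \<subseteq> \<mu>" using T refl_mu by (auto simp: transversal_def)
  have absorb: "qcl \<mu> (qcl (Id_on T) R) = qcl \<mu> R" for R
  proof
    have "qcl (Id_on T) R \<subseteq> qcl \<mu> R"
      using IdT qcl_upper(1)[of \<mu> R] qcl_upper(2)[of R \<mu>] by (intro qcl_least trans_qcl) auto
    then show "qcl \<mu> (qcl (Id_on T) R) \<subseteq> qcl \<mu> R" by (rule qcl_least[OF qcl_upper(1) _ trans_qcl])
    show "qcl \<mu> R \<subseteq> qcl \<mu> (qcl (Id_on T) R)" by (intro qcl_mono qcl_upper(2))
  qed
  have Zgen: "Z \<subseteq> Quo_e (Id_on T)" "Quo_e (Id_on T) \<subseteq> generated (Id_on T) Z"
    using Z complete_generating_set_iff_generated[OF Partial_order_Id_on'] by auto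
  have "qcl (Id_on T) {(s, t)} \<in> generated (Id_on T) Z"
    using Zgen(2) qcl_in_Quo_e[OF Partial_order_Id_on', of "{(s, t)}" T] st by auto
  then have "qcl \<mu> (qcl (Id_on T) {(s, t)}) \<in> generated \<mu> (qcl \<mu> ` Z)"
  proof (rule generated_transport[OF Partial_order_Id_on' Zgen(1)])
    show "qcl \<mu> \<rho> \<in> generated \<mu> (qcl \<mu> ` Z)" if "\<rho> \<in> Z" for \<rho>
      using that by (auto intro: generated.base)
    show "qcl \<mu> (qcl (Id_on T) (\<Union>X)) = qcl \<mu> (\<Union>(qcl \<mu> ` X))" for X
      unfolding absorb using qcl_UN_absorb[of \<mu> "\<lambda>\<rho>. \<rho>" X] by simp
    show "qcl \<mu> (\<Inter>X) = \<Inter>(qcl \<mu> ` X)" if X: "X \<subseteq> Quo_e (Id_on T)" "X \<noteq> {}" for X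
    proof
      show "qcl \<mu> (\<Inter>X) \<subseteq> \<Inter>(qcl \<mu> ` X)" by (intro INF_greatest qcl_mono Inter_lower)
      show "\<Inter>(qcl \<mu> ` X) \<subseteq> qcl \<mu> (\<Inter>X)"
      proof (rule subrelI)
        fix x y assume xy: "(x, y) \<in> \<Inter>(qcl \<mu> ` X)"
        show "(x, y) \<in> qcl \<mu> (\<Inter>X)"
        proof (cases "(x, y) \<in> \<mu>")
          case True then show ?thesis using qcl_upper(1) by blast
        next
          case False
          have ex: "\<exists>s t. (s, t) \<in> \<rho> \<and> (x, s) \<in> \<mu> \<and> (t, y) \<in> \<mu>" if "\<rho> \<in> X" for \<rho>
          proof -
            have "(x, y) \<in> qcl \<mu> \<rho>" using xy that by blast
            moreover have "\<rho> \<in> Quo_e (Id_on T)" using X(1) that by blast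
            ultimately show ?thesis using False unfolding qcl_transversal[OF T \<open>\<rho> \<in> Quo_e (Id_on T)\<close>] by auto
          qed
          obtain \<rho>0 where "\<rho>0 \<in> X" using X(2) by blast
          then obtain s t where st: "(s, t) \<in> \<rho>0" "(x, s) \<in> \<mu>" "(t, y) \<in> \<mu>" using ex by blast
          have inT: "a \<in> T \<and> b \<in> T" if "(a, b) \<in> \<rho>" "\<rho> \<in> X" for a b \<rho>
            using Quo_eD(1)[of \<rho> "Id_on T"] X(1) that by auto
          have "(s, t) \<in> \<rho>" if \<rho>: "\<rho> \<in> X" for \<rho>
          proof -
            obtain s' t' where st': "(s', t') \<in> \<rho>" "(x, s') \<in> \<mu>" "(t', y) \<in> \<mu>" using ex[OF \<rho>] by blast
            have "(s, s') \<in> E" using E_trans[OF E_sym[OF mu_E[OF st(2)]] mu_E[OF st'(2)]] .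
            moreover have "(t, t') \<in> E" using E_trans[OF mu_E[OF st(3)] E_sym[OF mu_E[OF st'(3)]]] .
            ultimately have "s = s'" "t = t'"
              using T inT[OF st(1) \<open>\<rho>0 \<in> X\<close>] inT[OF st'(1) \<rho>] by (auto simp: transversal_def)
            then show ?thesis using st'(1) by simp
          qed
          then have "(s, t) \<in> \<Inter>X" by blast
          then have "(s, t) \<in> qcl \<mu> (\<Inter>X)" using qcl_upper(2) by blast
          moreover have "(x, s) \<in> qcl \<mu> (\<Inter>X)" "(t, y) \<in> qcl \<mu> (\<Inter>X)"
            using st qcl_upper(1)[of \<mu> "\<Inter>X"] by auto
          ultimately show ?thesis
            using qcl_trans[of x s \<mu> "\<Inter>X" t] qcl_trans[of x t \<mu> "\<Inter>X" y] by simp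
        qed
      qed
    qed
  qed
  then show ?thesis unfolding absorb .
qed

lemma transversal_card: "transversal T \<Longrightarrow> |T| =o cmp \<mu>"
proof -
  assume T: "transversal T"
  have "inj_on cls T"
    using T cls_eq_iff by (auto simp: transversal_def inj_on_def subset_iff)
  then have "bij_betw cls T classes" using T by (simp add: bij_betw_def transversal_def)
  then have "|T| =o |classes|" using card_of_ordIso by blast
  moreover have "bij_betw (\<lambda>B. Restr \<mu> B) classes (Comp \<mu>)"
    using Restr_class_inj by (simp add: bij_betw_def Comp_eq)
  then have "|classes| =o |Comp \<mu>|" using card_of_ordIso by blast
  ultimately show ?thesis unfolding cmp_def by (rule ordIso_transitive)
qed

text \<open>
  With \<open>K\<close> positions available in each component, \<open>K\<close> times the number of pairs of chosen points in \<open>B1\<close> and \<open>B2\<close> transversals contain every pair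
  that has a member in \<open>B1\<close> or \<open>B2\<close>: a position selects a point in each of the other components simultaneously.
\<close>

lemma threads:
  assumes B: "B1 \<in> classes" "B2 \<in> classes" "B1 \<noteq> B2"
    and V: "\<And>B. B \<in> classes \<Longrightarrow> V B \<subseteq> B \<and> V B \<noteq> {}"
    and K: "0 < K" "\<And>B. B \<in> classes - {B1, B2} \<Longrightarrow> card (V B) \<le> K"
  shows "\<exists>\<Theta>. finite \<Theta> \<and> card \<Theta> \<le> K * (card (V B1) * card (V B2)) \<and> (\<forall>T\<in>\<Theta>. transversal T) \<and>
    (\<forall>B\<in>classes. \<forall>C\<in>{B1, B2}. B \<noteq> C \<longrightarrow> (\<forall>a\<in>V B. \<forall>m\<in>V C. \<exists>T\<in>\<Theta>. a \<in> T \<and> m \<in> T))"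
proof -
  let ?C = "classes - {B1, B2}"
  have fV: "finite (V B)" if "B \<in> classes" for B using V[OF that] finite_class[OF that] finite_subset by blast
  have "\<exists>e :: nat \<Rightarrow> 'a. e ` {..<K} = V B" if B: "B \<in> ?C" for B
  proof -
    obtain g where g: "bij_betw g {0..<card (V B)} (V B)" using ex_bij_betw_nat_finite fV B by blast
    obtain v where v: "v \<in> V B" using V[of B] B by blast
    let ?e = "\<lambda>i. if i < card (V B) then g i else v"
    have "?e ` {..<K} \<subseteq> V B" using g v by (auto simp: bij_betw_def)
    moreover have "x \<in> ?e ` {..<K}" if xV: "x \<in> V B" for x
    proof -
      have "x \<in> g ` {0..<card (V B)}" using g xV by (simp add: bij_betw_def)
      then obtain i where "i < card (V B)" "x = g i" by auto
      then show ?thesis using K(2)[OF B] by (intro image_eqI[of _ _ i]) auto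
    qed
    ultimately show ?thesis by blast
  qed
  then obtain e :: "'a set \<Rightarrow> nat \<Rightarrow> 'a" where e: "\<And>B. B \<in> ?C \<Longrightarrow> e B ` {..<K} = V B" by metis
  define thread where "thread r b c = insert b (insert c ((\<lambda>B. e B r) ` ?C))" for r b c
  define \<Theta> where "\<Theta> = (\<lambda>(r, b, c). thread r b c) ` ({..<K} \<times> V B1 \<times> V B2)"
  have fin: "finite ({..<K} \<times> V B1 \<times> V B2)" using fV B by simp
  have "card \<Theta> \<le> card ({..<K} \<times> V B1 \<times> V B2)" unfolding \<Theta>_def by (rule card_image_le[OF fin])
  then have card: "card \<Theta> \<le> K * (card (V B1) * card (V B2))" by (simp add: card_cartesian_product)
  have trans: "transversal (thread r b c)" if "r < K" "b \<in> V B1" "c \<in> V B2" for r b c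
  proof -
    have eB: "e B r \<in> B" if "B \<in> ?C" for B using e[OF that] V[of B] that \<open>r < K\<close> by blast
    have bc: "b \<in> B1" "c \<in> B2" using V B that by blast+
    have cl: "cls b = B1" "cls c = B2" "\<And>B. B \<in> ?C \<Longrightarrow> cls (e B r) = B"
      using class_of B bc eB by blast+
    have sub: "thread r b c \<subseteq> Field \<mu>"
      unfolding thread_def using class_sub bc B eB by blast
    have img: "cls ` thread r b c = classes"
    proof -
      have "(\<lambda>B. cls (e B r)) ` ?C = (\<lambda>B. B) ` ?C" by (rule image_cong[OF refl cl(3)])
      then show ?thesis unfolding thread_def using cl(1,2) B by (auto simp: image_image)
    qed
    define pick where "pick D = (if D = B1 then b else if D = B2 then c else e D r)" for D
    have pick: "s = pick (cls s)" if s: "s \<in> thread r b c" for s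
    proof -
      consider "s = b" | "s = c" | D where "D \<in> ?C" "s = e D r" using s unfolding thread_def by blast
      then show ?thesis
      proof cases
        case 1 then show ?thesis by (simp add: pick_def cl(1))
      next
        case 2 then show ?thesis using B(3) by (simp add: pick_def cl(2))
      next
        case (3 D)
        have "cls s = D" unfolding 3(2) by (rule cl(3)[OF 3(1)])
        then show ?thesis using 3 by (simp add: pick_def)
      qed
    qed
    have one: "s = t" if s: "s \<in> thread r b c" "t \<in> thread r b c" "(s, t) \<in> E" for s t
    proof -
      have "s = pick (cls s)" by (rule pick[OF s(1)])
      also have "\<dots> = pick (cls t)" by (simp only: cls_eq[OF s(3)])
      also have "\<dots> = t" by (rule pick[OF s(2), symmetric])
      finally show ?thesis .
    qed
    show ?thesis unfolding transversal_def
    proof (intro conjI ballI impI)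
      fix s t assume "s \<in> thread r b c" "t \<in> thread r b c" "(s, t) \<in> E" then show "s = t" by (rule one)
    qed (rule sub img)+
  qed
  have hit: "\<exists>T\<in>\<Theta>. a \<in> T \<and> m \<in> T"
    if C: "D \<in> classes" "C \<in> {B1, B2}" "D \<noteq> C" "a \<in> V D" "m \<in> V C" for D C a m
  proof -
    obtain v1 v2 where v: "v1 \<in> V B1" "v2 \<in> V B2" using V B by blast
    have "\<exists>r<K. D \<in> ?C \<longrightarrow> e D r = a"
    proof (cases "D \<in> ?C")
      case True
      then have "a \<in> e D ` {..<K}" using e[OF True] C(4) by simp
      then show ?thesis by blast
    next
      case False
      then show ?thesis using K(1) by blast
    qed
    then obtain r where r: "r < K" "D \<in> ?C \<Longrightarrow> e D r = a" by blast
    define b where "b = (if D = B1 then a else if C = B1 then m else v1)"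
    define c where "c = (if D = B2 then a else if C = B2 then m else v2)"
    have "b \<in> V B1" "c \<in> V B2" using v C B(3) by (auto simp: b_def c_def)
    then have "thread r b c \<in> \<Theta>" using r(1) by (auto simp: \<Theta>_def)
    moreover have "a \<in> thread r b c"
      using r(2) C(1) by (cases "D \<in> ?C") (auto simp: thread_def b_def c_def)
    moreover have "m \<in> thread r b c"
      using C(2,3) B(3) by (auto simp: thread_def b_def c_def)
    ultimately show ?thesis by blast
  qed
  have "\<forall>T\<in>\<Theta>. transversal T" using trans by (auto simp: \<Theta>_def)
  moreover have "finite \<Theta>" using fin by (simp add: \<Theta>_def)
  ultimately show ?thesis using card hit by (intro exI[of _ \<Theta>]) simp
qed

lemma threads_generate:
  assumes acc: "accessible |Field \<mu>|" and B: "B1 \<in> classes" "B2 \<in> classes" "B1 \<noteq> B2"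
    and V: "\<And>B. B \<in> classes \<Longrightarrow> V B \<subseteq> B \<and> V B \<noteq> {}"
    and K: "0 < K" "\<And>B. B \<in> classes - {B1, B2} \<Longrightarrow> card (V B) \<le> K"
  shows "\<exists>Z. finite Z \<and> Z \<subseteq> Quo_e \<mu> \<and> card Z \<le> f4 (cmp \<mu>) * (K * (card (V B1) * card (V B2))) \<and>
    (\<forall>B\<in>classes. \<forall>C\<in>{B1, B2}. B \<noteq> C \<longrightarrow> (\<forall>a\<in>V B. \<forall>m\<in>V C.
       qcl \<mu> {(a, m)} \<in> generated \<mu> Z \<and> qcl \<mu> {(m, a)} \<in> generated \<mu> Z))"
proof -
  have "\<exists>\<Theta>. finite \<Theta> \<and> card \<Theta> \<le> K * (card (V B1) * card (V B2)) \<and> (\<forall>T\<in>\<Theta>. transversal T) \<and>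
    (\<forall>B\<in>classes. \<forall>C\<in>{B1, B2}. B \<noteq> C \<longrightarrow> (\<forall>a\<in>V B. \<forall>m\<in>V C. \<exists>T\<in>\<Theta>. a \<in> T \<and> m \<in> T))"
    by (rule threads[OF B V K])
  then obtain \<Theta> where \<Theta>: "finite \<Theta>" "card \<Theta> \<le> K * (card (V B1) * card (V B2))"
    "\<forall>T\<in>\<Theta>. transversal T"
    "\<forall>B\<in>classes. \<forall>C\<in>{B1, B2}. B \<noteq> C \<longrightarrow> (\<forall>a\<in>V B. \<forall>m\<in>V C. \<exists>T\<in>\<Theta>. a \<in> T \<and> m \<in> T)"
    by (elim exE conjE)
  have "\<exists>Z. complete_generating_set (Quo_e (Id_on T)) Z \<and> finite Z \<and> card Z \<le> f4 (cmp \<mu>)" if "T \<in> \<Theta>" for T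
  proof -
    have T: "transversal T" using \<Theta>(3) that by blast
    then have sub: "T \<subseteq> Field \<mu>" and img: "cls ` T = classes" by (simp_all add: transversal_def)
    obtain s t where st: "s \<in> T" "t \<in> T" "cls s = B1" "cls t = B2" using img B by (metis imageE)
    have "|T| \<le>o |Field \<mu>|" by (rule card_of_mono1[OF sub])
    then have "accessible |T|"
      using acc unfolding accessible_def by (meson card_of_Card_order ordLeq_transitive)
    from f4_generated[OF this st(1,2)] st(3,4) B(3) show ?thesis
      unfolding generated_by_at_most_def f4_cong[OF transversal_card[OF T]] by blast
  qed
  then obtain Z where Z: "\<And>T. T \<in> \<Theta> \<Longrightarrow> complete_generating_set (Quo_e (Id_on T)) (Z T)"
    "\<And>T. T \<in> \<Theta> \<Longrightarrow> finite (Z T)" "\<And>T. T \<in> \<Theta> \<Longrightarrow> card (Z T) \<le> f4 (cmp \<mu>)" by metis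
  let ?Z = "\<Union>T\<in>\<Theta>. qcl \<mu> ` Z T"
  have "card ?Z \<le> (\<Sum>T\<in>\<Theta>. card (qcl \<mu> ` Z T))" by (rule card_UN_le[OF \<Theta>(1)])
  also have "\<dots> \<le> (\<Sum>T\<in>\<Theta>. f4 (cmp \<mu>))"
    by (intro sum_mono order_trans[OF card_image_le[OF Z(2)] Z(3)])
  also have "\<dots> = f4 (cmp \<mu>) * card \<Theta>" by simp
  also have "\<dots> \<le> f4 (cmp \<mu>) * (K * (card (V B1) * card (V B2)))" by (rule mult_le_mono2[OF \<Theta>(2)])
  finally have card: "card ?Z \<le> f4 (cmp \<mu>) * (K * (card (V B1) * card (V B2)))" .
  have sub: "?Z \<subseteq> Quo_e \<mu>"
  proof (rule UN_least, rule image_subsetI)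
    fix T \<rho> assume T: "T \<in> \<Theta>" "\<rho> \<in> Z T"
    have "\<rho> \<in> Quo_e (Id_on T)" using Z(1)[OF T(1)] T(2) by (auto simp: complete_generating_set_def)
    then have "\<rho> \<subseteq> T \<times> T" using Quo_eD(1)[of \<rho> "Id_on T"] by simp
    moreover have "T \<subseteq> Field \<mu>" using \<Theta>(3) T(1) by (auto simp: transversal_def)
    ultimately show "qcl \<mu> \<rho> \<in> Quo_e \<mu>" by (intro qcl_in_Quo_e[OF po]) auto
  qed
  have gen: "qcl \<mu> {(s, t)} \<in> generated \<mu> ?Z" if "T \<in> \<Theta>" "s \<in> T" "t \<in> T" for T s t
  proof -
    have "qcl \<mu> ` Z T \<subseteq> ?Z" using that(1) by blast
    from generated_mono[OF this] show ?thesis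
      using transversal_generated[OF bspec[OF \<Theta>(3) that(1)] Z(1)[OF that(1)] that(2,3)] by (rule subsetD)
  qed
  have "qcl \<mu> {(a, m)} \<in> generated \<mu> ?Z \<and> qcl \<mu> {(m, a)} \<in> generated \<mu> ?Z"
    if C: "B \<in> classes" "C \<in> {B1, B2}" "B \<noteq> C" "a \<in> V B" "m \<in> V C" for B C a m
  proof -
    have "\<exists>T\<in>\<Theta>. a \<in> T \<and> m \<in> T"
      using bspec[OF bspec[OF mp[OF bspec[OF bspec[OF \<Theta>(4) C(1)] C(2)] C(3)] C(4)] C(5)] .
    then obtain T where T: "T \<in> \<Theta>" "a \<in> T" "m \<in> T" by (elim bexE conjE)
    show ?thesis by (intro conjI gen[OF T(1)] T)
  qed
  moreover have "finite ?Z" using \<Theta>(1) Z(2) by simp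
  ultimately show ?thesis using card sub by (intro exI[of _ ?Z]) simp
qed

subsection \<open>Collapsing a component\<close>

lemma qcl_class: "B \<in> classes \<Longrightarrow> qcl \<mu> (B \<times> B) = \<mu> \<union> B \<times> B"
proof -
  assume B: "B \<in> classes"
  have "trans (\<mu> \<union> B \<times> B)"
  proof (rule transI)
    fix x y z assume "(x, y) \<in> \<mu> \<union> B \<times> B" "(y, z) \<in> \<mu> \<union> B \<times> B"
    then show "(x, z) \<in> \<mu> \<union> B \<times> B"
      using class_mu[OF B, of x y] class_mu[OF B, of y z] trans_mu[of x y z] by auto
  qed
  then show ?thesis using qcl_upper[of \<mu> "B \<times> B"] qcl_upper(2)[of "B \<times> B" \<mu>]
    by (intro antisym qcl_least) auto
qed

text \<open>
  The extra generators counted by \<open>spp\<close> generate all quasiorders of the component once the reversed coverings are present, and the quasiorder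
  that collapses the component is charged to the difference of one in the definition of \<open>spp\<close>.
\<close>

lemma spp_generators:
  assumes B: "B \<in> classes"
  shows "\<exists>Z. finite Z \<and> Z \<subseteq> Quo_e \<mu> \<and> card Z \<le> spp (Restr \<mu> B) \<and>
    (\<forall>Y. Z \<subseteq> Y \<longrightarrow> qcl \<mu> (B \<times> B) \<in> generated \<mu> Y \<and>
      ((\<forall>(x, y)\<in>Edge \<mu>. x \<in> B \<longrightarrow> qcl \<mu> {(y, x)} \<in> generated \<mu> Y) \<longrightarrow>
        (\<forall>a\<in>B. \<forall>b\<in>B. qcl \<mu> {(a, b)} \<in> generated \<mu> Y)))"
proof -
  let ?M = "Restr \<mu> B"
  have FM: "Field ?M = B" by (rule Field_Restr_class[OF B])
  have BF: "B \<subseteq> Field \<mu>" by (rule class_sub[OF B])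
  have bot: "qcl \<mu> {(a, a)} \<in> generated \<mu> Y" if "a \<in> Field \<mu>" for a Y
  proof -
    have "qcl \<mu> {(a, a)} = qcl \<mu> (\<Union>{})" using refl_mu[OF that] by (simp add: qcl_def insert_absorb)
    then show ?thesis using generated.join[of "{}"] by auto
  qed
  have nab: "qcl \<mu> (B \<times> B) \<in> Quo_e \<mu>" using BF by (intro qcl_in_Quo_e[OF po]) auto
  consider "card B = 1" | "card B \<noteq> 1" "Linear_order ?M" | "card B \<noteq> 1" "\<not> Linear_order ?M" by blast
  then show ?thesis
  proof cases
    case 1
    then obtain x where x: "B = {x}" by (auto simp: card_Suc_eq numeral_eq_Suc One_nat_def)
    have "x \<in> Field \<mu>" using BF x by simp
    then show ?thesis using bot x by (intro exI[of _ "{}"]) auto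
  next
    case 2
    have "spp ?M = 1" using 2 by (simp add: spp_def FM)
    moreover have "qcl \<mu> {(a, b)} \<in> generated \<mu> Y"
      if ed: "\<forall>(x, y)\<in>Edge \<mu>. x \<in> B \<longrightarrow> qcl \<mu> {(y, x)} \<in> generated \<mu> Y" and ab: "a \<in> B" "b \<in> B" for Y a b
    proof (cases "(a, b) \<in> \<mu>")
      case True
      have "qcl \<mu> {(a, b)} = qcl \<mu> (\<Union>{})" using True by (simp add: qcl_def insert_absorb)
      then show ?thesis using generated.join[of "{}"] by auto
    next
      case False
      then have "a \<noteq> b" using refl_mu BF ab by blast
      then have "(b, a) \<in> \<mu>"
        using 2(2) ab False unfolding linear_order_on_def total_on_def FM by blast
      then show ?thesis
      proof (rule below_generated)
        fix x y assume "(x, y) \<in> Edge \<mu>" "(a, x) \<in> E"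
        then show "qcl \<mu> {(y, x)} \<in> generated \<mu> Y" using ed class_closed[OF B ab(1)] by blast
      qed
    qed
    moreover have "qcl \<mu> (B \<times> B) \<in> generated \<mu> Y" if "{qcl \<mu> (B \<times> B)} \<subseteq> Y" for Y
      using that by (auto intro: generated.base)
    ultimately show ?thesis using nab by (intro exI[of _ "{qcl \<mu> (B \<times> B)}"]) simp
  next
    case 3
    define Q where "Q k \<longleftrightarrow> k > 0 \<and> (\<exists>Y. Y \<subseteq> Quo_e ?M \<and> finite Y \<and> card Y = k - 1
            \<and> complete_generating_set (Quo_e ?M) (Y \<union> {qu ?M y x | x y. (x, y) \<in> Edge ?M}))" for k :: nat
    have spp: "spp ?M = (LEAST k. Q k)" using 3 by (simp add: spp_def FM Q_def)
    have poM: "Partial_order ?M" by (rule Partial_order_class)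
    have EdgeM: "Edge ?M \<subseteq> B \<times> B" by (auto simp: Edge_def)
    have quM: "qu ?M y x = qcl ?M {(y, x)}" if "(x, y) \<in> Edge ?M" for x y
      using that EdgeM by (intro qu_eq_qcl[OF poM]) (auto simp: FM)
    have "Q (Suc (card (Quo_e ?M)))"
    proof -
      have "Quo_e ?M \<subseteq> Pow (B \<times> B)" using Quo_eD(1)[of _ ?M] unfolding FM by blast
      then have "finite (Quo_e ?M)" using finite_class[OF B] by (auto intro: finite_subset)
      moreover have "{qu ?M y x | x y. (x, y) \<in> Edge ?M} \<subseteq> Quo_e ?M"
        using quM EdgeM qcl_in_Quo_e[OF poM] unfolding FM by auto
      then have "Quo_e ?M \<union> {qu ?M y x | x y. (x, y) \<in> Edge ?M} = Quo_e ?M" by blast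
      moreover have "complete_generating_set (Quo_e ?M) (Quo_e ?M)"
        by (auto simp: complete_generating_set_def)
      ultimately show ?thesis unfolding Q_def by (intro conjI exI[of _ "Quo_e ?M"]) auto
    qed
    then have "Q (spp ?M)" unfolding spp by (rule LeastI)
    then obtain Y1 where Y1: "spp ?M > 0" "Y1 \<subseteq> Quo_e ?M" "finite Y1" "card Y1 = spp ?M - 1"
      "complete_generating_set (Quo_e ?M) (Y1 \<union> {qu ?M y x | x y. (x, y) \<in> Edge ?M})"
      unfolding Q_def by blast
    let ?G = "Y1 \<union> {qu ?M y x | x y. (x, y) \<in> Edge ?M}"
    have gen: "?G \<subseteq> Quo_e ?M" "Quo_e ?M \<subseteq> generated ?M ?G"
      using Y1(5) complete_generating_set_iff_generated[OF poM] by auto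
    let ?Z = "insert (qcl \<mu> (B \<times> B)) (qcl \<mu> ` Y1)"
    have QB: "\<rho> \<subseteq> B \<times> B" if "\<rho> \<in> Quo_e ?M" for \<rho> using Quo_eD(1)[OF that] unfolding FM .
    have absorb: "qcl \<mu> (qcl ?M R) = qcl \<mu> R" for R
    proof
      have "qcl ?M R \<subseteq> qcl \<mu> R"
        using qcl_upper(1)[of \<mu> R] qcl_upper(2)[of R \<mu>] by (intro qcl_least trans_qcl) auto
      then show "qcl \<mu> (qcl ?M R) \<subseteq> qcl \<mu> R" by (rule qcl_least[OF qcl_upper(1) _ trans_qcl])
      show "qcl \<mu> R \<subseteq> qcl \<mu> (qcl ?M R)" by (intro qcl_mono qcl_upper(2))
    qed
    have qM: "qcl \<mu> \<rho> = \<mu> \<union> \<rho>" if \<rho>: "\<rho> \<in> Quo_e ?M" for \<rho>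
    proof -
      have "trans (\<mu> \<union> \<rho>)"
      proof (rule transI)
        fix x y z assume xy: "(x, y) \<in> \<mu> \<union> \<rho>" and yz: "(y, z) \<in> \<mu> \<union> \<rho>"
        have iff: "x \<in> B \<longleftrightarrow> y \<in> B" "y \<in> B \<longleftrightarrow> z \<in> B"
          using xy yz QB[OF \<rho>] class_mu[OF B, of x y] class_mu[OF B, of y z] by auto
        show "(x, z) \<in> \<mu> \<union> \<rho>"
        proof (cases "y \<in> B")
          case True
          then have "(x, y) \<in> \<rho>" "(y, z) \<in> \<rho>" using xy yz iff Quo_eD(4)[OF \<rho>] by auto
          then show ?thesis using transD[OF Quo_eD(3)[OF \<rho>]] by blast
        next
          case False
          then have "(x, y) \<in> \<mu>" "(y, z) \<in> \<mu>" using xy yz QB[OF \<rho>] by auto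
          then show ?thesis using trans_mu by blast
        qed
      qed
      then show ?thesis using qcl_upper(1)[of \<mu> \<rho>] qcl_upper(2)[of \<rho> \<mu>]
        by (intro antisym qcl_least) auto
    qed
    have inner: "qcl \<mu> {(a, b)} \<in> generated \<mu> Y"
      if Y: "?Z \<subseteq> Y" and ed: "\<forall>(x, y)\<in>Edge \<mu>. x \<in> B \<longrightarrow> qcl \<mu> {(y, x)} \<in> generated \<mu> Y"
        and ab: "a \<in> B" "b \<in> B" for Y a b
    proof -
      have "qcl ?M {(a, b)} \<in> generated ?M ?G"
        using gen(2) qcl_in_Quo_e[OF poM, of "{(a, b)}"] ab by (auto simp: FM)
      then have "qcl \<mu> (qcl ?M {(a, b)}) \<in> generated \<mu> Y"
      proof (rule generated_transport[OF poM gen(1)])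
        show "qcl \<mu> \<rho> \<in> generated \<mu> Y" if "\<rho> \<in> ?G" for \<rho>
          using that
        proof
          assume "\<rho> \<in> Y1" then show ?thesis using Y by (auto intro: generated.base)
        next
          assume "\<rho> \<in> {qu ?M y x | x y. (x, y) \<in> Edge ?M}"
          then obtain x y where xy: "(x, y) \<in> Edge ?M" "\<rho> = qu ?M y x" by blast
          have "(x, y) \<in> Edge \<mu>" "x \<in> B"
            using xy(1) class_mu[OF B] by (auto simp: Edge_def)
          then have "qcl \<mu> {(y, x)} \<in> generated \<mu> Y" using ed by blast
          then show ?thesis unfolding xy(2) quM[OF xy(1)] absorb .
        qed
        show "qcl \<mu> (qcl ?M (\<Union>X)) = qcl \<mu> (\<Union>(qcl \<mu> ` X))" for X
          unfolding absorb using qcl_UN_absorb[of \<mu> "\<lambda>\<rho>. \<rho>" X] by simp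
        show "qcl \<mu> (\<Inter>X) = \<Inter>(qcl \<mu> ` X)" if X: "X \<subseteq> Quo_e ?M" "X \<noteq> {}" for X
        proof -
          have "\<Inter>X \<in> Quo_e ?M" by (rule Inter_in_Quo_e[OF X(2,1)])
          then have "qcl \<mu> (\<Inter>X) = \<mu> \<union> \<Inter>X" by (rule qM)
          also have "\<dots> = (\<Inter>\<rho>\<in>X. \<mu> \<union> \<rho>)" using X(2) by auto
          also have "\<dots> = (\<Inter>\<rho>\<in>X. qcl \<mu> \<rho>)" using qM X(1) by (intro INF_cong) auto
          finally show ?thesis .
        qed
      qed
      then show ?thesis unfolding absorb .
    qed
    have "card ?Z \<le> Suc (card (qcl \<mu> ` Y1))" using Y1(3) by (simp add: card_insert_le_m1 card_insert_if)
    also have "\<dots> \<le> spp ?M" using card_image_le[OF Y1(3), of "qcl \<mu>"] Y1(1,4) by simp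
    finally have "card ?Z \<le> spp ?M" .
    moreover have "?Z \<subseteq> Quo_e \<mu>"
    proof -
      have "qcl \<mu> \<rho> \<in> Quo_e \<mu>" if "\<rho> \<in> Y1" for \<rho>
        using QB[of \<rho>] that Y1(2) BF by (intro qcl_in_Quo_e[OF po]) auto
      then show ?thesis using nab by auto
    qed
    moreover have "qcl \<mu> (B \<times> B) \<in> generated \<mu> Y" if "?Z \<subseteq> Y" for Y
      using that by (auto intro: generated.base)
    ultimately show ?thesis using inner Y1(3) by (intro exI[of _ ?Z]) simp
  qed
qed

end


context finite_component_poset
begin

subsection \<open>Generating all quasiorders from few\<close>

lemma bottom_generated: "(a, b) \<in> \<mu> \<Longrightarrow> qcl \<mu> {(a, b)} \<in> generated \<mu> Y"
proof -
  assume "(a, b) \<in> \<mu>"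
  then have "qcl \<mu> {(a, b)} = qcl \<mu> (\<Union>{})" by (simp add: qcl_def insert_absorb)
  then show ?thesis using generated.join[of "{}"] by auto
qed

lemma max_elems_class: "B \<in> classes \<Longrightarrow> max_elems (Restr \<mu> B) \<subseteq> B \<and> max_elems (Restr \<mu> B) \<noteq> {}"
  and min_elems_class: "B \<in> classes \<Longrightarrow> min_elems (Restr \<mu> B) \<subseteq> B \<and> min_elems (Restr \<mu> B) \<noteq> {}"
proof -
  assume B: "B \<in> classes"
  then obtain x where x: "x \<in> B" using class_ne by blast
  then have xF: "x \<in> Field \<mu>" and cx: "cls x = B" using class_sub[OF B] class_of[OF B] by blast+
  obtain m where "m \<in> max_elems (Restr \<mu> (cls x))" using max_above[OF xF] by blast
  then show "max_elems (Restr \<mu> B) \<subseteq> B \<and> max_elems (Restr \<mu> B) \<noteq> {}"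
    unfolding cx using Field_Restr_class[OF B] by (auto simp: max_elems_def)
  obtain m where "m \<in> min_elems (Restr \<mu> (cls x))" using min_below[OF xF] by blast
  then show "min_elems (Restr \<mu> B) \<subseteq> B \<and> min_elems (Restr \<mu> B) \<noteq> {}"
    unfolding cx using Field_Restr_class[OF B] by (auto simp: min_elems_def)
qed

text \<open>
  A component is collapsed by a round trip through \<open>B1\<close>: up to a maximal element, across, down inside the collapsed \<open>B1\<close>, and back from the bottom.
  The same through \<open>B2\<close>; the meet of the two round trips affects neither of them.
\<close>

lemma generated_square:
  assumes B: "B1 \<in> classes" "B2 \<in> classes" "B1 \<noteq> B2"
    and top: "\<And>B C a m. B \<in> classes \<Longrightarrow> C \<in> {B1, B2} \<Longrightarrow> B \<noteq> C \<Longrightarrow> a \<in> max_elems (Restr \<mu> B) \<Longrightarrow>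
      m \<in> max_elems (Restr \<mu> C) \<Longrightarrow> qcl \<mu> {(a, m)} \<in> generated \<mu> Y"
    and bot: "\<And>B C a m. B \<in> classes \<Longrightarrow> C \<in> {B1, B2} \<Longrightarrow> B \<noteq> C \<Longrightarrow> a \<in> min_elems (Restr \<mu> B) \<Longrightarrow>
      m \<in> min_elems (Restr \<mu> C) \<Longrightarrow> qcl \<mu> {(m, a)} \<in> generated \<mu> Y"
    and square: "\<And>C. C \<in> {B1, B2} \<Longrightarrow> qcl \<mu> (C \<times> C) \<in> generated \<mu> Y"
    and D: "D \<in> classes"
  shows "qcl \<mu> (D \<times> D) \<in> generated \<mu> Y"
proof (cases "D \<in> {B1, B2}")
  case True then show ?thesis by (rule square)
next
  case False
  let ?S = "\<lambda>C. max_elems (Restr \<mu> D) \<times> max_elems (Restr \<mu> C) \<union> min_elems (Restr \<mu> C) \<times> min_elems (Restr \<mu> D)"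
  let ?N = "\<lambda>C. qcl \<mu> (C \<times> C \<union> ?S C)"
  have DC: "D \<noteq> C" "C \<in> classes" if "C \<in> {B1, B2}" for C using that False B by auto
  have N: "?N C \<in> generated \<mu> Y" if C: "C \<in> {B1, B2}" for C
  proof -
    have "qcl \<mu> (?S C) \<in> generated \<mu> Y"
    proof (rule qcl_in_generated)
      fix a b assume "(a, b) \<in> ?S C"
      then consider "a \<in> max_elems (Restr \<mu> D)" "b \<in> max_elems (Restr \<mu> C)"
        | "a \<in> min_elems (Restr \<mu> C)" "b \<in> min_elems (Restr \<mu> D)" by blast
      then show "qcl \<mu> {(a, b)} \<in> generated \<mu> Y"
        by cases (rule top[OF D C DC(1)[OF C]] bot[OF D C DC(1)[OF C]]; assumption)+
    qed
    then have "qcl \<mu> (qcl \<mu> (C \<times> C) \<union> qcl \<mu> (?S C)) \<in> generated \<mu> Y"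
      by (rule generated_Un[OF square[OF C]])
    moreover have "qcl \<mu> (qcl \<mu> (C \<times> C) \<union> qcl \<mu> (?S C)) = ?N C"
      using qcl_absorb[of \<mu> "C \<times> C" "qcl \<mu> (?S C)"] qcl_absorb[of \<mu> "?S C" "C \<times> C"]
      by (simp only: Un_commute)
    ultimately show ?thesis by simp
  qed
  have up: "?N C \<subseteq> \<mu> \<union> (C \<union> D) \<times> (C \<union> D)" if C: "C \<in> {B1, B2}" for C
  proof (rule qcl_least)
    have cl: "u \<in> C \<union> D \<longleftrightarrow> v \<in> C \<union> D" if "(u, v) \<in> \<mu>" for u v
      using class_mu[OF DC(2)[OF C] that] class_mu[OF D that] by simp
    show "trans (\<mu> \<union> (C \<union> D) \<times> (C \<union> D))"
    proof (rule transI)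
      fix u v w assume uv: "(u, v) \<in> \<mu> \<union> (C \<union> D) \<times> (C \<union> D)" and vw: "(v, w) \<in> \<mu> \<union> (C \<union> D) \<times> (C \<union> D)"
      show "(u, w) \<in> \<mu> \<union> (C \<union> D) \<times> (C \<union> D)"
        using uv vw cl[of u v] cl[of v w] trans_mu[of u v w] by (auto simp del: Un_iff simp add: Un_iff[of "(_, _)"])
    qed
    show "C \<times> C \<union> ?S C \<subseteq> \<mu> \<union> (C \<union> D) \<times> (C \<union> D)"
      using max_elems_class[OF D] max_elems_class[OF DC(2)[OF C]]
        min_elems_class[OF D] min_elems_class[OF DC(2)[OF C]] by blast
  qed blast
  have lo: "qcl \<mu> (D \<times> D) \<subseteq> ?N C" if C: "C \<in> {B1, B2}" for C
  proof (rule qcl_least[OF qcl_upper(1) _ trans_qcl])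
    show "D \<times> D \<subseteq> ?N C"
    proof (rule subrelI)
      fix a b assume "(a, b) \<in> D \<times> D"
      then have ab: "a \<in> D" "b \<in> D" by auto
      then have F: "a \<in> Field \<mu>" "b \<in> Field \<mu>" and c: "cls a = D" "cls b = D"
        using class_sub[OF D] class_of[OF D] by blast+
      obtain m where m: "(a, m) \<in> \<mu>" "m \<in> max_elems (Restr \<mu> D)" using max_above[OF F(1)] c by metis
      obtain n where n: "(n, b) \<in> \<mu>" "n \<in> min_elems (Restr \<mu> D)" using min_below[OF F(2)] c by metis
      obtain m' n' where mn: "m' \<in> max_elems (Restr \<mu> C)" "n' \<in> min_elems (Restr \<mu> C)" "m' \<in> C" "n' \<in> C"
        using max_elems_class[OF DC(2)[OF C]] min_elems_class[OF DC(2)[OF C]] by blast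
      have s: "(m, m') \<in> ?N C" "(m', n') \<in> ?N C" "(n', n) \<in> ?N C"
        using qcl_upper(2)[of "C \<times> C \<union> ?S C" \<mu>] m(2) n(2) mn by blast+
      have "(a, m) \<in> ?N C" "(n, b) \<in> ?N C" using m(1) n(1) qcl_upper(1)[of \<mu> "C \<times> C \<union> ?S C"] by blast+
      from qcl_trans[OF qcl_trans[OF qcl_trans[OF qcl_trans[OF this(1) s(1)] s(2)] s(3)] this(2)]
      show "(a, b) \<in> ?N C" .
    qed
  qed
  have dis: "B1 \<inter> B2 = {}" by (rule class_disjoint[OF B])
  have "?N B1 \<inter> ?N B2 \<subseteq> qcl \<mu> (D \<times> D)"
    unfolding qcl_class[OF D] using up[of B1] up[of B2] dis by blast
  moreover have "qcl \<mu> (D \<times> D) \<subseteq> ?N B1 \<inter> ?N B2" using lo[of B1] lo[of B2] by blast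
  ultimately have "qcl \<mu> (D \<times> D) = ?N B1 \<inter> ?N B2" by blast
  then show ?thesis using generated_Int[OF N[of B1] N[of B2]] by simp
qed

text \<open>
  Collapsing a single component isolates, from a quasiorder that reverses coverings in many components at once, its trace on that component. This produces all
  reversed coverings, then all pairs with one member in \<open>B1\<close> or \<open>B2\<close>, and finally the rest through two routes.
\<close>

lemma everything_generated:
  assumes B: "B1 \<in> classes" "B2 \<in> classes" "B1 \<noteq> B2"
    and top: "\<And>B C a m. B \<in> classes \<Longrightarrow> C \<in> {B1, B2} \<Longrightarrow> B \<noteq> C \<Longrightarrow> a \<in> max_elems (Restr \<mu> B) \<Longrightarrow>
      m \<in> max_elems (Restr \<mu> C) \<Longrightarrow> qcl \<mu> {(a, m)} \<in> generated \<mu> Y \<and> qcl \<mu> {(m, a)} \<in> generated \<mu> Y"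
    and bot: "\<And>B C a m. B \<in> classes \<Longrightarrow> C \<in> {B1, B2} \<Longrightarrow> B \<noteq> C \<Longrightarrow> a \<in> min_elems (Restr \<mu> B) \<Longrightarrow>
      m \<in> min_elems (Restr \<mu> C) \<Longrightarrow> qcl \<mu> {(a, m)} \<in> generated \<mu> Y \<and> qcl \<mu> {(m, a)} \<in> generated \<mu> Y"
    and square: "\<And>C. C \<in> {B1, B2} \<Longrightarrow> qcl \<mu> (C \<times> C) \<in> generated \<mu> Y"
    and edge: "\<And>x y. (x, y) \<in> Edge \<mu> \<Longrightarrow>
      \<exists>\<rho>\<in>generated \<mu> Y. (y, x) \<in> \<rho> \<and> \<mu> \<subseteq> \<rho> \<and> trans \<rho> \<and> \<rho> \<inter> cls x \<times> cls x \<subseteq> qcl \<mu> {(y, x)}"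
    and inner: "\<And>C a b. C \<in> {B1, B2} \<Longrightarrow> (\<forall>(x, y)\<in>Edge \<mu>. x \<in> C \<longrightarrow> qcl \<mu> {(y, x)} \<in> generated \<mu> Y) \<Longrightarrow>
      a \<in> C \<Longrightarrow> b \<in> C \<Longrightarrow> qcl \<mu> {(a, b)} \<in> generated \<mu> Y"
  shows "Quo_e \<mu> \<subseteq> generated \<mu> Y"
proof (rule Quo_e_subset_generated)
  have sq: "qcl \<mu> (D \<times> D) \<in> generated \<mu> Y" if D: "D \<in> classes" for D
  proof (rule generated_square[OF B _ _ square D])
    fix D C a m assume C: "D \<in> classes" "C \<in> {B1, B2}" "D \<noteq> C"
    show "qcl \<mu> {(a, m)} \<in> generated \<mu> Y" if "a \<in> max_elems (Restr \<mu> D)" "m \<in> max_elems (Restr \<mu> C)"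
      using top[OF C that] by (rule conjunct1)
    show "qcl \<mu> {(m, a)} \<in> generated \<mu> Y" if "a \<in> min_elems (Restr \<mu> D)" "m \<in> min_elems (Restr \<mu> C)"
      using bot[OF C that] by (rule conjunct2)
  qed
  have ed: "qcl \<mu> {(y, x)} \<in> generated \<mu> Y" if xy: "(x, y) \<in> Edge \<mu>" for x y
  proof -
    have F: "x \<in> Field \<mu>" using Edge_mu(1)[OF xy] mu_Field by blast
    obtain \<rho> where \<rho>: "\<rho> \<in> generated \<mu> Y" "(y, x) \<in> \<rho>" "\<mu> \<subseteq> \<rho>" "trans \<rho>" "\<rho> \<inter> cls x \<times> cls x \<subseteq> qcl \<mu> {(y, x)}"
      using edge[OF xy] by blast
    have in_x: "x \<in> cls x" "y \<in> cls x" using in_cls(1)[OF F] Edge_E xy by (auto simp: cls_def)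
    let ?q = "qcl \<mu> (cls x \<times> cls x)"
    have q: "?q = \<mu> \<union> cls x \<times> cls x" by (rule qcl_class[OF cls_classes[OF F]])
    have "qcl \<mu> {(y, x)} \<subseteq> \<rho> \<inter> ?q"
    proof (rule qcl_least)
      show "\<mu> \<subseteq> \<rho> \<inter> ?q" using \<rho>(3) unfolding q by blast
      show "{(y, x)} \<subseteq> \<rho> \<inter> ?q" using \<rho>(2) in_x unfolding q by blast
      show "trans (\<rho> \<inter> ?q)" by (rule trans_Int[OF \<rho>(4) trans_qcl])
    qed
    moreover have "\<rho> \<inter> ?q \<subseteq> qcl \<mu> {(y, x)}" unfolding q using \<rho>(5) qcl_upper(1)[of \<mu> "{(y, x)}"] by blast
    ultimately have "qcl \<mu> {(y, x)} = \<rho> \<inter> ?q" by blast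
    then show ?thesis using generated_Int[OF \<rho>(1) sq[OF cls_classes[OF F]]] by simp
  qed
  have down: "qcl \<mu> {(a, c)} \<in> generated \<mu> Y" if "(c, a) \<in> \<mu>" for a c
    using that ed by (rule below_generated)
  have cross: "qcl \<mu> {(a, b)} \<in> generated \<mu> Y"
    if F: "a \<in> Field \<mu>" "b \<in> Field \<mu>" and ne: "cls a \<noteq> cls b" and C: "cls a \<in> {B1, B2} \<or> cls b \<in> {B1, B2}" for a b
  proof -
    obtain c where c: "(c, a) \<in> \<mu>" "c \<in> min_elems (Restr \<mu> (cls a))" using min_below[OF F(1)] .
    obtain a' where a': "(a, a') \<in> \<mu>" "a' \<in> max_elems (Restr \<mu> (cls a))" using max_above[OF F(1)] .
    obtain d where d: "(d, b) \<in> \<mu>" "d \<in> min_elems (Restr \<mu> (cls b))" using min_below[OF F(2)] .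
    obtain b' where b': "(b, b') \<in> \<mu>" "b' \<in> max_elems (Restr \<mu> (cls b))" using max_above[OF F(2)] .
    note K = cls_classes[OF F(1)] cls_classes[OF F(2)]
    have cd: "qcl \<mu> {(c, d)} \<in> generated \<mu> Y \<and> qcl \<mu> {(a', b')} \<in> generated \<mu> Y"
      using C
    proof
      assume C: "cls a \<in> {B1, B2}"
      show ?thesis
        by (rule conjI[OF conjunct2[OF bot[OF K(2) C ne[symmetric] d(2) c(2)]] conjunct2[OF top[OF K(2) C ne[symmetric] b'(2) a'(2)]]])
    next
      assume C: "cls b \<in> {B1, B2}"
      show ?thesis
        by (rule conjI[OF conjunct1[OF bot[OF K(1) C ne c(2) d(2)]] conjunct1[OF top[OF K(1) C ne a'(2) b'(2)]]])
    qed
    have "(a, b) \<notin> E" using cls_eq[of a b] ne by argo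
    then show ?thesis
      by (rule cross_pair[OF down[OF c(1)] conjunct1[OF cd] conjunct2[OF cd] down[OF b'(1)] c(1) a'(1) d(1) b'(1)])
  qed
  fix a b assume F: "a \<in> Field \<mu>" "b \<in> Field \<mu>"
  show "qcl \<mu> {(a, b)} \<in> generated \<mu> Y"
  proof (cases "cls a \<in> {B1, B2} \<or> cls b \<in> {B1, B2}")
    case True
    show ?thesis
    proof (cases "cls a = cls b")
      case eq: True
      then have C: "cls a \<in> {B1, B2}" using True by auto
      have "a \<in> cls a" "b \<in> cls a" using in_cls(1)[OF F(1)] in_cls(1)[OF F(2)] eq by simp_all
      then show ?thesis using inner[OF C] ed by blast
    next
      case False then show ?thesis by (rule cross[OF F _ True])
    qed
  next
    case False
    obtain m m' where m: "m \<in> B1" "m' \<in> B2" using B class_ne by blast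
    then have mF: "m \<in> Field \<mu>" "m' \<in> Field \<mu>" using B class_sub by blast+
    have mc: "cls m = B1" "cls m' = B2" using m B class_of by blast+
    have ne: "cls a \<noteq> cls m" "cls a \<noteq> cls m'" "cls m \<noteq> cls b" "cls m' \<noteq> cls b" "cls m \<noteq> cls m'"
      using mc False B by auto
    have nE: "(m, m') \<notin> E" "(a, m) \<notin> E" "(a, m') \<notin> E" "(b, m) \<notin> E" "(b, m') \<notin> E"
      using cls_eq[of m m'] cls_eq[of a m] cls_eq[of a m'] cls_eq[of b m] cls_eq[of b m'] ne by metis+
    show ?thesis
      by (rule two_routes[OF cross[OF F(1) mF(1) ne(1)] cross[OF mF(1) F(2) ne(3)]
            cross[OF F(1) mF(2) ne(2)] cross[OF mF(2) F(2) ne(4)] F mF nE]) (simp_all add: mc)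
  qed
qed

subsection \<open>The thread number\<close>

lemma Edge_Restr_class: "B \<in> classes \<Longrightarrow> Edge (Restr \<mu> B) = Edge \<mu> \<inter> B \<times> B"
proof -
  assume B: "B \<in> classes"
  have "z \<in> B" if "x \<in> B" "(x, z) \<in> \<mu>" for x z using that class_mu[OF B] by blast
  then show ?thesis unfolding Edge_def by blast
qed

text \<open>
  Omitting two components leaves the other ones unchanged.
\<close>

lemma Comp_remainder:
  assumes B: "B1 \<in> classes" "B2 \<in> classes"
  shows "Comp (Restr \<mu> (Field \<mu> - (B1 \<union> B2))) = (\<lambda>B. Restr \<mu> B) ` (classes - {B1, B2})"
proof -
  let ?U = "B1 \<union> B2" and ?D = "Field \<mu> - (B1 \<union> B2)"
  let ?m = "Restr \<mu> ?D"
  have UE: "y \<in> ?U" if "(x, y) \<in> E" "x \<in> ?U" for x y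
    using that class_closed[OF B(1), of x y] class_closed[OF B(2), of x y] by blast
  have DE: "y \<in> ?D" if "(x, y) \<in> E" "x \<in> ?D" for x y
    using that UE[OF E_sym[OF that(1)]] E_Field[OF that(1)] by blast
  have FD: "Field ?m = ?D"
  proof
    show "?D \<subseteq> Field ?m"
    proof
      fix x assume "x \<in> ?D" then have "(x, x) \<in> ?m" using refl_mu by blast
      then show "x \<in> Field ?m" by (rule FieldI1)
    qed
  qed (auto simp: Field_def)
  have EdD: "Edge ?m = Edge \<mu> \<inter> ?D \<times> ?D"
  proof -
    have "z \<in> ?D" if "x \<in> ?D" "(x, z) \<in> \<mu>" for x z using DE[OF mu_E[OF that(2)] that(1)] .
    then show ?thesis unfolding Edge_def by blast
  qed
  have eq: "component_equiv ?m = E \<inter> ?D \<times> ?D"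
  proof
    have "equiv ?D (E \<inter> ?D \<times> ?D)"
    proof (rule equivI)
      show "refl_on ?D (E \<inter> ?D \<times> ?D)" using E_refl by (auto simp: refl_on_def)
      show "sym (E \<inter> ?D \<times> ?D)" by (rule symI) (use E_sym in blast)
      show "trans (E \<inter> ?D \<times> ?D)" by (rule transI) (use E_trans in blast)
    qed blast
    then show "component_equiv ?m \<subseteq> E \<inter> ?D \<times> ?D"
      unfolding component_equiv_def[of ?m] FD EdD using Edge_E by (intro Inter_lower) blast
    show "E \<inter> ?D \<times> ?D \<subseteq> component_equiv ?m"
      unfolding component_equiv_def[of ?m] FD EdD
    proof (rule Inter_greatest)
      fix \<theta> assume "\<theta> \<in> {\<theta>. equiv ?D \<theta> \<and> Edge \<mu> \<inter> ?D \<times> ?D \<subseteq> \<theta>}"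
      then have \<theta>: "equiv ?D \<theta>" "Edge \<mu> \<inter> ?D \<times> ?D \<subseteq> \<theta>" by auto
      then have \<theta>D: "\<theta> \<subseteq> ?D \<times> ?D" "\<And>x. x \<in> ?D \<Longrightarrow> (x, x) \<in> \<theta>"
        "\<And>x y. (x, y) \<in> \<theta> \<Longrightarrow> (y, x) \<in> \<theta>" "\<And>x y z. (x, y) \<in> \<theta> \<Longrightarrow> (y, z) \<in> \<theta> \<Longrightarrow> (x, z) \<in> \<theta>"
        by (auto simp: equiv_def refl_on_def dest: symD transD)
      let ?t = "\<theta> \<union> (E \<inter> ?U \<times> ?U)"
      have UF: "?U \<subseteq> Field \<mu>" using class_sub B by blast
      have "equiv (Field \<mu>) ?t"
      proof (rule equivI)
        show "?t \<subseteq> Field \<mu> \<times> Field \<mu>" using \<theta>D(1) UF by blast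
        show "refl_on (Field \<mu>) ?t" using \<theta>D(2) E_refl unfolding refl_on_def by blast
        show "sym ?t" by (rule symI) (use \<theta>D(3) E_sym in blast)
        show "trans ?t"
        proof (rule transI)
          fix x y z assume "(x, y) \<in> ?t" "(y, z) \<in> ?t"
          then consider "(x, y) \<in> \<theta>" "(y, z) \<in> \<theta>" | "(x, y) \<in> E" "(y, z) \<in> E" "x \<in> ?U" "z \<in> ?U"
            using \<theta>D(1) by blast
          then show "(x, z) \<in> ?t"
          proof cases
            case 1 then show ?thesis using \<theta>D(4)[of x y z] by simp
          next
            case 2 then show ?thesis using E_trans[of x y z] by simp
          qed
        qed
      qed
      moreover have "Edge \<mu> \<subseteq> ?t"
      proof (rule subrelI)
        fix x y assume xy: "(x, y) \<in> Edge \<mu>"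
        then have e: "(x, y) \<in> E" using Edge_E by blast
        show "(x, y) \<in> ?t"
        proof (cases "x \<in> ?U")
          case True then show ?thesis using UE[OF e] e by blast
        next
          case False
          then have "x \<in> ?D" using E_Field(1)[OF e] by blast
          then show ?thesis using DE[OF e] xy \<theta>(2) by blast
        qed
      qed
      ultimately have "E \<subseteq> ?t" unfolding component_equiv_def[of \<mu>] by (intro Inter_lower) simp
      then show "E \<inter> ?D \<times> ?D \<subseteq> \<theta>" by blast
    qed
  qed
  have img: "(E \<inter> ?D \<times> ?D) `` {x} = cls x" if "x \<in> ?D" for x
    using DE[of x] that unfolding cls_def by blast
  have "?D // component_equiv ?m = classes - {B1, B2}"
  proof
    show "?D // component_equiv ?m \<subseteq> classes - {B1, B2}"
    proof
      fix C assume "C \<in> ?D // component_equiv ?m"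
      then obtain x where x: "x \<in> ?D" "C = cls x" unfolding eq quotient_def using img by blast
      then have "x \<in> C" "C \<in> classes" using in_cls(1) cls_classes by blast+
      then show "C \<in> classes - {B1, B2}" using x(1) by blast
    qed
    show "classes - {B1, B2} \<subseteq> ?D // component_equiv ?m"
    proof
      fix C assume C: "C \<in> classes - {B1, B2}"
      then obtain x where x: "x \<in> Field \<mu>" "C = cls x" unfolding classes_def by blast
      have "x \<notin> ?U" using class_of B C x(2) by blast
      then have "x \<in> ?D" using x(1) by blast
      then show "C \<in> ?D // component_equiv ?m" unfolding eq quotient_def x(2) using img by blast
    qed
  qed
  then have "Comp ?m = (\<lambda>B. Restr ?m B) ` (classes - {B1, B2})" unfolding Comp_def FD by simp
  also have "\<dots> = (\<lambda>B. Restr \<mu> B) ` (classes - {B1, B2})"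
  proof (rule image_cong[OF refl])
    fix C assume C: "C \<in> classes - {B1, B2}"
    then have "C \<subseteq> ?D" using class_sub[of C] class_disjoint[of C] B by blast
    then show "Restr ?m C = Restr \<mu> C" by blast
  qed
  finally show ?thesis .
qed

lemma cmp_two_iff:
  assumes "B1 \<in> classes" "B2 \<in> classes" "B1 \<noteq> B2"
  shows "cmp \<mu> =o natLeq_on 2 \<longleftrightarrow> classes = {B1, B2}"
proof -
  have "finite (Comp \<mu>) = finite classes" unfolding Comp_eq by (rule finite_image_iff[OF Restr_class_inj])
  moreover have "card (Comp \<mu>) = card classes" unfolding Comp_eq by (rule card_image[OF Restr_class_inj])
  ultimately have *: "cmp \<mu> =o natLeq_on 2 \<longleftrightarrow> finite classes \<and> card classes = 2"
    unfolding cmp_def card_of_ordIso_natLeq_on by simp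
  have c2: "card {B1, B2} = 2" using assms(3) by simp
  show ?thesis
  proof
    assume "cmp \<mu> =o natLeq_on 2"
    then have h: "finite classes" "card classes = 2" using * by simp_all
    from card_subset_eq[OF h(1), of "{B1, B2}"] show "classes = {B1, B2}" using h(2) c2 assms(1,2) by simp
  next
    assume "classes = {B1, B2}"
    then show "cmp \<mu> =o natLeq_on 2" unfolding * using c2 by simp
  qed
qed

text \<open>
  The thread number counts transversals needed for the maximal and for the minimal elements; with two components there is nothing to
  choose in the others, and one position suffices.
\<close>

lemma thn_eq:
  assumes B: "B1 \<in> classes" "B2 \<in> classes" "B1 \<noteq> B2" and na: "\<not> antichain \<mu>"
  shows "\<exists>K L. 0 < K \<and> 0 < L \<and> (\<forall>B\<in>classes - {B1, B2}. card (max_elems (Restr \<mu> B)) \<le> K \<and> card (min_elems (Restr \<mu> B)) \<le> L)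
    \<and> thn \<mu> (Restr \<mu> B1) (Restr \<mu> B2) =
      K * (card (max_elems (Restr \<mu> B1)) * card (max_elems (Restr \<mu> B2))) +
      L * (card (min_elems (Restr \<mu> B1)) * card (min_elems (Restr \<mu> B2)))"
proof (cases "cmp \<mu> =o natLeq_on 2")
  case True
  then have "classes = {B1, B2}" using cmp_two_iff[OF B] by simp
  then show ?thesis using True na by (intro exI[of _ "1::nat"]) (simp add: thn_def)
next
  case False
  then obtain C where C: "C \<in> classes - {B1, B2}" using cmp_two_iff[OF B] B by blast
  obtain k where k: "\<forall>B\<in>classes. finite B \<and> card B \<le> k" using class_bound by blast
  let ?C = "(\<lambda>B. Restr \<mu> B) ` (classes - {B1, B2})"
  let ?F = "\<lambda>X. card (max_elems X)" and ?G = "\<lambda>X. card (min_elems X)"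
  have b: "?F (Restr \<mu> B) \<le> k \<and> ?G (Restr \<mu> B) \<le> k" if "B \<in> classes" for B
    using max_elems_class[OF that] min_elems_class[OF that] k that card_mono[of B] by (meson order_trans)
  have fin: "finite (?F ` ?C)" "finite (?G ` ?C)"
  proof -
    have "?F X \<le> k \<and> ?G X \<le> k" if X: "X \<in> ?C" for X
    proof -
      obtain D where D: "X = Restr \<mu> D" "D \<in> classes - {B1, B2}" using X by (elim imageE) (rule that)
      show ?thesis unfolding D(1) by (rule b[OF DiffD1[OF D(2)]])
    qed
    then have C_k: "?F ` ?C \<subseteq> {..k}" "?G ` ?C \<subseteq> {..k}" by (simp_all add: image_subset_iff)
    show "finite (?F ` ?C)" by (rule finite_subset[OF C_k(1) finite_atMost])
    show "finite (?G ` ?C)" by (rule finite_subset[OF C_k(2) finite_atMost])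
  qed
  have pos: "0 < ?F (Restr \<mu> C)" "0 < ?G (Restr \<mu> C)"
  proof -
    have Cc: "C \<in> classes" using C by (rule DiffD1)
    note M = max_elems_class[OF Cc] min_elems_class[OF Cc]
    have "finite (max_elems (Restr \<mu> C))" "finite (min_elems (Restr \<mu> C))"
      by (rule finite_subset[OF conjunct1[OF M(1)] finite_class[OF Cc]], rule finite_subset[OF conjunct1[OF M(2)] finite_class[OF Cc]])
    then show "0 < ?F (Restr \<mu> C)" "0 < ?G (Restr \<mu> C)"
      using conjunct2[OF M(1)] conjunct2[OF M(2)] by (simp_all add: card_gt_0_iff)
  qed
  have le: "?F (Restr \<mu> B) \<le> Max (?F ` ?C) \<and> ?G (Restr \<mu> B) \<le> Max (?G ` ?C)" if "B \<in> classes - {B1, B2}" for B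
    using that fin by (intro conjI Max_ge) auto
  have "thn \<mu> (Restr \<mu> B1) (Restr \<mu> B2) =
      Max (?F ` ?C) * (?F (Restr \<mu> B1) * ?F (Restr \<mu> B2)) + Max (?G ` ?C) * (?G (Restr \<mu> B1) * ?G (Restr \<mu> B2))"
    using False na by (simp add: thn_def Let_def Field_Restr_class[OF B(1)] Field_Restr_class[OF B(2)] Comp_remainder[OF B(1,2)])
  moreover have "0 < Max (?F ` ?C)" "0 < Max (?G ` ?C)" using le[OF C] pos by linarith+
  ultimately show ?thesis using le by (intro exI[of _ "Max (?F ` ?C)"] exI[of _ "Max (?G ` ?C)"]) simp
qed

subsection \<open>Upper bounds\<close>

lemma two_classes:
  assumes "natLeq_on 2 \<le>o cmp \<mu>" shows "\<exists>B1\<in>classes. \<exists>B2\<in>classes. B1 \<noteq> B2"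
proof -
  have "|Field (natLeq_on 2)| \<le>o |Field (cmp \<mu>)|" by (rule card_of_mono2[OF assms])
  then have "|{x::nat. x < 2}| \<le>o |Comp \<mu>|" by (simp add: Field_natLeq_on cmp_def Field_card_of)
  then obtain f where f: "inj_on f {x::nat. x < 2}" "f ` {x. x < 2} \<subseteq> Comp \<mu>"
    unfolding card_of_ordLeq[symmetric] by blast
  have f01: "f 0 \<in> Comp \<mu>" "f 1 \<in> Comp \<mu>" using f(2) by (simp_all add: image_subset_iff)
  have ne: "f 0 \<noteq> f 1" using inj_on_eq_iff[OF f(1), of 0 1] by simp
  obtain C1 where C1: "f 0 = Restr \<mu> C1" "C1 \<in> classes" using f01(1) unfolding Comp_eq by (elim imageE) (rule that)
  obtain C2 where C2: "f 1 = Restr \<mu> C2" "C2 \<in> classes" using f01(2) unfolding Comp_eq by (elim imageE) (rule that)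
  have "C1 \<noteq> C2" using C1(1) C2(1) ne by auto
  then show ?thesis using C1(2) C2(2) by blast
qed

text \<open>
  Every covering pair carries a nonempty set of labels, and one generator per label reverses all covering pairs with this label, in all
  components simultaneously. The hypothesis \<open>sep\<close> says that within a component the meet over the labels of a covering pair reverses this pair only.
\<close>

lemma generating_set_of_labelling:
  assumes acc: "accessible |Field \<mu>|" and two: "natLeq_on 2 \<le>o cmp \<mu>"
    and S: "\<And>e. e \<in> Edge \<mu> \<Longrightarrow> S e \<noteq> {} \<and> S e \<subseteq> {..<k::nat}"
    and sep: "\<And>x y. (x, y) \<in> Edge \<mu> \<Longrightarrow>
      (\<Inter>g\<in>S (x, y). qcl \<mu> {(v, u). (u, v) \<in> Edge \<mu> \<and> u \<in> cls x \<and> g \<in> S (u, v)}) \<inter> cls x \<times> cls x \<subseteq> qcl \<mu> {(y, x)}"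
  shows "\<exists>G. complete_generating_set (Quo_e \<mu>) G \<and> finite G \<and> card G \<le> cp \<mu> + k"
proof -
  let ?P = "\<lambda>n. \<exists>M1\<in>Comp \<mu>. \<exists>M2\<in>Comp \<mu>. M1 \<noteq> M2 \<and> n = f4 (cmp \<mu>) * thn \<mu> M1 M2 + spp M1 + spp M2"
  from two_classes[OF two] obtain C1 C2 where C: "C1 \<in> classes" "C2 \<in> classes" "C1 \<noteq> C2" by (elim bexE) (rule that)
  have C_Comp: "Restr \<mu> C1 \<in> Comp \<mu>" "Restr \<mu> C2 \<in> Comp \<mu>" unfolding Comp_eq by (rule imageI[OF C(1)], rule imageI[OF C(2)])
  have "Restr \<mu> C1 \<noteq> Restr \<mu> C2" using inj_onD[OF Restr_class_inj _ C(1,2)] C(3) by argo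
  then have "?P (f4 (cmp \<mu>) * thn \<mu> (Restr \<mu> C1) (Restr \<mu> C2) + spp (Restr \<mu> C1) + spp (Restr \<mu> C2))"
    by (intro bexI[OF _ C_Comp(1)] bexI[OF _ C_Comp(2)] conjI refl)
  then have "?P (cp \<mu>)" unfolding cp_def by (rule LeastI)
  then obtain M1 M2 where M: "M1 \<in> Comp \<mu>" "M2 \<in> Comp \<mu>" "M1 \<noteq> M2"
    "cp \<mu> = f4 (cmp \<mu>) * thn \<mu> M1 M2 + spp M1 + spp M2" by (elim bexE conjE) (rule that)
  obtain B1 where B1: "M1 = Restr \<mu> B1" "B1 \<in> classes" using M(1) unfolding Comp_eq by (elim imageE) (rule that)
  obtain B2 where B2: "M2 = Restr \<mu> B2" "B2 \<in> classes" using M(2) unfolding Comp_eq by (elim imageE) (rule that)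
  have B: "B1 \<in> classes" "B2 \<in> classes" "B1 \<noteq> B2" using B1 B2 M(3) by auto
  have cp: "cp \<mu> = f4 (cmp \<mu>) * thn \<mu> (Restr \<mu> B1) (Restr \<mu> B2) + spp (Restr \<mu> B1) + spp (Restr \<mu> B2)"
    using M(4) unfolding B1(1) B2(1) .
  show ?thesis
  proof (cases "antichain \<mu>")
    case True
    have \<mu>: "\<mu> = Id_on (Field \<mu>)"
    proof
      show "\<mu> \<subseteq> Id_on (Field \<mu>)"
      proof (rule subrelI)
        fix x y assume "(x, y) \<in> \<mu>"
        then show "(x, y) \<in> Id_on (Field \<mu>)" using True mu_Field[of x y] by (auto simp: antichain_def)
      qed
      show "Id_on (Field \<mu>) \<subseteq> \<mu>" using refl_mu by auto
    qed
    have "equiv (Field \<mu>) (Id_on (Field \<mu>))"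
      by (auto simp: equiv_def refl_on_def sym_def trans_def)
    moreover have "Edge \<mu> = {}" using True Edge_mu by (fastforce simp: antichain_def)
    ultimately have "E \<subseteq> Id_on (Field \<mu>)" unfolding component_equiv_def by (intro Inter_lower) simp
    then have "transversal (Field \<mu>)" unfolding transversal_def classes_def by auto
    from transversal_card[OF this] have f: "f4 |Field \<mu>| = f4 (cmp \<mu>)" by (rule f4_cong)
    obtain x y where xy: "x \<in> B1" "y \<in> B2" using class_ne B by blast
    have "x \<in> Field \<mu>" "y \<in> Field \<mu>" "x \<noteq> y"
      using xy B class_sub class_disjoint[OF B] by blast+
    from f4_generated[OF acc this] have "generated_by_at_most (f4 (cmp \<mu>)) (Field \<mu>)" unfolding f .
    then obtain G where "complete_generating_set (Quo_e (Id_on (Field \<mu>))) G" "finite G" "card G \<le> f4 (cmp \<mu>)"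
      unfolding generated_by_at_most_def by blast
    then have "complete_generating_set (Quo_e \<mu>) G" "finite G" "card G \<le> f4 (cmp \<mu>)" unfolding \<mu>[symmetric] .
    moreover have "thn \<mu> (Restr \<mu> B1) (Restr \<mu> B2) = 1" using True by (simp add: thn_def)
    ultimately show ?thesis unfolding cp by (intro exI[of _ G]) simp
  next
    case False
    from thn_eq[OF B False] obtain K L where KL: "0 < K" "0 < L"
      "\<forall>B\<in>classes - {B1, B2}. card (max_elems (Restr \<mu> B)) \<le> K \<and> card (min_elems (Restr \<mu> B)) \<le> L"
      "thn \<mu> (Restr \<mu> B1) (Restr \<mu> B2) =
        K * (card (max_elems (Restr \<mu> B1)) * card (max_elems (Restr \<mu> B2))) +
        L * (card (min_elems (Restr \<mu> B1)) * card (min_elems (Restr \<mu> B2)))"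
      by (elim exE conjE) (rule that)
    note K = KL(1,2) conjunct1[OF bspec[OF KL(3)]] conjunct2[OF bspec[OF KL(3)]] and thn = KL(4)
    obtain Z1 where Z1: "finite Z1" "Z1 \<subseteq> Quo_e \<mu>"
      "card Z1 \<le> f4 (cmp \<mu>) * (K * (card (max_elems (Restr \<mu> B1)) * card (max_elems (Restr \<mu> B2))))"
      "\<forall>B\<in>classes. \<forall>C\<in>{B1, B2}. B \<noteq> C \<longrightarrow> (\<forall>a\<in>max_elems (Restr \<mu> B). \<forall>m\<in>max_elems (Restr \<mu> C).
       qcl \<mu> {(a, m)} \<in> generated \<mu> Z1 \<and> qcl \<mu> {(m, a)} \<in> generated \<mu> Z1)"
      by (rule exE[OF threads_generate[OF acc B max_elems_class K(1,3)]], assumption, assumption, elim conjE) (rule that)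
    obtain Z2 where Z2: "finite Z2" "Z2 \<subseteq> Quo_e \<mu>"
      "card Z2 \<le> f4 (cmp \<mu>) * (L * (card (min_elems (Restr \<mu> B1)) * card (min_elems (Restr \<mu> B2))))"
      "\<forall>B\<in>classes. \<forall>C\<in>{B1, B2}. B \<noteq> C \<longrightarrow> (\<forall>a\<in>min_elems (Restr \<mu> B). \<forall>m\<in>min_elems (Restr \<mu> C).
       qcl \<mu> {(a, m)} \<in> generated \<mu> Z2 \<and> qcl \<mu> {(m, a)} \<in> generated \<mu> Z2)"
      by (rule exE[OF threads_generate[OF acc B min_elems_class K(2,4)]], assumption, assumption, elim conjE) (rule that)
    from spp_generators[OF B(1)] obtain Z3 where Z3: "finite Z3" "Z3 \<subseteq> Quo_e \<mu>" "card Z3 \<le> spp (Restr \<mu> B1)"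
      "\<forall>Y. Z3 \<subseteq> Y \<longrightarrow> qcl \<mu> (B1 \<times> B1) \<in> generated \<mu> Y \<and>
        ((\<forall>(x, y)\<in>Edge \<mu>. x \<in> B1 \<longrightarrow> qcl \<mu> {(y, x)} \<in> generated \<mu> Y) \<longrightarrow>
          (\<forall>a\<in>B1. \<forall>b\<in>B1. qcl \<mu> {(a, b)} \<in> generated \<mu> Y))"
      by (elim exE conjE) (rule that)
    note Z3' = conjunct1[OF mp[OF spec[OF Z3(4)]]] bspec[OF bspec[OF mp[OF conjunct2[OF mp[OF spec[OF Z3(4)]]]]]]
    from spp_generators[OF B(2)] obtain Z4 where Z4: "finite Z4" "Z4 \<subseteq> Quo_e \<mu>" "card Z4 \<le> spp (Restr \<mu> B2)"
      "\<forall>Y. Z4 \<subseteq> Y \<longrightarrow> qcl \<mu> (B2 \<times> B2) \<in> generated \<mu> Y \<and>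
        ((\<forall>(x, y)\<in>Edge \<mu>. x \<in> B2 \<longrightarrow> qcl \<mu> {(y, x)} \<in> generated \<mu> Y) \<longrightarrow>
          (\<forall>a\<in>B2. \<forall>b\<in>B2. qcl \<mu> {(a, b)} \<in> generated \<mu> Y))"
      by (elim exE conjE) (rule that)
    note Z4' = conjunct1[OF mp[OF spec[OF Z4(4)]]] bspec[OF bspec[OF mp[OF conjunct2[OF mp[OF spec[OF Z4(4)]]]]]]
    define R where "R g = {(v, u). (u, v) \<in> Edge \<mu> \<and> g \<in> S (u, v)}" for g
    define Y where "Y = Z1 \<union> Z2 \<union> Z3 \<union> Z4 \<union> (\<lambda>g. qcl \<mu> (R g)) ` {..<k}"
    have RF: "R g \<subseteq> Field \<mu> \<times> Field \<mu>" for g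
    proof (rule subrelI)
      fix v u assume "(v, u) \<in> R g"
      then have "(u, v) \<in> \<mu>" using Edge_mu by (auto simp: R_def)
      then show "(v, u) \<in> Field \<mu> \<times> Field \<mu>" using mu_Field by auto
    qed
    have YQ: "Y \<subseteq> Quo_e \<mu>"
      using Z1(2) Z2(2) Z3(2) Z4(2) qcl_in_Quo_e[OF po RF] by (auto simp: Y_def)
    have finY: "finite Y" using Z1(1) Z2(1) Z3(1) Z4(1) by (simp add: Y_def)
    have "card Y \<le> card Z1 + card Z2 + card Z3 + card Z4 + k"
    proof -
      have "card ((\<lambda>g. qcl \<mu> (R g)) ` {..<k}) \<le> k" using card_image_le[of "{..<k}" "\<lambda>g. qcl \<mu> (R g)"] by simp
      then show ?thesis unfolding Y_def
        using card_Un_le[of "Z1 \<union> Z2 \<union> Z3 \<union> Z4" "(\<lambda>g. qcl \<mu> (R g)) ` {..<k}"]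
          card_Un_le[of "Z1 \<union> Z2 \<union> Z3" Z4] card_Un_le[of "Z1 \<union> Z2" Z3] card_Un_le[of Z1 Z2] by linarith
    qed
    moreover have "card Z1 + card Z2 \<le> f4 (cmp \<mu>) * thn \<mu> (Restr \<mu> B1) (Restr \<mu> B2)"
      using Z1(3) Z2(3) unfolding thn distrib_left by (rule add_mono)
    ultimately have cardY: "card Y \<le> cp \<mu> + k" using Z3(3) Z4(3) unfolding cp by linarith
    have sub: "Z1 \<subseteq> Y" "Z2 \<subseteq> Y" "Z3 \<subseteq> Y" "Z4 \<subseteq> Y" by (auto simp: Y_def)
    have "Quo_e \<mu> \<subseteq> generated \<mu> Y"
    proof (rule everything_generated[OF B])
      show "qcl \<mu> {(a, m)} \<in> generated \<mu> Y \<and> qcl \<mu> {(m, a)} \<in> generated \<mu> Y"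
        if C: "D \<in> classes" "C \<in> {B1, B2}" "D \<noteq> C" "a \<in> max_elems (Restr \<mu> D)" "m \<in> max_elems (Restr \<mu> C)" for D C a m
      proof -
        note pairs = bspec[OF bspec[OF mp[OF bspec[OF bspec[OF Z1(4) C(1)] C(2)] C(3)] C(4)] C(5)]
        show ?thesis using subsetD[OF generated_mono[OF sub(1)]] pairs by simp
      qed
      show "qcl \<mu> {(a, m)} \<in> generated \<mu> Y \<and> qcl \<mu> {(m, a)} \<in> generated \<mu> Y"
        if C: "D \<in> classes" "C \<in> {B1, B2}" "D \<noteq> C" "a \<in> min_elems (Restr \<mu> D)" "m \<in> min_elems (Restr \<mu> C)" for D C a m
      proof -
        note pairs = bspec[OF bspec[OF mp[OF bspec[OF bspec[OF Z2(4) C(1)] C(2)] C(3)] C(4)] C(5)]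
        show ?thesis using subsetD[OF generated_mono[OF sub(2)]] pairs by simp
      qed
      show "qcl \<mu> (C \<times> C) \<in> generated \<mu> Y" if "C \<in> {B1, B2}" for C
        using that Z3'(1)[OF sub(3)] Z4'(1)[OF sub(4)] by auto
      show "qcl \<mu> {(a, b)} \<in> generated \<mu> Y"
        if C: "C \<in> {B1, B2}" and ed: "\<forall>(x, y)\<in>Edge \<mu>. x \<in> C \<longrightarrow> qcl \<mu> {(y, x)} \<in> generated \<mu> Y"
          and ab: "a \<in> C" "b \<in> C" for C a b
      proof -
        have "C = B1 \<or> C = B2" using C by blast
        then show ?thesis
        proof
          assume "C = B1" then show ?thesis using Z3'(2)[OF sub(3)] ed ab by simp
        next
          assume "C = B2" then show ?thesis using Z4'(2)[OF sub(4)] ed ab by simp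
        qed
      qed
      show "\<exists>\<rho>\<in>generated \<mu> Y. (y, x) \<in> \<rho> \<and> \<mu> \<subseteq> \<rho> \<and> trans \<rho> \<and> \<rho> \<inter> cls x \<times> cls x \<subseteq> qcl \<mu> {(y, x)}"
        if xy: "(x, y) \<in> Edge \<mu>" for x y
      proof -
        let ?r = "\<Inter>g\<in>S (x, y). qcl \<mu> (R g)"
        have r: "?r \<in> generated \<mu> Y"
        proof (rule generated_meet_family)
          show "S (x, y) \<noteq> {}" using S[OF xy] by blast
          show "qcl \<mu> (R g) \<in> generated \<mu> Y" if "g \<in> S (x, y)" for g
            using S[OF xy] that by (intro generated.base) (auto simp: Y_def)
        qed
        have rQ: "?r \<in> Quo_e \<mu>" by (rule generated_in_Quo_e[OF po YQ r])
        have yx: "(y, x) \<in> ?r"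
        proof (rule INT_I)
          fix g assume "g \<in> S (x, y)"
          then have "(y, x) \<in> R g" using xy by (simp add: R_def)
          then show "(y, x) \<in> qcl \<mu> (R g)" using qcl_upper(2) by blast
        qed
        have trace: "?r \<inter> cls x \<times> cls x \<subseteq> qcl \<mu> {(y, x)}"
        proof (rule order_trans[OF _ sep[OF xy]])
          have "x \<in> Field \<mu>" using Edge_mu(1)[OF xy] mu_Field by blast
          then have cx: "cls x \<in> classes" by (rule cls_classes)
          have local: "qcl \<mu> (R g) \<inter> cls x \<times> cls x \<subseteq> qcl \<mu> {(v, u). (u, v) \<in> Edge \<mu> \<and> u \<in> cls x \<and> g \<in> S (u, v)}" for g
          proof -
            have "R g \<subseteq> E"
            proof (rule subrelI)
              fix v u assume "(v, u) \<in> R g"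
              then have "(u, v) \<in> E" using Edge_E by (auto simp: R_def)
              then show "(v, u) \<in> E" by (rule E_sym)
            qed
            from qcl_within_class[OF this cx] show ?thesis
              by (rule order_trans) (rule qcl_mono, auto simp: R_def)
          qed
          show "?r \<inter> cls x \<times> cls x \<subseteq>
            (\<Inter>g\<in>S (x, y). qcl \<mu> {(v, u). (u, v) \<in> Edge \<mu> \<and> u \<in> cls x \<and> g \<in> S (u, v)}) \<inter> cls x \<times> cls x"
          proof (rule subsetI)
            fix p assume p: "p \<in> ?r \<inter> cls x \<times> cls x"
            have "p \<in> qcl \<mu> {(v, u). (u, v) \<in> Edge \<mu> \<and> u \<in> cls x \<and> g \<in> S (u, v)}" if "g \<in> S (x, y)" for g
              by (rule subsetD[OF local IntI[OF INT_D[OF IntD1[OF p] that] IntD2[OF p]]])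
            then show "p \<in> (\<Inter>g\<in>S (x, y). qcl \<mu> {(v, u). (u, v) \<in> Edge \<mu> \<and> u \<in> cls x \<and> g \<in> S (u, v)}) \<inter> cls x \<times> cls x"
              by (intro IntI[OF INT_I IntD2[OF p]])
          qed
        qed
        show ?thesis by (intro bexI[OF _ r] conjI yx Quo_eD(4)[OF rQ] Quo_eD(3)[OF rQ] trace)
      qed
    qed
    then have "complete_generating_set (Quo_e \<mu>) Y"
      using complete_generating_set_iff_generated[OF po] YQ by blast
    then show ?thesis using finY cardY by blast
  qed
qed

lemma edge_numbering:
  "\<exists>h. \<forall>B\<in>classes. inj_on h (Edge \<mu> \<inter> B \<times> B) \<and> h ` (Edge \<mu> \<inter> B \<times> B) \<subseteq> {..<ce \<mu>}"
proof -
  obtain k where k: "\<forall>B\<in>classes. finite B \<and> card B \<le> k" using class_bound by blast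
  have fin: "finite (Edge \<mu> \<inter> B \<times> B)" if "B \<in> classes" for B using k that by auto
  have bound: "card (Edge \<mu> \<inter> B \<times> B) \<le> k * k" if B: "B \<in> classes" for B
  proof -
    have "card (Edge \<mu> \<inter> B \<times> B) \<le> card (B \<times> B)" using k B by (intro card_mono) auto
    also have "\<dots> \<le> k * k" unfolding card_cartesian_product using k B by (intro mult_le_mono) auto
    finally show ?thesis .
  qed
  have fC: "finite ((\<lambda>X. card (Edge X)) ` Comp \<mu>)"
  proof (rule finite_subset[OF image_subsetI finite_atMost[of "k * k"]])
    fix X assume "X \<in> Comp \<mu>"
    then obtain D where D: "X = Restr \<mu> D" "D \<in> classes" unfolding Comp_eq by (elim imageE) (rule that)
    show "card (Edge X) \<in> {..k * k}" unfolding D(1) Edge_Restr_class[OF D(2)] using bound[OF D(2)] by simp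
  qed
  have le: "card (Edge \<mu> \<inter> B \<times> B) \<le> ce \<mu>" if B: "B \<in> classes" for B
  proof -
    have "card (Edge (Restr \<mu> B)) \<in> (\<lambda>X. card (Edge X)) ` Comp \<mu>" unfolding Comp_eq using B by blast
    then have "card (Edge (Restr \<mu> B)) \<le> ce \<mu>" unfolding ce_def by (rule Max_ge[OF fC])
    then show ?thesis by (simp add: Edge_Restr_class[OF B])
  qed
  have "\<exists>h. inj_on h (Edge \<mu> \<inter> B \<times> B) \<and> h ` (Edge \<mu> \<inter> B \<times> B) \<subseteq> {..<ce \<mu>}" if B: "B \<in> classes" for B
  proof -
    obtain h where h: "bij_betw h (Edge \<mu> \<inter> B \<times> B) {0..<card (Edge \<mu> \<inter> B \<times> B)}"
      using ex_bij_betw_finite_nat[OF fin[OF B]] by blast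
    then have "inj_on h (Edge \<mu> \<inter> B \<times> B)" "h ` (Edge \<mu> \<inter> B \<times> B) \<subseteq> {..<ce \<mu>}"
      using le[OF B] by (auto simp: bij_betw_def)
    then show ?thesis by blast
  qed
  then have "\<forall>B\<in>classes. \<exists>h. inj_on h (Edge \<mu> \<inter> B \<times> B) \<and> h ` (Edge \<mu> \<inter> B \<times> B) \<subseteq> {..<ce \<mu>}" by (rule ballI)
  from bchoice[OF this] obtain H where
    choice: "\<forall>B\<in>classes. inj_on (H B) (Edge \<mu> \<inter> B \<times> B) \<and> H B ` (Edge \<mu> \<inter> B \<times> B) \<subseteq> {..<ce \<mu>}" by (elim exE)
  note H = conjunct1[OF bspec[OF choice]] conjunct2[OF bspec[OF choice]]
  let ?h = "\<lambda>e. H (cls (fst e)) e"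
  have eq: "?h e = H B e" if "B \<in> classes" "e \<in> Edge \<mu> \<inter> B \<times> B" for B e
    using class_of[OF that(1), of "fst e"] that(2) by auto
  have "inj_on ?h (Edge \<mu> \<inter> B \<times> B) \<and> ?h ` (Edge \<mu> \<inter> B \<times> B) \<subseteq> {..<ce \<mu>}" if B: "B \<in> classes" for B
  proof
    have e: "inj_on ?h (Edge \<mu> \<inter> B \<times> B) \<longleftrightarrow> inj_on (H B) (Edge \<mu> \<inter> B \<times> B)"
      by (rule inj_on_cong[OF eq[OF B]])
    show "inj_on ?h (Edge \<mu> \<inter> B \<times> B)" unfolding e by (rule H(1)[OF B])
    have i: "?h ` (Edge \<mu> \<inter> B \<times> B) = H B ` (Edge \<mu> \<inter> B \<times> B)" by (rule image_cong[OF refl eq[OF B]])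
    show "?h ` (Edge \<mu> \<inter> B \<times> B) \<subseteq> {..<ce \<mu>}" unfolding i by (rule H(2)[OF B])
  qed
  then show ?thesis by (intro exI[of _ ?h] ballI)
qed

text \<open>
  Numbering the coverings of each component uses one label for each covering.
\<close>

theorem generating_set_cp_ce:
  assumes "accessible |Field \<mu>|" "natLeq_on 2 \<le>o cmp \<mu>"
  shows "\<exists>G. complete_generating_set (Quo_e \<mu>) G \<and> finite G \<and> card G \<le> cp \<mu> + ce \<mu>"
proof -
  from edge_numbering obtain h where
    numbering: "\<forall>B\<in>classes. inj_on h (Edge \<mu> \<inter> B \<times> B) \<and> h ` (Edge \<mu> \<inter> B \<times> B) \<subseteq> {..<ce \<mu>}" by (elim exE)
  note h = conjunct1[OF bspec[OF numbering]] conjunct2[OF bspec[OF numbering]]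
  have edge: "cls x \<in> classes" "(x, y) \<in> Edge \<mu> \<inter> cls x \<times> cls x" if xy: "(x, y) \<in> Edge \<mu>" for x y
  proof -
    have F: "x \<in> Field \<mu>" using Edge_mu(1)[OF xy] mu_Field by blast
    show "cls x \<in> classes" by (rule cls_classes[OF F])
    show "(x, y) \<in> Edge \<mu> \<inter> cls x \<times> cls x" using xy in_cls(1)[OF F] Edge_E by (auto simp: cls_def)
  qed
  show ?thesis
  proof (rule generating_set_of_labelling[OF assms, of "\<lambda>e. {h e}"])
    fix e assume e: "e \<in> Edge \<mu>"
    obtain x y where xy: "e = (x, y)" by (cases e)
    have e': "(x, y) \<in> Edge \<mu>" using e unfolding xy .
    have "h (x, y) \<in> {..<ce \<mu>}" by (rule subsetD[OF h(2)[OF edge(1)[OF e']] imageI[OF edge(2)[OF e']]])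
    then show "{h e} \<noteq> {} \<and> {h e} \<subseteq> {..<ce \<mu>}" unfolding xy by simp
  next
    fix x y assume xy: "(x, y) \<in> Edge \<mu>"
    have "{(v, u). (u, v) \<in> Edge \<mu> \<and> u \<in> cls x \<and> h (x, y) \<in> {h (u, v)}} \<subseteq> {(y, x)}"
    proof (rule subrelI)
      fix v u assume "(v, u) \<in> {(v, u). (u, v) \<in> Edge \<mu> \<and> u \<in> cls x \<and> h (x, y) \<in> {h (u, v)}}"
      then have uv: "(u, v) \<in> Edge \<mu>" "u \<in> cls x" "h (u, v) = h (x, y)" by auto
      have "cls u = cls x" by (rule class_of[OF edge(1)[OF xy] uv(2)])
      then have uv_x: "(u, v) \<in> Edge \<mu> \<inter> cls x \<times> cls x" using edge(2)[OF uv(1)] by simp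
      have "(u, v) = (x, y)" by (rule inj_onD[OF h(1)[OF edge(1)[OF xy]] uv(3) uv_x edge(2)[OF xy]])
      then show "(v, u) \<in> {(y, x)}" by simp
    qed
    from qcl_mono[OF this] show "(\<Inter>g\<in>{h (x, y)}. qcl \<mu> {(v, u). (u, v) \<in> Edge \<mu> \<and> u \<in> cls x \<and> g \<in> {h (u, v)}})
        \<inter> cls x \<times> cls x \<subseteq> qcl \<mu> {(y, x)}" by (simp add: le_infI1)
  qed
qed

end


section \<open>Antichains of sets\<close>

text \<open>
  Induction on the number of points: sum the inequality over the families of those members that miss a given point. A member of size \<open>s\<close> is counted
  \<open>card Y - s\<close> times, and the absorption identity for binomial coefficients turns the weights into the wanted ones.
\<close>

lemma LYM_inequality:
  assumes "finite Y" "A \<subseteq> Pow Y" "\<And>S T. S \<in> A \<Longrightarrow> T \<in> A \<Longrightarrow> S \<subseteq> T \<Longrightarrow> S = T"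
  shows "(\<Sum>S\<in>A. 1 / real (card Y choose card S)) \<le> 1"
  using assms
proof (induction "card Y" arbitrary: Y A)
  case 0
  then have "A \<subseteq> {{}}" by simp
  then consider "A = {}" | "A = {{}}" by blast
  then show ?case using 0 by cases simp_all
next
  case (Suc m)
  show ?case
  proof (cases "Y \<in> A")
    case True
    then have "A = {Y}" using Suc.prems(2,3) by blast
    then show ?thesis by simp
  next
    case False
    let ?f = "\<lambda>S. 1 / real (m choose card S)"
    have finA: "finite A" using Suc.prems(1,2) by (auto intro: finite_subset)
    have "(\<Sum>S\<in>{S. S \<in> A \<and> y \<notin> S}. ?f S) \<le> 1" if y: "y \<in> Y" for y
    proof -
      have c: "m = card (Y - {y})" using Suc.hyps(2) Suc.prems(1) y by simp
      have "(\<Sum>S\<in>{S. S \<in> A \<and> y \<notin> S}. 1 / real (card (Y - {y}) choose card S)) \<le> 1"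
      proof (rule Suc.hyps(1)[OF c])
        show "{S. S \<in> A \<and> y \<notin> S} \<subseteq> Pow (Y - {y})" using Suc.prems(2) by blast
        show "S = T" if "S \<in> {S. S \<in> A \<and> y \<notin> S}" "T \<in> {S. S \<in> A \<and> y \<notin> S}" "S \<subseteq> T" for S T
          using Suc.prems(3)[of S T] that by simp
      qed (use Suc.prems(1) in simp)
      then show ?thesis unfolding c[symmetric] .
    qed
    then have "(\<Sum>y\<in>Y. \<Sum>S\<in>{S. S \<in> A \<and> y \<notin> S}. ?f S) \<le> (\<Sum>y\<in>Y. 1)" by (intro sum_mono)
    also have "(\<Sum>y\<in>Y. (1::real)) = real (card Y)" by simp
    also have "(\<Sum>y\<in>Y. \<Sum>S\<in>{S. S \<in> A \<and> y \<notin> S}. ?f S) = (\<Sum>S\<in>A. \<Sum>y\<in>{y. y \<in> Y \<and> y \<notin> S}. ?f S)"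
      by (rule sum.swap_restrict[OF Suc.prems(1) finA])
    also have "\<dots> = (\<Sum>S\<in>A. real (card Y) * (1 / real (card Y choose card S)))"
    proof (rule sum.cong[OF refl])
      fix S assume S: "S \<in> A"
      then have SY: "S \<subset> Y" using Suc.prems(2) False by blast
      have less: "card S < card Y" by (rule psubset_card_mono[OF Suc.prems(1) SY])
      have "{y. y \<in> Y \<and> y \<notin> S} = Y - S" by blast
      then have c: "card {y. y \<in> Y \<and> y \<notin> S} = card Y - card S"
        using card_Diff_subset[OF finite_subset[OF psubset_imp_subset[OF SY] Suc.prems(1)] psubset_imp_subset[OF SY]] by simp
      have pos: "0 < m choose card S" "0 < card Y choose card S"
        using less Suc.hyps(2) by (simp_all add: zero_less_binomial_iff)
      have "(card Y - card S) * (card Y choose card S) = card Y * (m choose card S)"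
        using binomial_absorb_comp[of "card Y" "card S"] Suc.hyps(2) by (metis diff_Suc_1)
      then have "real (card Y - card S) * real (card Y choose card S) = real (card Y) * real (m choose card S)"
        by (metis of_nat_mult)
      then have "real (card Y - card S) * ?f S = real (card Y) * (1 / real (card Y choose card S))"
        using pos by (simp add: divide_simps)
      then show "(\<Sum>y\<in>{y. y \<in> Y \<and> y \<notin> S}. ?f S) = real (card Y) * (1 / real (card Y choose card S))"
        unfolding sum_constant c .
    qed
    also have "\<dots> = real (card Y) * (\<Sum>S\<in>A. 1 / real (card Y choose card S))"
      by (rule sum_distrib_left[symmetric])
    finally show ?thesis using Suc.hyps(2)[symmetric] by simp
  qed
qed

lemma Sperner:
  assumes "finite Y" "A \<subseteq> Pow Y" "\<And>S T. S \<in> A \<Longrightarrow> T \<in> A \<Longrightarrow> S \<subseteq> T \<Longrightarrow> S = T"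
  shows "card A \<le> card Y choose (card Y div 2)"
proof -
  let ?c = "card Y choose (card Y div 2)"
  have pos: "0 < ?c" by (simp add: zero_less_binomial_iff)
  have "real (card A) * (1 / real ?c) = (\<Sum>S\<in>A. 1 / real ?c)" by simp
  also have "\<dots> \<le> (\<Sum>S\<in>A. 1 / real (card Y choose card S))"
  proof (rule sum_mono)
    fix S assume "S \<in> A"
    then have "card S \<le> card Y" using assms(1,2) card_mono by blast
    then have "0 < card Y choose card S" by (simp add: zero_less_binomial_iff)
    then show "1 / real ?c \<le> 1 / real (card Y choose card S)"
      using binomial_maximum[of "card Y" "card S"] by (intro divide_left_mono) simp_all
  qed
  also have "\<dots> \<le> 1" by (rule LYM_inequality[OF assms])
  finally have "real (card A) \<le> real ?c" using pos by (simp add: divide_simps)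
  then show ?thesis by simp
qed

lemma LASp_bound:
  assumes "0 < n" shows "0 < LASp n" "n \<le> LASp n choose (LASp n div 2)"
proof -
  have "n choose 1 \<le> n choose (n div 2)" by (rule binomial_maximum)
  then have "n > 0 \<and> n \<le> n choose (n div 2)" using assms by simp
  then have "(LEAST k. k > 0 \<and> n \<le> k choose (k div 2)) > 0 \<and>
    n \<le> (LEAST k. k > 0 \<and> n \<le> k choose (k div 2)) choose ((LEAST k. k > 0 \<and> n \<le> k choose (k div 2)) div 2)"
    by (rule LeastI)
  moreover have "LASp n = (LEAST k. k > 0 \<and> n \<le> k choose (k div 2))" using assms by (simp add: LASp_def)
  ultimately have "LASp n > 0 \<and> n \<le> LASp n choose (LASp n div 2)" by simp
  then show "0 < LASp n" "n \<le> LASp n choose (LASp n div 2)" by simp_all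
qed

lemma LASp_least: "0 < n \<Longrightarrow> 0 < k \<Longrightarrow> n \<le> k choose (k div 2) \<Longrightarrow> LASp n \<le> k"
  unfolding LASp_def by (simp add: Least_le)

text \<open>
  Sets of the larger of the two middle sizes are used since they are nonempty even when only one label is available.
\<close>

lemma antichain_labels:
  "\<exists>L :: nat \<Rightarrow> nat set. inj_on L {..<n} \<and> (\<forall>i<n. L i \<noteq> {} \<and> L i \<subseteq> {..<LASp n}) \<and>
    (\<forall>i<n. \<forall>j<n. L i \<subseteq> L j \<longrightarrow> i = j)"
proof (cases "n = 0")
  case False
  define k where "k = LASp n"
  define m where "m = k - k div 2"
  have k: "0 < k" "n \<le> k choose (k div 2)" using LASp_bound False unfolding k_def by simp_all
  have m: "0 < m" using k(1) by (simp add: m_def)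
  let ?P = "{S. S \<subseteq> {..<k} \<and> card S = m}"
  have finP: "finite ?P" by (rule finite_subset[of _ "Pow {..<k}"]) auto
  have "card ?P = k choose m" using n_subsets[of "{..<k}" m] by simp
  also have "\<dots> = k choose (k div 2)" unfolding m_def by (rule binomial_symmetric[symmetric]) simp
  finally have "card {..<n} \<le> card ?P" using k(2) by simp
  then obtain L where L: "inj_on L {..<n}" "L ` {..<n} \<subseteq> ?P"
    using inj_on_iff_card_le[of "{..<n}" ?P] finP by auto
  have P: "L i \<subseteq> {..<k}" "card (L i) = m" if "i < n" for i using L(2) that by auto
  have "i = j" if ij: "i < n" "j < n" "L i \<subseteq> L j" for i j
  proof -
    have "finite (L j)" using P(1)[OF ij(2)] finite_subset by blast
    then have "L i = L j" using card_subset_eq[OF _ ij(3)] P(2) ij by simp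
    then show ?thesis using inj_onD[OF L(1)] ij by simp
  qed
  moreover have "L i \<noteq> {}" if "i < n" for i using P(2)[OF that] m by auto
  ultimately show ?thesis using L(1) P(1) unfolding k_def by (intro exI[of _ L]) blast
qed simp

section \<open>Forests\<close>

text \<open>
  A return to an earlier vertex is removed by cutting the path there.
\<close>

lemma distinct_path:
  assumes "(u, v) \<in> A\<^sup>*"
  shows "\<exists>vs. vs \<noteq> [] \<and> hd vs = u \<and> last vs = v \<and> distinct vs \<and> successively (\<lambda>a b. (a, b) \<in> A) vs"
  using assms
proof (induction rule: converse_rtrancl_induct)
  case base
  show ?case by (rule exI[of _ "[v]"]) simp
next
  case (step a b)
  then obtain vs where vs: "vs \<noteq> []" "hd vs = b" "last vs = v" "distinct vs" "successively (\<lambda>a b. (a, b) \<in> A) vs"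
    by blast
  show ?case
  proof (cases "a \<in> set vs")
    case True
    then obtain ps qs where pq: "vs = ps @ a # qs" using split_list by metis
    have "successively (\<lambda>a b. (a, b) \<in> A) (a # qs)" using vs(5) unfolding pq successively_append_iff by blast
    moreover have "distinct (a # qs)" "last (a # qs) = v" using vs(3,4) unfolding pq by simp_all
    ultimately show ?thesis by (intro exI[of _ "a # qs"]) simp
  next
    case False
    have "successively (\<lambda>a b. (a, b) \<in> A) (a # vs)"
      using vs(1,2,5) step(1) by (cases vs) simp_all
    then show ?thesis using vs False by (intro exI[of _ "a # vs"]) simp
  qed
qed

context finite_component_poset
begin

abbreviation adj where "adj \<equiv> Edge \<mu> \<union> (Edge \<mu>)\<inverse>"

lemma E_path: assumes "(u, v) \<in> E" shows "(u, v) \<in> adj\<^sup>*"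
proof -
  have F: "Edge \<mu> \<subseteq> Field \<mu> \<times> Field \<mu>" using Edge_E E_Field by auto
  have sym: "sym (adj\<^sup>*)" by (rule sym_rtrancl[OF sym_Un_converse])
  have "equiv (Field \<mu>) (adj\<^sup>* \<inter> Field \<mu> \<times> Field \<mu>)"
  proof (rule equivI)
    show "refl_on (Field \<mu>) (adj\<^sup>* \<inter> Field \<mu> \<times> Field \<mu>)" by (auto simp: refl_on_def)
    show "sym (adj\<^sup>* \<inter> Field \<mu> \<times> Field \<mu>)" using symD[OF sym] by (intro symI) simp
    show "trans (adj\<^sup>* \<inter> Field \<mu> \<times> Field \<mu>)"
      by (rule transI) (use transD[OF trans_rtrancl] in simp, meson rtrancl_trans)
  qed simp
  moreover have "Edge \<mu> \<subseteq> adj\<^sup>* \<inter> Field \<mu> \<times> Field \<mu>" using F by (auto intro: r_into_rtrancl)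
  ultimately have "E \<subseteq> adj\<^sup>* \<inter> Field \<mu> \<times> Field \<mu>" unfolding component_equiv_def by (intro Inter_lower) simp
  then show ?thesis using assms by blast
qed

text \<open>
  A side of the graph that the covering pair \<open>f\<close> enters from below and that no other covering pair leaves or enters.
\<close>

definition cut :: "'a \<times> 'a \<Rightarrow> 'a set \<Rightarrow> bool" where
  "cut f C \<longleftrightarrow> fst f \<notin> C \<and> snd f \<in> C \<and> (\<forall>(a, b)\<in>Edge \<mu>. (a, b) \<noteq> f \<longrightarrow> (a \<in> C \<longleftrightarrow> b \<in> C))"

lemma cutD:
  assumes "cut f C"
  shows "fst f \<notin> C" "snd f \<in> C" "(a, b) \<in> Edge \<mu> \<Longrightarrow> (a, b) \<noteq> f \<Longrightarrow> a \<in> C \<longleftrightarrow> b \<in> C"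
  using assms unfolding cut_def by auto

lemma cut_path:
  assumes C: "cut f C" and vs: "vs \<noteq> []" "successively (\<lambda>a b. (a, b) \<in> adj) vs" and u: "u \<notin> set vs" "u = fst f \<or> u = snd f"
  shows "hd vs \<in> C \<longleftrightarrow> last vs \<in> C"
  using vs u(1)
proof (induction vs)
  case (Cons a vs)
  show ?case
  proof (cases vs)
    case (Cons b ws)
    have "(a, b) \<in> adj" using Cons.prems(2) Cons by simp
    moreover have "(a, b) \<noteq> f" "(b, a) \<noteq> f" using Cons.prems(3) u(2) Cons by auto
    ultimately have "a \<in> C \<longleftrightarrow> b \<in> C" using cutD(3)[OF C, of a b] cutD(3)[OF C, of b a] by blast
    moreover have "hd vs \<in> C \<longleftrightarrow> last vs \<in> C" using Cons.IH Cons.prems Cons by simp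
    ultimately show ?thesis using Cons by simp
  qed simp
qed simp

text \<open>
  A path without repetitions cannot return across a cut, so each step down along a covering pair separates its ends by the cut of that pair. If this
  is excluded for all pairs but one, then all the other steps go up.
\<close>

lemma qcl_of_cuts:
  assumes cuts: "\<And>f. f \<in> Edge \<mu> \<Longrightarrow> cut f (C f)"
    and vs: "vs \<noteq> []" "successively (\<lambda>a b. (a, b) \<in> adj) vs" "distinct vs"
    and F: "hd vs \<in> Field \<mu>"
    and sides: "\<And>f. f \<in> Edge \<mu> \<Longrightarrow> f \<noteq> (x, y) \<Longrightarrow> (hd vs, fst f) \<in> E \<Longrightarrow> hd vs \<in> C f \<Longrightarrow> last vs \<in> C f"
  shows "(hd vs, last vs) \<in> qcl \<mu> {(y, x)}"
  using vs F sides
proof (induction vs)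
  case (Cons u vs)
  show ?case
  proof (cases vs)
    case Nil
    then show ?thesis using refl_mu Cons.prems(4) qcl_upper(1)[of \<mu> "{(y, x)}"] by auto
  next
    case vs: (Cons w ws)
    have uw: "(u, w) \<in> adj" using Cons.prems(2) vs by simp
    have ne: "vs \<noteq> []" "hd vs = w" "last (u # vs) = last vs" using vs by simp_all
    have uv: "u \<notin> set vs" "distinct vs" using Cons.prems(3) by simp_all
    have suc: "successively (\<lambda>a b. (a, b) \<in> adj) vs" using Cons.prems(2) vs by simp
    have E: "(u, w) \<in> E" using uw Edge_E E_sym by blast
    have side: "w \<in> C f \<longleftrightarrow> last vs \<in> C f" if f: "f \<in> Edge \<mu>" "u = fst f \<or> u = snd f" for f
      using cut_path[OF cuts[OF f(1)] ne(1) suc uv(1) f(2)] ne(2) by simp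
    have IH: "(w, last vs) \<in> qcl \<mu> {(y, x)}"
    proof -
      have "(hd vs, last vs) \<in> qcl \<mu> {(y, x)}"
      proof (rule Cons.IH[OF ne(1) suc uv(2)])
        show "hd vs \<in> Field \<mu>" using E_Field(2)[OF E] ne(2) by simp
        fix f assume f: "f \<in> Edge \<mu>" "f \<noteq> (x, y)" "(hd vs, fst f) \<in> E" "hd vs \<in> C f"
        show "last vs \<in> C f"
        proof (cases "u = fst f \<or> u = snd f")
          case True then show ?thesis using side[OF f(1) True] f(4) ne(2) by simp
        next
          case False
          then have "(u, w) \<noteq> f" "(w, u) \<noteq> f" by auto
          then have "u \<in> C f" using cutD(3)[OF cuts[OF f(1)], of u w] cutD(3)[OF cuts[OF f(1)], of w u] uw f(4) ne(2) by blast
          moreover have "(u, fst f) \<in> E" using E_trans[OF E] f(3) ne(2) by simp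
          ultimately show ?thesis using Cons.prems(5)[OF f(1,2)] ne(3) by simp
        qed
      qed
      then show ?thesis using ne(2) by simp
    qed
    have "(u, w) \<in> qcl \<mu> {(y, x)}"
    proof (cases "(u, w) \<in> Edge \<mu>")
      case True then show ?thesis using Edge_mu(1) qcl_upper(1)[of \<mu> "{(y, x)}"] by blast
    next
      case False
      then have wu: "(w, u) \<in> Edge \<mu>" using uw by blast
      have "w \<notin> C (w, u)" "u \<in> C (w, u)" using cutD(1,2)[OF cuts[OF wu]] by simp_all
      moreover from this have "last vs \<notin> C (w, u)" using side[OF wu] by simp
      ultimately have "(w, u) = (x, y)" using Cons.prems(5)[OF wu] E ne(3) by auto
      then show ?thesis using qcl_upper(2)[of "{(y, x)}" \<mu>] by simp
    qed
    then show ?thesis using qcl_trans[OF _ IH] ne(3) by simp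
  qed
qed simp

text \<open>
  A generator whose label is not a label of \<open>f\<close> respects the cut of \<open>f\<close>. If the sets of labels form an antichain, such a label exists for every other covering pair.
\<close>

lemma separation_of_cuts:
  assumes cuts: "\<And>f. f \<in> Edge \<mu> \<Longrightarrow> cut f (C f)" and xy: "(x, y) \<in> Edge \<mu>"
    and S: "\<And>f. f \<in> Edge \<mu> \<Longrightarrow> fst f \<in> cls x \<Longrightarrow> S (x, y) \<subseteq> S f \<Longrightarrow> f = (x, y)"
  shows "(\<Inter>g\<in>S (x, y). qcl \<mu> {(v, u). (u, v) \<in> Edge \<mu> \<and> u \<in> cls x \<and> g \<in> S (u, v)}) \<inter> cls x \<times> cls x \<subseteq> qcl \<mu> {(y, x)}"
proof (rule subrelI)
  let ?F = "\<lambda>g. qcl \<mu> {(v, u). (u, v) \<in> Edge \<mu> \<and> u \<in> cls x \<and> g \<in> S (u, v)}"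
  fix u v assume uv: "(u, v) \<in> (\<Inter>g\<in>S (x, y). ?F g) \<inter> cls x \<times> cls x"
  then have xu: "(x, u) \<in> E" "(x, v) \<in> E" using in_cls(2) by blast+
  have E: "(u, v) \<in> E" using E_trans[OF E_sym[OF xu(1)] xu(2)] .
  from distinct_path[OF E_path[OF E]] obtain vs where vs: "vs \<noteq> []" "hd vs = u" "last vs = v" "distinct vs"
    "successively (\<lambda>a b. (a, b) \<in> adj) vs" by blast
  have "(hd vs, last vs) \<in> qcl \<mu> {(y, x)}"
  proof (rule qcl_of_cuts[OF cuts vs(1,5,4)])
    show "hd vs \<in> Field \<mu>" using E_Field(1)[OF E] vs(2) by simp
    fix f assume f: "f \<in> Edge \<mu>" "f \<noteq> (x, y)" "(hd vs, fst f) \<in> E" "hd vs \<in> C f"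
    have "fst f \<in> cls x" using E_trans[OF xu(1)] f(3) vs(2) by (simp add: cls_def)
    then obtain g where g: "g \<in> S (x, y)" "g \<notin> S f" using S[OF f(1)] f(2) by blast
    let ?Q = "{(a, b). a \<in> C f \<longrightarrow> b \<in> C f}"
    have "?F g \<subseteq> ?Q"
    proof (rule qcl_least)
      have EQ: "b \<in> C f" if "(a, b) \<in> Edge \<mu>" "a \<in> C f" for a b
        using cutD[OF cuts[OF f(1)]] that by (cases "(a, b) = f") auto
      show "\<mu> \<subseteq> ?Q"
      proof (rule subrelI)
        fix a b assume "(a, b) \<in> \<mu>"
        from mu_Edge_path[OF this] have "a \<in> C f \<longrightarrow> b \<in> C f"
          by (induction rule: rtrancl_induct) (use EQ in blast)+
        then show "(a, b) \<in> ?Q" by simp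
      qed
      show "{(v, u). (u, v) \<in> Edge \<mu> \<and> u \<in> cls x \<and> g \<in> S (u, v)} \<subseteq> ?Q"
      proof (rule subrelI)
        fix b a assume "(b, a) \<in> {(v, u). (u, v) \<in> Edge \<mu> \<and> u \<in> cls x \<and> g \<in> S (u, v)}"
        then have "(a, b) \<in> Edge \<mu>" "(a, b) \<noteq> f" using g(2) by auto
        from cutD(3)[OF cuts[OF f(1)] this] show "(b, a) \<in> ?Q" by simp
      qed
      show "trans ?Q" by (rule transI) simp
    qed
    moreover have "(u, v) \<in> ?F g" using uv g(1) by blast
    ultimately show "last vs \<in> C f" using f(4) vs(2,3) by blast
  qed
  then show "(u, v) \<in> qcl \<mu> {(y, x)}" using vs(2,3) by simp
qed

text \<open>
  Removing an edge of a forest disconnects its ends, since another connection would close a circle.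
\<close>

lemma forest_cut:
  assumes forest: "forest \<mu>" and f: "f \<in> Edge \<mu>"
  shows "cut f {z. (snd f, z) \<in> (adj - {f, (snd f, fst f)})\<^sup>*}"
proof -
  obtain x y where fxy: "f = (x, y)" by (cases f)
  let ?A = "adj - {(x, y), (y, x)}"
  have xy: "(x, y) \<in> Edge \<mu>" "x \<noteq> y" using f Edge_mu(2) unfolding fxy by blast+
  have G: "{a, b} \<in> graph_edges \<mu>" if "(a, b) \<in> adj" for a b
    using that unfolding graph_edges_def by (auto simp: insert_commute)
  have "(y, x) \<notin> ?A\<^sup>*"
  proof
    assume "(y, x) \<in> ?A\<^sup>*"
    from distinct_path[OF this] obtain vs where vs: "vs \<noteq> []" "hd vs = y" "last vs = x" "distinct vs"
      "successively (\<lambda>a b. (a, b) \<in> ?A) vs" by blast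
    have "length vs \<noteq> 1" using vs(1-3) xy(2) by (auto simp: length_Suc_conv One_nat_def)
    moreover have "length vs \<noteq> 2"
      using vs(2,3,5) by (auto simp: length_Suc_conv numeral_2_eq_2)
    moreover have "length vs \<noteq> 0" using vs(1) by simp
    ultimately have len: "3 \<le> length vs" by linarith
    have "{vs ! i, vs ! (Suc i mod length vs)} \<in> graph_edges \<mu>" if i: "i < length vs" for i
    proof (cases "Suc i < length vs")
      case True
      then have "(vs ! i, vs ! Suc i) \<in> adj" using vs(5) unfolding successively_conv_nth by blast
      then show ?thesis using True G by simp
    next
      case False
      then have i': "Suc i = length vs" "i = length vs - 1" using i by simp_all
      have "vs ! i = x" "vs ! 0 = y" using vs(1-3) i'(2) by (simp_all add: last_conv_nth hd_conv_nth)
      then show ?thesis using G[of x y] xy(1) i'(1) by simp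
    qed
    then have "is_circle \<mu> vs" using len vs(4) by (simp add: is_circle_def)
    then show False using forest by (auto simp: forest_def)
  qed
  moreover have "a \<in> {z. (y, z) \<in> ?A\<^sup>*} \<longleftrightarrow> b \<in> {z. (y, z) \<in> ?A\<^sup>*}" if ab: "(a, b) \<in> Edge \<mu>" "(a, b) \<noteq> (x, y)" for a b
  proof -
    have "(a, b) \<noteq> (y, x)"
    proof
      assume "(a, b) = (y, x)"
      then have "(y, x) \<in> \<mu>" "(x, y) \<in> \<mu>" using ab(1) xy(1) Edge_mu(1) by auto
      then show False using antisym_mu xy(2) by blast
    qed
    then have "(a, b) \<in> ?A" "(b, a) \<in> ?A" using ab by auto
    then show ?thesis using rtrancl_into_rtrancl[of y a ?A b] rtrancl_into_rtrancl[of y b ?A a] by blast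
  qed
  ultimately show ?thesis unfolding cut_def fxy by auto
qed

lemma edge_labelling:
  "\<exists>S. (\<forall>e\<in>Edge \<mu>. S e \<noteq> {} \<and> S e \<subseteq> {..<LASp (ce \<mu>)}) \<and>
    (\<forall>x y. (x, y) \<in> Edge \<mu> \<longrightarrow> (\<forall>f\<in>Edge \<mu>. fst f \<in> cls x \<longrightarrow> S (x, y) \<subseteq> S f \<longrightarrow> f = (x, y)))"
proof -
  from edge_numbering obtain h where
    numbering: "\<forall>B\<in>classes. inj_on h (Edge \<mu> \<inter> B \<times> B) \<and> h ` (Edge \<mu> \<inter> B \<times> B) \<subseteq> {..<ce \<mu>}" by (elim exE)
  note h = conjunct1[OF bspec[OF numbering]] conjunct2[OF bspec[OF numbering]]
  from antichain_labels[of "ce \<mu>"] obtain L :: "nat \<Rightarrow> nat set" where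
    labels: "\<forall>i<ce \<mu>. L i \<noteq> {} \<and> L i \<subseteq> {..<LASp (ce \<mu>)}"
      "\<forall>i<ce \<mu>. \<forall>j<ce \<mu>. L i \<subseteq> L j \<longrightarrow> i = j" by (elim exE conjE) (rule that)
  note L = mp[OF spec[OF labels(1)]] mp[OF mp[OF spec[OF mp[OF spec[OF labels(2)]]]]]
  have edge: "cls (fst e) \<in> classes" "e \<in> Edge \<mu> \<inter> cls (fst e) \<times> cls (fst e)" if e: "e \<in> Edge \<mu>" for e
  proof -
    obtain x y where xy: "e = (x, y)" by (cases e)
    have F: "x \<in> Field \<mu>" using Edge_mu(1)[of x y] e mu_Field unfolding xy by blast
    show "cls (fst e) \<in> classes" using cls_classes[OF F] by (simp add: xy)
    show "e \<in> Edge \<mu> \<inter> cls (fst e) \<times> cls (fst e)" using e in_cls(1)[OF F] Edge_E by (auto simp: cls_def xy)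
  qed
  have hce: "h e < ce \<mu>" if "e \<in> Edge \<mu>" for e using h(2)[OF edge(1)[OF that]] edge(2)[OF that] by blast
  have "f = (x, y)" if e: "(x, y) \<in> Edge \<mu>" and f: "f \<in> Edge \<mu>" "fst f \<in> cls x" and sub: "L (h (x, y)) \<subseteq> L (h f)" for x y f
  proof -
    have c: "cls x \<in> classes" "(x, y) \<in> Edge \<mu> \<inter> cls x \<times> cls x" using edge[OF e] by simp_all
    have "cls (fst f) = cls x" by (rule class_of[OF c(1) f(2)])
    then have "f \<in> Edge \<mu> \<inter> cls x \<times> cls x" using edge(2)[OF f(1)] by simp
    moreover have "h f = h (x, y)" using L(2)[OF hce[OF e] hce[OF f(1)] sub] by simp
    ultimately show ?thesis using inj_onD[OF h(1)[OF c(1)], of f "(x, y)"] c(2) by blast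
  qed
  then show ?thesis using L(1) hce by (intro exI[of _ "\<lambda>e. L (h e)"]) blast
qed

theorem generating_set_forest:
  assumes "accessible |Field \<mu>|" "natLeq_on 2 \<le>o cmp \<mu>" "forest \<mu>"
  shows "\<exists>G. complete_generating_set (Quo_e \<mu>) G \<and> finite G \<and> card G \<le> cp \<mu> + LASp (ce \<mu>)"
proof -
  from edge_labelling obtain S where labels: "\<forall>e\<in>Edge \<mu>. S e \<noteq> {} \<and> S e \<subseteq> {..<LASp (ce \<mu>)}"
    "\<forall>x y. (x, y) \<in> Edge \<mu> \<longrightarrow> (\<forall>f\<in>Edge \<mu>. fst f \<in> cls x \<longrightarrow> S (x, y) \<subseteq> S f \<longrightarrow> f = (x, y))"
    by (elim exE conjE) (rule that)
  note S = bspec[OF labels(1)] mp[OF mp[OF bspec[OF mp[OF spec[OF spec[OF labels(2)]]]]]]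
  show ?thesis
    by (rule generating_set_of_labelling[OF assms(1,2) S(1)]; (assumption | rule separation_of_cuts[OF forest_cut[OF assms(3)] _ S(2)]))
qed

section \<open>Finite chains\<close>

context
  assumes lin: "Linear_order \<mu>" and fin: "finite (Field \<mu>)"
begin

lemma chain_total: "x \<in> Field \<mu> \<Longrightarrow> y \<in> Field \<mu> \<Longrightarrow> (x, y) \<in> \<mu> \<or> (y, x) \<in> \<mu>"
  using lin refl_mu[of x] unfolding linear_order_on_def total_on_def by (cases "x = y") simp_all

lemma chain_cls: "x \<in> Field \<mu> \<Longrightarrow> cls x = Field \<mu>"
proof -
  assume x: "x \<in> Field \<mu>"
  have "(x, y) \<in> E" if "y \<in> Field \<mu>" for y using chain_total[OF x that] mu_E E_sym by blast
  then show ?thesis using E_Field unfolding cls_def by blast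
qed

lemma chain_Edge:
  assumes xy: "(x, y) \<in> Edge \<mu>" and z: "z \<in> Field \<mu>"
  shows "(y, z) \<in> \<mu> \<longleftrightarrow> (z, x) \<notin> \<mu>"
proof -
  have F: "x \<in> Field \<mu>" "y \<in> Field \<mu>" and le: "(x, y) \<in> \<mu>" "x \<noteq> y" using xy Edge_mu mu_Field by blast+
  have no: "z = x \<or> z = y" if "(x, z) \<in> \<mu>" "(z, y) \<in> \<mu>" using xy that unfolding Edge_def by blast
  have "\<not> ((y, z) \<in> \<mu> \<and> (z, x) \<in> \<mu>)" using trans_mu[of y z x] antisym_mu[OF le(1)] le(2) by blast
  moreover have "(y, z) \<in> \<mu> \<or> (z, x) \<in> \<mu>"
    using chain_total[OF F(1) z] chain_total[OF F(2) z] no refl_mu[OF F(1)] refl_mu[OF F(2)] by blast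
  ultimately show ?thesis by blast
qed

text \<open>
  In a chain, the upper end of a covering pair generates a filter, and no other covering crosses its boundary.
\<close>

lemma chain_cut:
  assumes f: "f \<in> Edge \<mu>" shows "cut f {z. (snd f, z) \<in> \<mu>}"
proof -
  obtain x y where fxy: "f = (x, y)" by (cases f)
  have xy: "(x, y) \<in> Edge \<mu>" using f fxy by simp
  then have F: "x \<in> Field \<mu>" "y \<in> Field \<mu>" and le: "(x, y) \<in> \<mu>" "x \<noteq> y" using Edge_mu mu_Field by blast+
  have "(y, x) \<notin> \<mu>" using antisym_mu le by blast
  moreover have "(y, a) \<in> \<mu> \<longleftrightarrow> (y, b) \<in> \<mu>" if ab: "(a, b) \<in> Edge \<mu>" "(a, b) \<noteq> (x, y)" for a b
  proof
    have lab: "(a, b) \<in> \<mu>" by (rule Edge_mu(1)[OF ab(1)])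
    then have Fab: "a \<in> Field \<mu>" "b \<in> Field \<mu>" using mu_Field by blast+
    show "(y, b) \<in> \<mu>" if "(y, a) \<in> \<mu>" by (rule trans_mu[OF that lab])
    assume yb: "(y, b) \<in> \<mu>"
    show "(y, a) \<in> \<mu>"
    proof (rule ccontr)
      assume "(y, a) \<notin> \<mu>"
      then have ax: "(a, x) \<in> \<mu>" using chain_Edge[OF xy Fab(1)] by blast
      have "(b, x) \<notin> \<mu>" "(y, a) \<notin> \<mu>" using chain_Edge[OF xy Fab(2)] yb \<open>(y, a) \<notin> \<mu>\<close> by blast+
      moreover have "(b, x) \<in> \<mu> \<or> (x, a) \<in> \<mu>" "(b, y) \<in> \<mu> \<or> (y, a) \<in> \<mu>"
        using chain_Edge[OF ab(1) F(1)] chain_Edge[OF ab(1) F(2)] by blast+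
      ultimately have "(x, a) \<in> \<mu>" "(b, y) \<in> \<mu>" by blast+
      then have "a = x" "b = y" using ax yb antisym_mu by blast+
      then show False using ab(2) by simp
    qed
  qed
  moreover have "(y, y) \<in> \<mu>" by (rule refl_mu[OF F(2)])
  ultimately show ?thesis unfolding cut_def fxy by auto
qed

lemma chain_generated:
  "\<exists>G. complete_generating_set (Quo_e \<mu>) G \<and> finite G \<and> card G \<le> LASp (ce \<mu>)"
proof -
  let ?k = "LASp (ce \<mu>)"
  from edge_labelling obtain S where labels: "\<forall>e\<in>Edge \<mu>. S e \<noteq> {} \<and> S e \<subseteq> {..<?k}"
    "\<forall>x y. (x, y) \<in> Edge \<mu> \<longrightarrow> (\<forall>f\<in>Edge \<mu>. fst f \<in> cls x \<longrightarrow> S (x, y) \<subseteq> S f \<longrightarrow> f = (x, y))"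
    by (elim exE conjE) (rule that)
  note S = bspec[OF labels(1)] mp[OF mp[OF bspec[OF mp[OF spec[OF spec[OF labels(2)]]]]]]
  define R where "R g = {(v, u). (u, v) \<in> Edge \<mu> \<and> g \<in> S (u, v)}" for g
  let ?G = "(\<lambda>g. qcl \<mu> (R g)) ` {..<?k}"
  have EF: "x \<in> Field \<mu> \<and> y \<in> Field \<mu>" if "(x, y) \<in> Edge \<mu>" for x y
    using Edge_mu(1)[OF that] mu_Field[of x y] by simp
  have "R g \<subseteq> Field \<mu> \<times> Field \<mu>" for g using EF unfolding R_def by auto
  then have GQ: "?G \<subseteq> Quo_e \<mu>" using qcl_in_Quo_e[OF po] by blast
  have ed: "qcl \<mu> {(y, x)} \<in> generated \<mu> ?G" if xy: "(x, y) \<in> Edge \<mu>" for x y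
  proof -
    have cx: "cls x = Field \<mu>" using chain_cls EF[OF xy] by blast
    let ?r = "\<Inter>g\<in>S (x, y). qcl \<mu> (R g)"
    have r: "?r \<in> generated \<mu> ?G"
    proof (rule generated_meet_family)
      show "S (x, y) \<noteq> {}" using S(1)[OF xy] by blast
      show "qcl \<mu> (R g) \<in> generated \<mu> ?G" if "g \<in> S (x, y)" for g
        using S(1)[OF xy] that by (intro generated.base) blast
    qed
    have rQ: "?r \<in> Quo_e \<mu>" by (rule generated_in_Quo_e[OF po GQ r])
    have "(\<Inter>g\<in>S (x, y). qcl \<mu> {(v, u). (u, v) \<in> Edge \<mu> \<and> u \<in> cls x \<and> g \<in> S (u, v)}) \<inter> cls x \<times> cls x \<subseteq> qcl \<mu> {(y, x)}"
      by (rule separation_of_cuts[OF chain_cut xy S(2)[OF xy]])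
    moreover have "{(v, u). (u, v) \<in> Edge \<mu> \<and> u \<in> cls x \<and> g \<in> S (u, v)} = R g" for g
      using EF unfolding R_def cx by auto
    ultimately have "?r \<inter> Field \<mu> \<times> Field \<mu> \<subseteq> qcl \<mu> {(y, x)}" unfolding cx by simp
    then have "?r \<subseteq> qcl \<mu> {(y, x)}" using Quo_eD(1)[OF rQ] by blast
    moreover have "qcl \<mu> {(y, x)} \<subseteq> ?r"
    proof (rule qcl_least[OF Quo_eD(4)[OF rQ] _ Quo_eD(3)[OF rQ]])
      have "(y, x) \<in> qcl \<mu> (R g)" if "g \<in> S (x, y)" for g
        using that xy qcl_upper(2)[of "R g" \<mu>] unfolding R_def by blast
      then show "{(y, x)} \<subseteq> ?r" by blast
    qed
    ultimately show ?thesis using r by simp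
  qed
  have "Quo_e \<mu> \<subseteq> generated \<mu> ?G"
  proof (rule Quo_e_subset_generated)
    fix a b assume "a \<in> Field \<mu>" "b \<in> Field \<mu>"
    then consider "(a, b) \<in> \<mu>" | "(b, a) \<in> \<mu>" using chain_total by blast
    then show "qcl \<mu> {(a, b)} \<in> generated \<mu> ?G"
    proof cases
      case 1 then show ?thesis by (rule bottom_generated)
    next
      case 2 then show ?thesis using ed by (rule below_generated)
    qed
  qed
  then have "complete_generating_set (Quo_e \<mu>) ?G"
    using complete_generating_set_iff_generated[OF po] GQ by blast
  moreover have "card ?G \<le> ?k" using card_image_le[of "{..<?k}" "\<lambda>g. qcl \<mu> (R g)"] by simp
  ultimately show ?thesis by (intro exI[of _ ?G]) simp
qed

lemma chain_ce: "ce \<mu> = card (Edge \<mu>)"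
proof -
  obtain C n where "C \<in> Chains \<mu>" "card C = n + (1::nat)"
    using fcs unfolding finite_component_size_def finite_length_def by blast
  then obtain c where "c \<in> C" "(c, c) \<in> \<mu>" unfolding Chains_def by (cases "C = {}") auto
  then have c: "c \<in> Field \<mu>" using mu_Field by blast
  have "classes = {Field \<mu>}" unfolding classes_def using c chain_cls by auto
  moreover have "Restr \<mu> (Field \<mu>) = \<mu>" using mu_Field by auto
  ultimately show ?thesis unfolding ce_def Comp_eq by simp
qed

text \<open>
  A join reverses a covering pair of a chain only if a member does: otherwise the filter above the covering is a cut for all the members.
\<close>

lemma reversed_edge_in_join:
  assumes xy: "(x, y) \<in> Edge \<mu>" and X: "X \<subseteq> Quo_e \<mu>" and join: "(y, x) \<in> qcl \<mu> (\<Union>X)"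
  shows "\<exists>\<rho>\<in>X. (y, x) \<in> \<rho>"
proof (rule ccontr)
  assume no: "\<not> ?thesis"
  let ?Q = "{(u, v). (y, u) \<in> \<mu> \<longrightarrow> (y, v) \<in> \<mu>}"
  have "qcl \<mu> (\<Union>X) \<subseteq> ?Q"
  proof (rule qcl_least)
    show "\<mu> \<subseteq> ?Q" using trans_mu by blast
    show "trans ?Q" by (rule transI) simp
    show "\<Union>X \<subseteq> ?Q"
    proof (rule Union_least, rule subrelI)
      fix \<rho> u v assume \<rho>: "\<rho> \<in> X" and uv: "(u, v) \<in> \<rho>"
      have Q: "\<rho> \<in> Quo_e \<mu>" using X \<rho> by blast
      have "(y, v) \<in> \<mu>" if yu: "(y, u) \<in> \<mu>"
      proof (rule ccontr)
        assume "(y, v) \<notin> \<mu>"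
        moreover have "v \<in> Field \<mu>" using Quo_eD(1)[OF Q] uv by blast
        ultimately have "(v, x) \<in> \<mu>" using chain_Edge[OF xy] by blast
        then have "(y, u) \<in> \<rho>" "(v, x) \<in> \<rho>" using yu Quo_eD(4)[OF Q] by blast+
        then have "(y, x) \<in> \<rho>" using transD[OF Quo_eD(3)[OF Q] transD[OF Quo_eD(3)[OF Q] _ uv]] by blast
        then show False using no \<rho> by blast
      qed
      then show "(u, v) \<in> ?Q" by simp
    qed
  qed
  then have "(y, y) \<in> \<mu> \<longrightarrow> (y, x) \<in> \<mu>" using join by blast
  moreover have le: "(x, y) \<in> \<mu>" "x \<noteq> y" using Edge_mu[OF xy] by blast+
  ultimately show False using refl_mu[OF mu_Field(2)[OF le(1)]] antisym_mu[OF le(1)] by blast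
qed

text \<open>
  The quasiorders that contain \<open>p\<close> whenever they reverse the given covering are closed under joins and meets.
\<close>

lemma reversed_edge_generated:
  assumes Y: "Y \<subseteq> Quo_e \<mu>" and \<rho>: "\<rho> \<in> generated \<mu> Y" and xy: "(x, y) \<in> Edge \<mu>" and yx: "(y, x) \<in> \<rho>"
    and p: "\<And>\<sigma>. \<sigma> \<in> Y \<Longrightarrow> (y, x) \<in> \<sigma> \<Longrightarrow> p \<in> \<sigma>"
  shows "p \<in> \<rho>" "\<exists>\<sigma>\<in>Y. (y, x) \<in> \<sigma>"
proof -
  have "(y, x) \<in> \<rho> \<longrightarrow> p \<in> \<rho> \<and> (\<exists>\<sigma>\<in>Y. (y, x) \<in> \<sigma>)"
    using \<rho>
  proof (induction rule: generated.induct)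
    case (base \<rho>)
    then show ?case using p by blast
  next
    case (join X)
    have XQ: "X \<subseteq> Quo_e \<mu>" using join generated_in_Quo_e[OF po Y] by blast
    show ?case
    proof
      assume "(y, x) \<in> qcl \<mu> (\<Union>X)"
      from reversed_edge_in_join[OF xy XQ this] obtain \<sigma> where \<sigma>: "\<sigma> \<in> X" "(y, x) \<in> \<sigma>" by blast
      then have "p \<in> \<sigma>" "\<exists>\<sigma>\<in>Y. (y, x) \<in> \<sigma>" using join by blast+
      then show "p \<in> qcl \<mu> (\<Union>X) \<and> (\<exists>\<sigma>\<in>Y. (y, x) \<in> \<sigma>)" using \<sigma>(1) qcl_upper(2)[of "\<Union>X" \<mu>] by blast
    qed
  next
    case (meet X)
    then show ?case by blast
  qed
  then show "p \<in> \<rho>" "\<exists>\<sigma>\<in>Y. (y, x) \<in> \<sigma>" using yx by blast+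
qed

text \<open>
  The traces of the reversed coverings on a generating set form an antichain: an inclusion between two of them would persist in everything that is generated, including the least
  quasiorder that reverses the first covering. The bound is then Sperner's theorem.
\<close>

lemma chain_lower_bound:
  assumes Y: "complete_generating_set (Quo_e \<mu>) Y" "finite Y"
  shows "LASp (ce \<mu>) \<le> card Y"
proof (cases "ce \<mu> = 0")
  case True
  then show ?thesis by (simp add: LASp_def)
next
  case False
  have Yg: "Y \<subseteq> Quo_e \<mu>" "Quo_e \<mu> \<subseteq> generated \<mu> Y"
    using Y(1) complete_generating_set_iff_generated[OF po] by blast+
  have EF: "x \<in> Field \<mu> \<and> y \<in> Field \<mu>" if "(x, y) \<in> Edge \<mu>" for x y
    using Edge_mu(1)[OF that] mu_Field[of x y] by simp
  have q: "qcl \<mu> {(y, x)} \<in> generated \<mu> Y" "(y, x) \<in> qcl \<mu> {(y, x)}" if xy: "(x, y) \<in> Edge \<mu>" for x y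
  proof -
    have "qcl \<mu> {(y, x)} \<in> Quo_e \<mu>" using EF[OF xy] by (intro qcl_in_Quo_e[OF po]) auto
    then show "qcl \<mu> {(y, x)} \<in> generated \<mu> Y" using Yg(2) by blast
    show "(y, x) \<in> qcl \<mu> {(y, x)}" using qcl_upper(2)[of "{(y, x)}" \<mu>] by blast
  qed
  define T where "T e = {\<sigma> \<in> Y. (snd e, fst e) \<in> \<sigma>}" for e
  have anti: "e = e'" if e: "e \<in> Edge \<mu>" "e' \<in> Edge \<mu>" and sub: "T e \<subseteq> T e'" for e e'
  proof -
    obtain x y x' y' where ee: "e = (x, y)" "e' = (x', y')" by (cases e, cases e')
    note xy = e[unfolded ee]
    have "(y', x') \<in> qcl \<mu> {(y, x)}"
    proof (rule reversed_edge_generated(1)[OF Yg(1) q(1)[OF xy(1)] xy(1) q(2)[OF xy(1)]])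
      fix \<sigma> assume "\<sigma> \<in> Y" "(y, x) \<in> \<sigma>"
      then show "(y', x') \<in> \<sigma>" using sub unfolding T_def ee by auto
    qed
    moreover have "(y', x') \<notin> \<mu>" using antisym_mu[of x' y'] Edge_mu[OF xy(2)] by blast
    ultimately have le: "(y', y) \<in> \<mu>" "(x, x') \<in> \<mu>"
      using EF[OF xy(1)] unfolding qcl_single[OF po conjunct2[OF EF[OF xy(1)]] conjunct1[OF EF[OF xy(1)]]] by auto
    have "(x', y) \<in> \<mu>" "(x, y') \<in> \<mu>"
      using trans_mu[OF Edge_mu(1)[OF xy(2)] le(1)] trans_mu[OF le(2) Edge_mu(1)[OF xy(2)]] by blast+
    then have "x' = x \<or> x' = y" "y' = x \<or> y' = y" using le xy(1) unfolding Edge_def by blast+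
    moreover have "x' \<noteq> y" using le(1) Edge_mu[OF xy(2)] antisym_mu by blast
    moreover have "y' \<noteq> x" using le(2) Edge_mu[OF xy(2)] antisym_mu by blast
    ultimately show ?thesis unfolding ee by blast
  qed
  have "inj_on T (Edge \<mu>)" using anti by (intro inj_onI) simp
  then have "ce \<mu> = card (T ` Edge \<mu>)" unfolding chain_ce by (simp add: card_image)
  also have "\<dots> \<le> card Y choose (card Y div 2)"
  proof (rule Sperner[OF Y(2)])
    show "T ` Edge \<mu> \<subseteq> Pow Y" by (auto simp: T_def)
    show "U = V" if UV: "U \<in> T ` Edge \<mu>" "V \<in> T ` Edge \<mu>" "U \<subseteq> V" for U V
    proof -
      obtain e e' where "e \<in> Edge \<mu>" "U = T e" "e' \<in> Edge \<mu>" "V = T e'" using UV(1,2) by blast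
      then show ?thesis using anti[of e e'] UV(3) by simp
    qed
  qed
  finally have le: "ce \<mu> \<le> card Y choose (card Y div 2)" .
  have "Edge \<mu> \<noteq> {}" using False unfolding chain_ce by auto
  then obtain x y where xy: "(x, y) \<in> Edge \<mu>" by auto
  have "\<exists>\<sigma>\<in>Y. (y, x) \<in> \<sigma>"
    by (rule reversed_edge_generated(2)[OF Yg(1) q(1)[OF xy] xy q(2)[OF xy], of "(y, x)"])
  then have "0 < card Y" using Y(2) by (auto simp: card_gt_0_iff)
  then show ?thesis using LASp_least[OF _ _ le] False by simp
qed

end

end

section \<open>The generation theorem\<close>

theorem theorem2p4:
  fixes \<mu> :: "'a rel"
  assumes "Partial_order \<mu>"
    and "finite_component_size \<mu>"
    and "accessible |Field \<mu>|"
  shows "(natLeq_on 2 \<le>o cmp \<mu> \<longrightarrow>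
            (\<exists>E. complete_generating_set (Quo_e \<mu>) E \<and> finite E \<and> card E \<le> cp \<mu> + ce \<mu>))
       \<and> (forest \<mu> \<and> natLeq_on 2 \<le>o cmp \<mu> \<longrightarrow>
            (\<exists>E. complete_generating_set (Quo_e \<mu>) E \<and> finite E \<and> card E \<le> cp \<mu> + LASp (ce \<mu>)))
       \<and> (Linear_order \<mu> \<and> finite (Field \<mu>) \<longrightarrow>
            n_generated (int (LASp (ce \<mu>))) (Quo_e \<mu>)
            \<and> \<not> n_generated (int (LASp (ce \<mu>)) - 1) (Quo_e \<mu>))"
proof -
  interpret finite_component_poset \<mu> by standard (rule assms(1,2))+
  have "n_generated (int (LASp (ce \<mu>))) (Quo_e \<mu>) \<and> \<not> n_generated (int (LASp (ce \<mu>)) - 1) (Quo_e \<mu>)"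
    if chain: "Linear_order \<mu>" "finite (Field \<mu>)"
  proof
    show "n_generated (int (LASp (ce \<mu>))) (Quo_e \<mu>)"
      using chain_generated[OF chain] unfolding n_generated_def by auto
    show "\<not> n_generated (int (LASp (ce \<mu>)) - 1) (Quo_e \<mu>)"
      using chain_lower_bound[OF chain] unfolding n_generated_def by fastforce
  qed
  then show ?thesis
    using generating_set_cp_ce[OF assms(3)] generating_set_forest[OF assms(3)] by simp
qed

end
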